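(* Let $L\ge M\ge 0$ be integers with $L\ge 1$, let $\mathbb T=\mathbb T_{L,M}$ be the $L\times M$ tube, let $W=(L+1)(M+1)$, let $\mathcal F_{\mathbb T}(f)$ be the free energy of polygons in $\mathbb T$ subject to a force $f$, and let $\beta^{\mathrm F}_{\mathbb T}$ be the exponential growth rate of full $s$-blocks of $\mathbb T$. Then in the limit $f\to-\infty$ the free energy is asymptotic to $(\beta^{\mathrm F}_{\mathbb T}+f)/W$, that is, $$\lim_{f\to-\infty}\left(\mathcal F_{\mathbb T}(f)-\frac fW\right)=\frac{\beta^{\mathrm F}_{\mathbb T}}{W}.$$
   Context: The tube is $\mathbb T=\mathbb T_{L,M}=\{(x,y,z)\in\mathbb Z^3: x\ge 0,\ 0\le y\le L,\ 0\le z\le M\}$, with edges joining vertices at unit distance. A self-avoiding polygon is a finite subgraph of the cubic lattice $\mathbb Z^3$ that is a simple closed curve (connected, every vertex of degree 2; unrooted and unoriented); its length is its number of edges. $\mathcal P_{\mathbb T}$ is the set of self-avoiding polygons in $\mathbb T$ which occupy at least one vertex in the plane $x=0$ (polygons differing by a translation in the $y$ or $z$ directions are counted as distinct). The span $s(\pi)$ of $\pi\in\mathcal P_{\mathbb T}$ is the maximal $x$-coordinate of its vertices. Let $p_{\mathbb T,n}(s)$ be the number of polygons in $\mathcal P_{\mathbb T}$ with $n$ edges and span $s$, and $Z_{\mathbb T,n}(f)=\sum_s p_{\mathbb T,n}(s)e^{fs}$. The free energy is $\mathcal F_{\mathbb T}(f)=\lim_{n\to\infty}\frac1n\log Z_{\mathbb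 T,n}(f)$, where $n$ runs through even values only; this limit is known to exist for all real $f$. Blocks. Given a polygon $\pi$ in $\mathbb T$, its hinge $H_k$ is the set of edges and vertices of $\pi$ lying in the plane $x=k$ ($k$ an integer). The section $S_k$ is the set of edges of $\pi$ in the $x$-direction connecting $H_{k-1}$ and $H_k$; each such edge is split at $x=k-\frac12$ into two half-edges of length $\frac12$, and the half-edges with $k-1\le x\le k-\frac12$ (resp. $k-\frac12\le x\le k$) form the two half-sections of $S_k$. A 1-block of $\mathbb T$ is any non-empty hinge which can occur in a polygon $\pi$ in $\mathbb T$, together with the half-edges of $\pi$ in the two adjacent half-sections, i.e. the part of a polygon between $x=k-\frac12$ and $x=k+\frac12$. An $s$-block is any connected sequence of $s$ (consecutive) 1-blocks, the entirety of which can occur in a polygon in $\mathbb T$ (the first and last half-sections may be empty, so the $s$-block may itself be a polygon). The length of a 1-block is the sum of the lengths of its edges and half-edges. A 1-block is full if its length equals $W$; equivalently, if every one of the $W$ vertices of the tube in the plane of its hinge belongs to its hinge. An $s$-block is full if all its constituent 1-blocks are full. Let $b^{\mathrm F}_{\mathbb T,s}$ be the number of full $s$-blocks in $\mathbb T$, counted up to translation in the $x$-direction. Then $\beta^{\mathrm F}_{\mathbb T}=\lim_{s\to\infty}\frac1s\log b^{\mathrm F}_{\mathbb T,s}$, a limit which exists and is finite. *)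

theory Defs
  imports Complex_Main
begin

section \<open>Polygons in a tube\<close>

type_synonym vertex = "int \<times> int \<times> int"

definition adjacent :: "vertex \<Rightarrow> vertex \<Rightarrow> bool" where
  "adjacent u v \<longleftrightarrow> (case (u, v) of ((x, y, z), (x', y', z')) \<Rightarrow>
     \<bar>x - x'\<bar> + \<bar>y - y'\<bar> + \<bar>z - z'\<bar> = 1)"

definition tube :: "nat \<Rightarrow> nat \<Rightarrow> vertex set" where
  "tube L M = {(x, y, z). 0 \<le> x \<and> 0 \<le> y \<and> y \<le> int L \<and> 0 \<le> z \<and> z \<le> int M}"

text \<open>
  A subgraph without isolated vertices is determined by its set of edges, and is represented
  by it. Its vertex set is the union of its edges.
\<close>

definition polygon :: "vertex set set \<Rightarrow> bool" where
  "polygon \<pi> \<longleftrightarrow>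
     finite \<pi> \<and> \<pi> \<noteq> {} \<and>
     (\<forall>e\<in>\<pi>. \<exists>u v. e = {u, v} \<and> adjacent u v) \<and>
     (\<forall>v\<in>\<Union>\<pi>. card {e\<in>\<pi>. v \<in> e} = 2) \<and>
     (\<forall>u\<in>\<Union>\<pi>. \<forall>v\<in>\<Union>\<pi>. (u, v) \<in> {(a, b). {a, b} \<in> \<pi>}\<^sup>*)"

definition polygon_in_tube :: "nat \<Rightarrow> nat \<Rightarrow> vertex set set \<Rightarrow> bool" where
  "polygon_in_tube L M \<pi> \<longleftrightarrow> polygon \<pi> \<and> \<Union>\<pi> \<subseteq> tube L M"

definition tube_polygons :: "nat \<Rightarrow> nat \<Rightarrow> vertex set set set" where
  "tube_polygons L M = {\<pi>. polygon_in_tube L M \<pi> \<and> (\<exists>v\<in>\<Union>\<pi>. fst v = 0)}"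

definition polygon_span :: "vertex set set \<Rightarrow> int" where
  "polygon_span \<pi> = Max (fst ` \<Union>\<pi>)"


section \<open>Free energy\<close>

definition polygon_count :: "nat \<Rightarrow> nat \<Rightarrow> nat \<Rightarrow> nat \<Rightarrow> nat" where
  "polygon_count L M n s =
     card {\<pi> \<in> tube_polygons L M. card \<pi> = n \<and> polygon_span \<pi> = int s}"

text \<open>Only finitely many terms of this series are nonzero, since the span is less than \<open>n\<close>.\<close>

definition partition_function :: "nat \<Rightarrow> nat \<Rightarrow> nat \<Rightarrow> real \<Rightarrow> real" where
  "partition_function L M n f = (\<Sum>s. real (polygon_count L M n s) * exp (f * real s))"

definition free_energy :: "nat \<Rightarrow> nat \<Rightarrow> real \<Rightarrow> real" where
  "free_energy L M f =
     lim (\<lambda>m. ln (partition_function L M (2 * m) f) / real (2 * m))"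


section \<open>Blocks\<close>

definition hinge_vertices :: "vertex set set \<Rightarrow> int \<Rightarrow> vertex set" where
  "hinge_vertices \<pi> k = {v \<in> \<Union>\<pi>. fst v = k}"

definition hinge_edges :: "vertex set set \<Rightarrow> int \<Rightarrow> vertex set set" where
  "hinge_edges \<pi> k = {e \<in> \<pi>. \<forall>v\<in>e. fst v = k}"

definition section_edges :: "vertex set set \<Rightarrow> int \<Rightarrow> vertex set set" where
  "section_edges \<pi> k = {e \<in> \<pi>. \<exists>u v. e = {u, v} \<and> fst u = k - 1 \<and> fst v = k}"

text \<open>
  The pair \<open>(v, w)\<close> stands for the half of the edge \<open>{v, w}\<close> that is incident to \<open>v\<close>. The
  half-edges of \<open>\<pi>\<close> with \<open>k - 1/2 \<le> x \<le> k + 1/2\<close> come from the two sections on either side of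
  the plane \<open>x = k\<close>.
\<close>

definition half_edges :: "vertex set set \<Rightarrow> int \<Rightarrow> (vertex \<times> vertex) set" where
  "half_edges \<pi> k =
     {(v, w). {v, w} \<in> section_edges \<pi> k \<union> section_edges \<pi> (k + 1) \<and> fst v = k}"

text \<open>A 1-block consists of the vertices and the edges of its hinge and of its half-edges.\<close>

type_synonym block = "vertex set \<times> vertex set set \<times> (vertex \<times> vertex) set"

definition block_at :: "vertex set set \<Rightarrow> int \<Rightarrow> block" where
  "block_at \<pi> k = (hinge_vertices \<pi> k, hinge_edges \<pi> k, half_edges \<pi> k)"

definition block_length :: "block \<Rightarrow> real" where
  "block_length = (\<lambda>(V, E, H). real (card E) + real (card H) / 2)"

text \<open>
  Consecutive non-empty hinges of a polygon are joined by a non-empty section, so that the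
  sequences below are automatically connected. Blocks are recorded with their absolute position.
\<close>

definition s_blocks :: "nat \<Rightarrow> nat \<Rightarrow> nat \<Rightarrow> block list set" where
  "s_blocks L M s =
     {map (\<lambda>i. block_at \<pi> (k + int i)) [0..<s] | \<pi> k.
        polygon_in_tube L M \<pi> \<and> (\<forall>i<s. hinge_vertices \<pi> (k + int i) \<noteq> {})}"

definition tube_width :: "nat \<Rightarrow> nat \<Rightarrow> nat" where
  "tube_width L M = (L + 1) * (M + 1)"

definition full_s_blocks :: "nat \<Rightarrow> nat \<Rightarrow> nat \<Rightarrow> block list set" where
  "full_s_blocks L M s =
     {bs \<in> s_blocks L M s. \<forall>b\<in>set bs. block_length b = real (tube_width L M)}"

definition shift :: "int \<Rightarrow> vertex \<Rightarrow> vertex" where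
  "shift t = (\<lambda>(x, y, z). (x + t, y, z))"

definition shift_block :: "int \<Rightarrow> block \<Rightarrow> block" where
  "shift_block t =
     (\<lambda>(V, E, H). (shift t ` V, image (shift t) ` E, map_prod (shift t) (shift t) ` H))"

definition translates :: "block list set \<Rightarrow> (block list \<times> block list) set" where
  "translates B = {(bs, cs). bs \<in> B \<and> cs \<in> B \<and> (\<exists>t. cs = map (shift_block t) bs)}"

definition full_block_count :: "nat \<Rightarrow> nat \<Rightarrow> nat \<Rightarrow> nat" where
  "full_block_count L M s = card (full_s_blocks L M s // translates (full_s_blocks L M s))"

definition full_block_growth :: "nat \<Rightarrow> nat \<Rightarrow> real" where
  "full_block_growth L M = lim (\<lambda>s. ln (real (full_block_count L M s)) / real s)"

end

theory Submission
  imports Defs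
begin

text \<open>
  Let \<open>Z n\<close> be the partition function at force \<open>f\<close>, \<open>b s\<close> the number of full \<open>s\<close>-blocks and
  \<open>\<beta>\<close> its growth rate. Cutting an \<open>(s + t)\<close>-block shows \<open>b (s + t) \<le> b s * b t\<close>.

  Existence of the free energy: let \<open>a n g g'\<close> be the part of \<open>Z n\<close> coming from polygons with the edge
  \<open>g\<close> in the leftmost and \<open>g'\<close> in the rightmost plane. Joining two polygons along equal edges gives
  \<open>exp f * a n g g' * a m g' g'' \<le> a (n + m) g g''\<close>, and reflection gives \<open>a n g g' = a n g' g\<close>.
  So \<open>exp f * (a n g g')\<^sup>2 \<le> a (2 * n) g g\<close>, and all of \<open>Z n\<close> grows like the largest of the
  supermultiplicative sequences \<open>a n g g\<close>. These are positive because of rectangles.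

  Upper bound: a polygon of span \<open>s\<close> is a sequence of \<open>s + 1\<close> blocks, so the sum of \<open>z ^ length\<close> over
  all blocks is submultiplicative. A non-full \<open>t\<close>-block has length at most \<open>W * t - 1\<close>, whence
  \<open>exp (f * t) * (b t * z ^ (W * t) + const * z ^ (W * t - 1)) \<le> 1\<close> implies that
  \<open>Z n * z ^ n\<close> grows at most linearly. For \<open>f\<close> very negative,
  \<open>z = exp (- (f + \<beta> + \<epsilon>) / W)\<close> is large enough for this.

  Lower bound: what lies to the left of a block may be exchanged for the left part of another polygon
  that crosses the cut at the same places and connects them in the same way. As there are only
  finitely many such patterns, every full block extends to a polygon within a bounded distance.
\<close>

section \<open>Polygons as graphs\<close>


text \<open>Lengths are counted in vertices. On a polygon this agrees with the number of edges, but
  each vertex belongs to a single plane, so the count is additive under cutting, and block lengths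
  become integers although half-edges occur. Hence a non-full block falls short of the maximum by at
  least 1 and its weight loses a whole factor \<open>z\<close>. As \<open>z\<close> grows without
  bound for \<open>f\<close> tending to minus infinity, the non-full \<open>t\<close>-blocks, finite
  in number for fixed \<open>t\<close>, are absorbed by the slack that \<epsilon> leaves.
  \<open>free_energy\<close> is defined by \<open>lim\<close>, so convergence must be proved along
  with the value. This is done where the upper bound is available, since that bound also keeps the
  supermultiplicative sequences from growing faster than exponentially. In a tube of bounded width
  polygons can be joined only at equal edges of their end planes; this forces a finite family of
  sequences indexed by pairs of edges. Most arguments take place in the cylinder that is infinite in
  both directions, where translations and reflections act freely. In the lower bound the length of
  the extended polygon is not prescribed, but it varies in an interval of bounded width, which costs
  a bounded factor.\<close>

definition link :: "vertex set set \<Rightarrow> vertex rel" where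
  "link E = {(a, b). {a, b} \<in> E}"

lemma sym_link: "sym (link E)"
  by (auto simp: link_def sym_def insert_commute)

lemma link_rtrancl_sym: "(a, b) \<in> (link E)\<^sup>* \<Longrightarrow> (b, a) \<in> (link E)\<^sup>*"
  using sym_rtrancl[OF sym_link] by (rule symD)

lemma link_mono: "E \<subseteq> F \<Longrightarrow> (link E)\<^sup>* \<subseteq> (link F)\<^sup>*"
  by (rule rtrancl_mono) (auto simp: link_def)

lemma link_rtrancl_cases:
  assumes "(a, b) \<in> (link E)\<^sup>*"
  shows "a = b \<or> a \<in> \<Union>E \<and> b \<in> \<Union>E"
  using assms by (induction rule: rtrancl_induct) (auto simp: link_def)

lemma adjacent_iff:
  "adjacent u v \<longleftrightarrow>
     \<bar>fst u - fst v\<bar> + \<bar>fst (snd u) - fst (snd v)\<bar> + \<bar>snd (snd u) - snd (snd v)\<bar> = 1"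
  by (cases u; cases v) (simp add: adjacent_def)

lemma adjacent_sym: "adjacent u v \<longleftrightarrow> adjacent v u"
  by (simp add: adjacent_iff abs_minus_commute)

lemma adjacent_neq: "adjacent u v \<Longrightarrow> u \<noteq> v"
  by (auto simp: adjacent_iff)

lemma polygon_altdef:
  "polygon \<pi> \<longleftrightarrow> finite \<pi> \<and> \<pi> \<noteq> {} \<and> (\<forall>e\<in>\<pi>. \<exists>u v. e = {u, v} \<and> adjacent u v) \<and>
     (\<forall>v\<in>\<Union>\<pi>. card {e\<in>\<pi>. v \<in> e} = 2) \<and> (\<forall>u\<in>\<Union>\<pi>. \<forall>v\<in>\<Union>\<pi>. (u, v) \<in> (link \<pi>)\<^sup>*)"
  by (simp add: polygon_def link_def)

lemma polygonD:
  assumes "polygon \<pi>"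
  shows "finite \<pi>" "\<pi> \<noteq> {}" "e \<in> \<pi> \<Longrightarrow> \<exists>u v. e = {u, v} \<and> adjacent u v"
    "v \<in> \<Union>\<pi> \<Longrightarrow> card {e\<in>\<pi>. v \<in> e} = 2"
    "u \<in> \<Union>\<pi> \<Longrightarrow> v \<in> \<Union>\<pi> \<Longrightarrow> (u, v) \<in> (link \<pi>)\<^sup>*"
proof -
  note * = assms[unfolded polygon_altdef]
  show "finite \<pi>" "\<pi> \<noteq> {}" using * by simp_all
  show "e \<in> \<pi> \<Longrightarrow> \<exists>u v. e = {u, v} \<and> adjacent u v" using * by simp
  show "v \<in> \<Union>\<pi> \<Longrightarrow> card {e\<in>\<pi>. v \<in> e} = 2" using * by (elim conjE) (rule bspec)
  show "u \<in> \<Union>\<pi> \<Longrightarrow> v \<in> \<Union>\<pi> \<Longrightarrow> (u, v) \<in> (link \<pi>)\<^sup>*"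
    using * by (elim conjE) (drule (1) bspec, erule (1) bspec)
qed

lemma polygon_edge_card:
  assumes "polygon \<pi>" "e \<in> \<pi>"
  shows "card e = 2"
proof -
  obtain u v where "e = {u, v}" "adjacent u v" using polygonD(3)[OF assms] by blast
  then show ?thesis using adjacent_neq[of u v] by simp
qed

lemma polygon_edge_finite: "polygon \<pi> \<Longrightarrow> e \<in> \<pi> \<Longrightarrow> finite e"
  using polygonD(3)[of \<pi> e] by auto

lemma polygon_finite_verts: "polygon \<pi> \<Longrightarrow> finite (\<Union>\<pi>)"
  by (rule finite_Union[OF polygonD(1) polygon_edge_finite])

lemma polygon_edge_adjacent:
  assumes "polygon \<pi>" "{u, v} \<in> \<pi>"
  shows "adjacent u v"
proof -
  obtain a b where "{u, v} = {a, b}" "adjacent a b" using polygonD(3)[OF assms] by blast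
  then show ?thesis using adjacent_sym[of a b] by (auto simp: doubleton_eq_iff)
qed

lemma polygon_verts_nonempty:
  assumes "polygon \<pi>"
  shows "\<Union>\<pi> \<noteq> {}"
proof -
  obtain e where e: "e \<in> \<pi>" using polygonD(2)[OF assms] by blast
  then obtain u v where "e = {u, v}" using polygonD(3)[OF assms e] by blast
  then show ?thesis using e by blast
qed

text \<open>Double counting of incidences. \<open>V\<close> is arbitrary because it will be the
  whole vertex set, the even sublattice, a connected component and a single hinge.\<close>

lemma sum_degree:
  assumes "finite E" "finite V"
  shows "(\<Sum>v\<in>V. card {e\<in>E. v \<in> e}) = (\<Sum>e\<in>E. card (e \<inter> V))"
proof (rule sum_multicount_gen[OF assms(2,1)], rule ballI)
  fix e
  have "{v\<in>V. v \<in> e} = e \<inter> V" by blast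
  then show "card {v\<in>V. v \<in> e} = card (e \<inter> V)" by simp
qed

text \<open>Both sides are half the number of incidences. This turns lengths into vertex counts,
  which split without fractions when a polygon is cut along planes.\<close>

lemma polygon_card_verts:
  assumes "polygon \<pi>"
  shows "card (\<Union>\<pi>) = card \<pi>"
proof -
  have "(\<Sum>v\<in>\<Union>\<pi>. card {e\<in>\<pi>. v \<in> e}) = (\<Sum>e\<in>\<pi>. card (e \<inter> \<Union>\<pi>))"
    by (rule sum_degree[OF polygonD(1)[OF assms] polygon_finite_verts[OF assms]])
  also have "\<dots> = (\<Sum>e\<in>\<pi>. 2)"
  proof (rule sum.cong[OF refl])
    fix e assume e: "e \<in> \<pi>"
    then have "e \<inter> \<Union>\<pi> = e" by blast
    then show "card (e \<inter> \<Union>\<pi>) = 2" using polygon_edge_card[OF assms e] by metis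
  qed
  also have "(\<Sum>v\<in>\<Union>\<pi>. card {e\<in>\<pi>. v \<in> e}) = (\<Sum>v\<in>\<Union>\<pi>. 2)"
    by (rule sum.cong[OF refl]) (rule polygonD(4)[OF assms])
  finally have "card (\<Union>\<pi>) * 2 = card \<pi> * 2" by (simp only: sum_constant of_nat_id)
  then show ?thesis by linarith
qed

text \<open>Each edge has exactly one end of even coordinate sum, and each such vertex has degree 2.\<close>

lemma polygon_even:
  assumes "polygon \<pi>"
  shows "even (card \<pi>)"
proof -
  define V where "V = {v \<in> \<Union>\<pi>. even (fst v + fst (snd v) + snd (snd v))}"
  have "(\<Sum>v\<in>V. card {e\<in>\<pi>. v \<in> e}) = (\<Sum>e\<in>\<pi>. card (e \<inter> V))"
    using polygonD(1)[OF assms] polygon_finite_verts[OF assms] finite_subset[of V "\<Union>\<pi>"]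
    by (intro sum_degree) (auto simp: V_def)
  moreover have "card {e\<in>\<pi>. v \<in> e} = 2" if "v \<in> V" for v
    using polygonD(4)[OF assms, of v] that V_def by auto
  moreover have "card (e \<inter> V) = 1" if e: "e \<in> \<pi>" for e
  proof -
    obtain u v where uv: "e = {u, v}" "adjacent u v" using polygonD(3)[OF assms e] by blast
    have uV: "u \<in> \<Union>\<pi>" "v \<in> \<Union>\<pi>" using e uv by auto
    have parity: "even (a + b + c) \<longleftrightarrow> odd (a' + b' + c')"
      if "\<bar>a - a'\<bar> + \<bar>b - b'\<bar> + \<bar>c - c'\<bar> = 1" for a b c a' b' c' :: int
    proof -
      have "odd (\<bar>a - a'\<bar> + \<bar>b - b'\<bar> + \<bar>c - c'\<bar>)" unfolding that by simp
      then show ?thesis by simp blast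
    qed
    have "u \<in> V \<longleftrightarrow> v \<notin> V"
      using parity[OF uv(2)[unfolded adjacent_iff]] uV unfolding V_def by blast
    then have "e \<inter> V = {u} \<or> e \<inter> V = {v}" unfolding uv(1) by blast
    then show ?thesis by auto
  qed
  ultimately have "2 * card V = card \<pi>" by simp
  then show ?thesis by (metis dvd_triv_left)
qed

text \<open>Otherwise the component of \<open>u\<close> would contain exactly one vertex of odd degree.\<close>

lemma polygon_delete_edge_ends:
  assumes "polygon \<pi>" "{u, v} \<in> \<pi>"
  shows "(u, v) \<in> (link (\<pi> - {{u, v}}))\<^sup>*"
proof (rule ccontr)
  define E where "E = \<pi> - {{u, v}}"
  assume "(u, v) \<notin> (link (\<pi> - {{u, v}}))\<^sup>*"
  then have nv: "(u, v) \<notin> (link E)\<^sup>*" by (simp add: E_def)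
  define C where "C = {w. (u, w) \<in> (link E)\<^sup>*}"
  have uV: "u \<in> \<Union>\<pi>" using assms by auto
  have CV: "C \<subseteq> \<Union>\<pi>"
    using link_rtrancl_cases uV unfolding C_def E_def by fast
  have fin: "finite C" "finite E"
    using CV polygon_finite_verts[OF assms(1)] finite_subset polygonD(1)[OF assms(1)] E_def by auto
  have deg: "card {e\<in>E. w \<in> e} = (if w = u then 1 else 2)" if w: "w \<in> C" for w
  proof -
    have c2: "card {e\<in>\<pi>. w \<in> e} = 2" using polygonD(4)[OF assms(1)] w CV by blast
    have wv: "w \<noteq> v" using nv w C_def by auto
    have eq: "{e\<in>E. w \<in> e} = (if w = u then {e\<in>\<pi>. w \<in> e} - {{u, v}} else {e\<in>\<pi>. w \<in> e})"
      using wv unfolding E_def by auto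
    show ?thesis unfolding eq using c2 assms(2) by auto
  qed
  have "(\<Sum>w\<in>C. card {e\<in>E. w \<in> e}) = (\<Sum>e\<in>E. card (e \<inter> C))"
    using fin by (intro sum_degree)
  moreover have "even (card (e \<inter> C))" if e: "e \<in> E" for e
  proof -
    obtain a b where ab: "e = {a, b}" "adjacent a b" using polygonD(3)[OF assms(1)] e E_def by blast
    have "(a, b) \<in> link E" "(b, a) \<in> link E" using e ab by (auto simp: link_def insert_commute)
    then have "a \<in> C \<longleftrightarrow> b \<in> C" unfolding C_def by (auto intro: rtrancl.rtrancl_into_rtrancl)
    then have "e \<inter> C = {} \<or> e \<inter> C = {a, b}" using ab by auto
    then show ?thesis using adjacent_neq[OF ab(2)] by auto
  qed
  ultimately have ev: "even (\<Sum>w\<in>C. card {e\<in>E. w \<in> e})"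
    by (simp add: dvd_sum)
  have uC: "u \<in> C" by (simp add: C_def)
  have "(\<Sum>w\<in>C. card {e\<in>E. w \<in> e}) = (\<Sum>w\<in>C. if w = u then 1 else 2)"
    by (intro sum.cong refl) (simp add: deg)
  also have "\<dots> = 1 + (\<Sum>w\<in>C - {u}. 2)"
    using fin uC by (subst sum.remove[of _ u]) auto
  finally show False using ev by simp
qed

text \<open>The deleted edge can be bypassed along the rest of the cycle, so every path can be made
  to avoid it. This keeps a polygon connected when one of its edges is opened for joining.\<close>

lemma polygon_delete_edge:
  assumes "polygon \<pi>" "{u, v} \<in> \<pi>" "a \<in> \<Union>\<pi>" "b \<in> \<Union>\<pi>"
  shows "(a, b) \<in> (link (\<pi> - {{u, v}}))\<^sup>*"
proof -
  let ?E = "\<pi> - {{u, v}}"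
  have uv: "(u, v) \<in> (link ?E)\<^sup>*" by (rule polygon_delete_edge_ends[OF assms(1,2)])
  have "link \<pi> \<subseteq> (link ?E)\<^sup>*"
  proof
    fix x assume "x \<in> link \<pi>"
    then obtain c d where cd: "x = (c, d)" "{c, d} \<in> \<pi>" by (auto simp: link_def)
    show "x \<in> (link ?E)\<^sup>*"
    proof (cases "{c, d} = {u, v}")
      case True
      then show ?thesis using uv link_rtrancl_sym[OF uv] cd by (auto simp: doubleton_eq_iff)
    next
      case False
      then have "(c, d) \<in> link ?E" using cd by (auto simp: link_def)
      then show ?thesis using cd by auto
    qed
  qed
  then have "(link \<pi>)\<^sup>* \<subseteq> (link ?E)\<^sup>*" by (metis rtrancl_mono rtrancl_idemp)
  then show ?thesis using polygonD(5)[OF assms(1,3,4)] by auto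
qed

text \<open>A discrete intermediate value argument: an edge changes the x-coordinate by at most 1,
  so a path cannot jump over a plane.\<close>

lemma polygon_hits_plane:
  assumes "polygon \<pi>" "a \<in> \<Union>\<pi>" "b \<in> \<Union>\<pi>" "fst a \<le> k" "k \<le> fst b"
  shows "\<exists>v\<in>\<Union>\<pi>. fst v = k"
proof (rule ccontr)
  assume no: "\<not> ?thesis"
  have "w \<in> \<Union>\<pi> \<and> fst w < k" if "(a, w) \<in> (link \<pi>)\<^sup>*" for w
    using that
  proof (induction rule: rtrancl_induct)
    case base
    have "fst a \<noteq> k" using no assms(2) by blast
    then show ?case using assms(2,4) by simp
  next
    case (step y z)
    then have yz: "{y, z} \<in> \<pi>" by (auto simp: link_def)
    then have "adjacent y z" "z \<in> \<Union>\<pi>" using polygon_edge_adjacent[OF assms(1)] by blast+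
    moreover have "fst z \<noteq> k" using no \<open>z \<in> \<Union>\<pi>\<close> by blast
    moreover have "\<bar>fst y - fst z\<bar> \<le> 1" using \<open>adjacent y z\<close> by (simp add: adjacent_iff)
    ultimately show ?case using step.IH by linarith
  qed
  then show False using polygonD(5)[OF assms(1,2,3)] assms(5) by (meson not_less)
qed

section \<open>Lattice symmetries acting on polygons\<close>

definition gmap :: "(vertex \<Rightarrow> vertex) \<Rightarrow> vertex set set \<Rightarrow> vertex set set" where
  "gmap h \<pi> = (`) h ` \<pi>"

lemma Union_gmap: "\<Union>(gmap h \<pi>) = h ` \<Union>\<pi>"
  by (auto simp: gmap_def)

lemma gmap_gmap: "gmap g (gmap h \<pi>) = gmap (g \<circ> h) \<pi>"
  by (auto simp: gmap_def image_comp o_def)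

lemma gmap_id: "(\<And>v. h v = v) \<Longrightarrow> gmap h \<pi> = \<pi>"
  by (auto simp: gmap_def)

lemma inj_image_inj: "inj h \<Longrightarrow> inj ((`) h)"
  by (rule injI) (simp add: inj_image_eq_iff)

lemma inj_gmap: "inj h \<Longrightarrow> inj (gmap h)"
  unfolding gmap_def by (intro inj_image_inj)

lemma card_gmap: "inj h \<Longrightarrow> card (gmap h \<pi>) = card \<pi>"
  unfolding gmap_def by (intro card_image inj_on_subset[OF inj_image_inj]) auto

lemma gmap_filter: "gmap h {e\<in>\<pi>. P (h ` e)} = {e\<in>gmap h \<pi>. P e}"
  by (auto simp: gmap_def)

lemma polygon_gmap:
  assumes "polygon \<pi>" "inj h" "\<And>u v. adjacent u v \<Longrightarrow> adjacent (h u) (h v)"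
  shows "polygon (gmap h \<pi>)"
  unfolding polygon_altdef
proof (intro conjI ballI)
  show "finite (gmap h \<pi>)" "gmap h \<pi> \<noteq> {}"
    using polygonD(1,2)[OF assms(1)] by (auto simp: gmap_def)
next
  fix e assume "e \<in> gmap h \<pi>"
  then obtain d where "d \<in> \<pi>" "e = h ` d" by (auto simp: gmap_def)
  then show "\<exists>u v. e = {u, v} \<and> adjacent u v"
    using polygonD(3)[OF assms(1), of d] assms(3) by (metis image_insert image_empty)
next
  fix v assume "v \<in> \<Union>(gmap h \<pi>)"
  then obtain u where u: "u \<in> \<Union>\<pi>" "v = h u" by (auto simp: Union_gmap)
  have "{e\<in>gmap h \<pi>. v \<in> e} = gmap h {e\<in>\<pi>. h u \<in> h ` e}"
    using gmap_filter[of h \<pi> "\<lambda>e. v \<in> e"] u by simp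
  also have "\<dots> = gmap h {e\<in>\<pi>. u \<in> e}"
    using assms(2) by (simp add: inj_image_mem_iff)
  finally show "card {e\<in>gmap h \<pi>. v \<in> e} = 2"
    using card_gmap[OF assms(2)] polygonD(4)[OF assms(1) u(1)] by simp
next
  fix a b assume "a \<in> \<Union>(gmap h \<pi>)" "b \<in> \<Union>(gmap h \<pi>)"
  then obtain u v where u: "u \<in> \<Union>\<pi>" "a = h u" "v \<in> \<Union>\<pi>" "b = h v"
    unfolding Union_gmap by blast
  have "(h u, h w) \<in> (link (gmap h \<pi>))\<^sup>*" if "(u, w) \<in> (link \<pi>)\<^sup>*" for w
    using that
  proof (induction rule: rtrancl_induct)
    case (step y z)
    then have "(h y, h z) \<in> link (gmap h \<pi>)"
      unfolding link_def gmap_def by (auto intro!: image_eqI[of _ _ "{y, z}"])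
    then show ?case using step by (meson rtrancl.rtrancl_into_rtrancl)
  qed auto
  then show "(a, b) \<in> (link (gmap h \<pi>))\<^sup>*" using polygonD(5)[OF assms(1)] u by auto
qed

text \<open>The reflection in the plane x = c/2, an involution that exchanges the planes x = 0 and x
  = c.\<close>

definition reflect :: "int \<Rightarrow> vertex \<Rightarrow> vertex" where
  "reflect c v = (c - fst v, snd v)"

lemma shift_eq: "shift t v = (fst v + t, snd v)"
  by (cases v) (simp add: shift_def)

lemma fst_shift [simp]: "fst (shift t v) = fst v + t"
  and snd_shift [simp]: "snd (shift t v) = snd v"
  and fst_reflect [simp]: "fst (reflect c v) = c - fst v"
  and snd_reflect [simp]: "snd (reflect c v) = snd v"
  by (simp_all add: shift_eq reflect_def)

lemma inj_shift: "inj (shift t)"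
  by (rule injI) (simp add: shift_eq prod_eq_iff)

lemma inj_reflect: "inj (reflect t)"
  by (rule injI) (simp add: reflect_def prod_eq_iff)

lemma polygon_shift: "polygon \<pi> \<Longrightarrow> polygon (gmap (shift t) \<pi>)"
  by (erule polygon_gmap[OF _ inj_shift]) (simp add: adjacent_iff)

lemma polygon_reflect: "polygon \<pi> \<Longrightarrow> polygon (gmap (reflect t) \<pi>)"
  by (erule polygon_gmap[OF _ inj_reflect]) (simp add: adjacent_iff)

lemma gmap_shift_shift: "gmap (shift s) (gmap (shift t) \<pi>) = gmap (shift (t + s)) \<pi>"
  by (simp add: gmap_gmap o_def shift_eq[abs_def] add.assoc)

lemma gmap_shift_0 [simp]: "gmap (shift 0) \<pi> = \<pi>"
  by (simp add: gmap_id shift_eq)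

lemma gmap_reflect_reflect [simp]: "gmap (reflect t) (gmap (reflect t) \<pi>) = \<pi>"
  by (simp add: gmap_gmap gmap_id reflect_def)

section \<open>Joining polygons\<close>

text \<open>An edge of the cross-section is kept as a set of (y, z) positions, without its
  x-coordinate, so that edges in different planes and different polygons can be compared.\<close>

definition cross :: "int \<Rightarrow> (int \<times> int) set \<Rightarrow> vertex set" where
  "cross k g = Pair k ` g"

definition bridges :: "int \<Rightarrow> (int \<times> int) set \<Rightarrow> vertex set set" where
  "bridges k g = (\<lambda>p. {(k, p), (k + 1, p)}) ` g"

text \<open>Two parallel edges that face each other in adjacent planes are traded for two edges in
  the x-direction, so the total length is preserved.\<close>

definition join :: "int \<Rightarrow> (int \<times> int) set \<Rightarrow> vertex set set \<Rightarrow> vertex set set \<Rightarrow> vertex set set" where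
  "join k g \<pi> \<rho> = (\<pi> - {cross k g}) \<union> (\<rho> - {cross (k + 1) g}) \<union> bridges k g"

lemma mem_cross [simp]: "v \<in> cross k g \<longleftrightarrow> fst v = k \<and> snd v \<in> g"
  by (cases v) (auto simp: cross_def)

lemma card_cross: "card (cross k g) = card g"
  unfolding cross_def by (intro card_image inj_onI) simp

lemma shift_cross: "shift t ` cross k g = cross (k + t) g"
  by (auto simp: cross_def shift_eq image_image)

lemma reflect_cross: "reflect t ` cross k g = cross (t - k) g"
  by (auto simp: cross_def reflect_def image_image)

lemma cross_inject [simp]: "cross k g = cross k g' \<longleftrightarrow> g = g'"
  unfolding cross_def by (rule inj_image_eq_iff) (simp add: inj_def)

text \<open>The local form of joining: an end of the removed edge \<open>c\<close> receives the new
  edge \<open>b\<close> in exchange, and elsewhere nothing changes.\<close>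

lemma card_degree_swap:
  assumes "{e\<in>J. v \<in> e} = ({e\<in>\<pi>. v \<in> e} - {c}) \<union> (if v \<in> c then {b} else {})"
    and "c \<in> \<pi>" "b \<notin> \<pi>" "card {e\<in>\<pi>. v \<in> e} = 2"
  shows "card {e\<in>J. v \<in> e} = 2"
proof (cases "v \<in> c")
  case True
  have fin: "finite {e\<in>\<pi>. v \<in> e}" using assms(4) by (metis card.infinite zero_neq_numeral)
  have "card (insert b ({e\<in>\<pi>. v \<in> e} - {c})) = Suc (card ({e\<in>\<pi>. v \<in> e} - {c}))"
    using fin assms(3) by (intro card_insert_disjoint) auto
  also have "card ({e\<in>\<pi>. v \<in> e} - {c}) = 1"
    using fin assms(2,4) True by (subst card_Diff_singleton) auto
  finally show ?thesis using True by (simp add: assms(1))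
next
  case False
  then have "{e\<in>J. v \<in> e} = {e\<in>\<pi>. v \<in> e}" using assms(1) by auto
  then show ?thesis using assms(4) by simp
qed

context
  fixes k :: int and g :: "(int \<times> int) set" and \<pi> \<rho> :: "vertex set set"
  assumes pi: "polygon \<pi>" and rho: "polygon \<rho>"
    and le: "\<And>v. v \<in> \<Union>\<pi> \<Longrightarrow> fst v \<le> k" and ge: "\<And>v. v \<in> \<Union>\<rho> \<Longrightarrow> k + 1 \<le> fst v"
    and cpi: "cross k g \<in> \<pi>" and crho: "cross (k + 1) g \<in> \<rho>"
begin

lemma Union_join: "\<Union>(join k g \<pi> \<rho>) = \<Union>\<pi> \<union> \<Union>\<rho>"
proof -
  have "\<Union>\<pi> \<subseteq> \<Union>(join k g \<pi> \<rho>)"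
  proof
    fix v assume "v \<in> \<Union>\<pi>"
    then obtain e where e: "e \<in> \<pi>" "v \<in> e" by blast
    show "v \<in> \<Union>(join k g \<pi> \<rho>)"
    proof (cases "e = cross k g")
      case True
      then have "{(k, snd v), (k + 1, snd v)} \<in> bridges k g" "v = (k, snd v)"
        using e by (auto simp: bridges_def prod_eq_iff)
      then show ?thesis unfolding join_def by blast
    qed (use e in \<open>auto simp: join_def\<close>)
  qed
  moreover have "\<Union>\<rho> \<subseteq> \<Union>(join k g \<pi> \<rho>)"
  proof
    fix v assume "v \<in> \<Union>\<rho>"
    then obtain e where e: "e \<in> \<rho>" "v \<in> e" by blast
    show "v \<in> \<Union>(join k g \<pi> \<rho>)"
    proof (cases "e = cross (k + 1) g")
      case True
      then have "{(k, snd v), (k + 1, snd v)} \<in> bridges k g" "v = (k + 1, snd v)"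
        using e by (auto simp: bridges_def prod_eq_iff)
      then show ?thesis unfolding join_def by blast
    qed (use e in \<open>auto simp: join_def\<close>)
  qed
  moreover have "\<Union>(bridges k g) \<subseteq> cross k g \<union> cross (k + 1) g"
    by (auto simp: bridges_def)
  then have "\<Union>(join k g \<pi> \<rho>) \<subseteq> \<Union>\<pi> \<union> \<Union>\<rho>"
    unfolding join_def using cpi crho by blast
  ultimately show ?thesis by blast
qed

text \<open>Each end of a removed edge receives one bridge, which preserves the degrees. Either
  polygon without its removed edge is still connected, so a single bridge suffices to connect
  everything.\<close>

lemma polygon_join: "polygon (join k g \<pi> \<rho>)"
proof -
  let ?J = "join k g \<pi> \<rho>"
  have "card g = 2" using polygon_edge_card[OF pi cpi] by (simp add: card_cross)
  then obtain p q where g: "g = {p, q}" "p \<noteq> q" by (auto simp: card_2_iff)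
  have ck: "cross k g = {(k, p), (k, q)}" "cross (k + 1) g = {(k + 1, p), (k + 1, q)}"
    by (auto simp: cross_def g)
  have fin: "finite ?J"
    using polygonD(1)[OF pi] polygonD(1)[OF rho] by (simp add: join_def bridges_def g)
  have ne: "?J \<noteq> {}" by (simp add: join_def bridges_def g)
  have adj: "\<exists>u v. e = {u, v} \<and> adjacent u v" if "e \<in> ?J" for e
  proof -
    consider "e \<in> \<pi>" | "e \<in> \<rho>" | r where "e = {(k, r), (k + 1, r)}"
      using \<open>e \<in> ?J\<close> unfolding join_def bridges_def by blast
    then show ?thesis
    proof cases
      case 3
      have "adjacent (k, r) (k + 1, r)" by (simp add: adjacent_iff)
      then show ?thesis using 3 by blast
    qed (use polygonD(3)[OF pi] polygonD(3)[OF rho] in blast)+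
  qed
  have deg1: "card {e\<in>?J. v \<in> e} = 2" if v: "v \<in> \<Union>\<pi>" for v
  proof (rule card_degree_swap[OF _ cpi])
    have vk: "fst v \<le> k" using le[OF v] .
    have 1: "v \<notin> e" if "e \<in> \<rho>" for e using ge[of v] vk that by force
    have 2: "{e\<in>bridges k g. v \<in> e} = (if v \<in> cross k g then {{v, (k + 1, snd v)}} else {})"
      using vk by (cases v) (auto simp: bridges_def)
    have "{e\<in>?J. v \<in> e} = ({e\<in>\<pi>. v \<in> e} - {cross k g}) \<union> {e\<in>bridges k g. v \<in> e}"
      using 1 unfolding join_def by blast
    then show "{e\<in>?J. v \<in> e} = ({e\<in>\<pi>. v \<in> e} - {cross k g}) \<union>
        (if v \<in> cross k g then {{v, (k + 1, snd v)}} else {})" unfolding 2 .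
    show "{v, (k + 1, snd v)} \<notin> \<pi>" using le[of "(k + 1, snd v)"] by force
    show "card {e\<in>\<pi>. v \<in> e} = 2" by (rule polygonD(4)[OF pi v])
  qed
  have deg2: "card {e\<in>?J. v \<in> e} = 2" if v: "v \<in> \<Union>\<rho>" for v
  proof (rule card_degree_swap[OF _ crho])
    have vk: "k + 1 \<le> fst v" using ge[OF v] .
    have 1: "v \<notin> e" if "e \<in> \<pi>" for e using le[of v] vk that by force
    have 2: "{e\<in>bridges k g. v \<in> e} = (if v \<in> cross (k + 1) g then {{(k, snd v), v}} else {})"
      using vk by (cases v) (auto simp: bridges_def)
    have "{e\<in>?J. v \<in> e} = ({e\<in>\<rho>. v \<in> e} - {cross (k + 1) g}) \<union> {e\<in>bridges k g. v \<in> e}"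
      using 1 unfolding join_def by blast
    then show "{e\<in>?J. v \<in> e} = ({e\<in>\<rho>. v \<in> e} - {cross (k + 1) g}) \<union>
        (if v \<in> cross (k + 1) g then {{(k, snd v), v}} else {})" unfolding 2 .
    show "{(k, snd v), v} \<notin> \<rho>" using ge[of "(k, snd v)"] by force
    show "card {e\<in>\<rho>. v \<in> e} = 2" by (rule polygonD(4)[OF rho v])
  qed
  have J1: "(link (\<pi> - {cross k g}))\<^sup>* \<subseteq> (link ?J)\<^sup>*"
    and J2: "(link (\<rho> - {cross (k + 1) g}))\<^sup>* \<subseteq> (link ?J)\<^sup>*"
    by (auto simp: join_def intro!: link_mono)
  have in1: "(k, p) \<in> \<Union>\<pi>" and in2: "(k + 1, p) \<in> \<Union>\<rho>" using cpi crho ck by blast+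
  have br: "((k + 1, p), (k, p)) \<in> (link ?J)\<^sup>*"
  proof (rule link_rtrancl_sym[OF r_into_rtrancl])
    have "{(k, p), (k + 1, p)} \<in> bridges k g" unfolding bridges_def g by blast
    then show "((k, p), (k + 1, p)) \<in> link ?J" unfolding link_def join_def by blast
  qed
  have conn: "(v, (k, p)) \<in> (link ?J)\<^sup>*" if "v \<in> \<Union>?J" for v
  proof -
    from that have "v \<in> \<Union>\<pi> \<or> v \<in> \<Union>\<rho>" unfolding Union_join by simp
    then show ?thesis
    proof (elim disjE)
      assume 1: "v \<in> \<Union>\<pi>"
      have "(v, (k, p)) \<in> (link (\<pi> - {cross k g}))\<^sup>*"
        unfolding ck by (rule polygon_delete_edge[OF pi _ 1 in1]) (use cpi ck in simp)
      then show ?thesis using J1 by blast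
    next
      assume 2: "v \<in> \<Union>\<rho>"
      have "(v, (k + 1, p)) \<in> (link (\<rho> - {cross (k + 1) g}))\<^sup>*"
        unfolding ck by (rule polygon_delete_edge[OF rho _ 2 in2]) (use crho ck in simp)
      then have "(v, (k + 1, p)) \<in> (link ?J)\<^sup>*" using J2 by blast
      then show ?thesis using br by (rule rtrancl_trans)
    qed
  qed
  show ?thesis unfolding polygon_altdef
  proof (intro conjI ballI fin ne)
    fix v assume "v \<in> \<Union>?J"
    then show "card {e\<in>?J. v \<in> e} = 2" unfolding Union_join using deg1 deg2 by (elim UnE)
  next
    fix u v assume "u \<in> \<Union>?J" "v \<in> \<Union>?J"
    then show "(u, v) \<in> (link ?J)\<^sup>*"
      by (intro rtrancl_trans[OF conn link_rtrancl_sym[OF conn]])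
  qed (rule adj)
qed

text \<open>Counting vertices avoids tracking the exchanged edges: the two vertex sets are disjoint,
  and joining leaves them as they are.\<close>

lemma card_join: "card (join k g \<pi> \<rho>) = card \<pi> + card \<rho>"
proof -
  have "card (\<Union>\<pi> \<union> \<Union>\<rho>) = card (\<Union>\<pi>) + card (\<Union>\<rho>)"
    using polygon_finite_verts[OF pi] polygon_finite_verts[OF rho] le ge
    by (intro card_Un_disjoint) force+
  then show ?thesis
    using polygon_card_verts[OF pi] polygon_card_verts[OF rho] polygon_card_verts[OF polygon_join]
      Union_join by simp
qed

end

section \<open>Explicit polygons given by closed walks\<close>

definition cycle_edges :: "nat \<Rightarrow> (nat \<Rightarrow> vertex) \<Rightarrow> vertex set set" where
  "cycle_edges n c = (\<lambda>i. {c i, c (Suc i mod n)}) ` {..<n}"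

lemma Union_cycle_edges:
  assumes "0 < n"
  shows "\<Union>(cycle_edges n c) = c ` {..<n}"
proof -
  have "c (Suc i mod n) \<in> c ` {..<n}" for i using assms by (intro imageI) simp
  then show ?thesis unfolding cycle_edges_def by blast
qed

lemma polygon_cycle_edges:
  assumes n: "3 \<le> n" and inj: "inj_on c {..<n}"
    and adj: "\<And>i. i < n \<Longrightarrow> adjacent (c i) (c (Suc i mod n))"
  shows "polygon (cycle_edges n c)"
  unfolding polygon_altdef
proof (intro conjI ballI)
  show "finite (cycle_edges n c)" by (simp add: cycle_edges_def)
  show "cycle_edges n c \<noteq> {}" using n by (auto simp: cycle_edges_def lessThan_empty_iff)
next
  fix e assume "e \<in> cycle_edges n c"
  then show "\<exists>u v. e = {u, v} \<and> adjacent u v" unfolding cycle_edges_def using adj by blast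
next
  have U: "\<Union>(cycle_edges n c) = c ` {..<n}" using n by (intro Union_cycle_edges) simp
  have eqI: "c i = c j \<longleftrightarrow> i = j" if "i < n" "j < n" for i j
    using inj_on_eq_iff[OF inj] that by simp
  fix v assume "v \<in> \<Union>(cycle_edges n c)"
  then obtain i where i: "i < n" "v = c i" unfolding U by blast
  define j where "j = (if i = 0 then n - 1 else i - 1)"
  have j: "j < n" "Suc j mod n = i" using i n by (auto simp: j_def)
  define k where "k = Suc i mod n"
  have k: "k < n" "k \<noteq> j" using i n by (auto simp: j_def k_def mod_Suc)
  have only: "l = i \<or> l = j" if "l < n" "i = l \<or> i = Suc l mod n" for l
    using that i by (auto simp: j_def mod_Suc split: if_splits)
  have "{e \<in> cycle_edges n c. v \<in> e} = {{c i, c k}, {c j, c i}}"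
  proof (intro equalityI subsetI)
    fix e assume "e \<in> {e \<in> cycle_edges n c. v \<in> e}"
    then obtain l where l: "l < n" "e = {c l, c (Suc l mod n)}" "c i \<in> e"
      unfolding cycle_edges_def i(2) by blast
    then have "i = l \<or> i = Suc l mod n" using eqI[of i l] eqI[of i "Suc l mod n"] i n by auto
    then have "l = i \<or> l = j" using only l by blast
    then show "e \<in> {{c i, c k}, {c j, c i}}" using l j k_def by auto
  next
    fix e assume "e \<in> {{c i, c k}, {c j, c i}}"
    then show "e \<in> {e \<in> cycle_edges n c. v \<in> e}"
      using i j k_def unfolding cycle_edges_def by auto
  qed
  moreover have "{c i, c k} \<noteq> {c j, c i}"
    using eqI[of k j] k j i by (auto simp: doubleton_eq_iff)
  ultimately show "card {e \<in> cycle_edges n c. v \<in> e} = 2" by simp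
next
  have U: "\<Union>(cycle_edges n c) = c ` {..<n}" using n by (intro Union_cycle_edges) simp
  have reach: "i < n \<Longrightarrow> (c 0, c i) \<in> (link (cycle_edges n c))\<^sup>*" for i
  proof (induction i)
    case (Suc i)
    then have "(c i, c (Suc i)) \<in> link (cycle_edges n c)"
      unfolding link_def cycle_edges_def by (auto intro!: image_eqI[of _ _ i])
    then show ?case using Suc by (meson Suc_lessD rtrancl.rtrancl_into_rtrancl)
  qed simp
  fix u v assume "u \<in> \<Union>(cycle_edges n c)" "v \<in> \<Union>(cycle_edges n c)"
  then show "(u, v) \<in> (link (cycle_edges n c))\<^sup>*"
    unfolding U using reach link_rtrancl_sym rtrancl_trans by (metis imageE lessThan_iff)
qed

text \<open>The closed walk along \<open>P\<close> and back along \<open>Q\<close>, of whose rungs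
  only the first and the last are used. Two instances occur: Hamiltonian paths of neighbouring
  cross-sections, and two parallel lines along the tube.\<close>

definition ladder :: "nat \<Rightarrow> (nat \<Rightarrow> vertex) \<Rightarrow> (nat \<Rightarrow> vertex) \<Rightarrow> vertex set set" where
  "ladder m P Q = cycle_edges (2 * m) (\<lambda>i. if i < m then P i else Q (2 * m - 1 - i))"

context
  fixes m :: nat and P Q :: "nat \<Rightarrow> vertex"
  assumes m: "2 \<le> m" and injP: "inj_on P {..<m}" and injQ: "inj_on Q {..<m}"
    and disj: "\<And>i j. i < m \<Longrightarrow> j < m \<Longrightarrow> P i \<noteq> Q j"
    and adjP: "\<And>i. Suc i < m \<Longrightarrow> adjacent (P i) (P (Suc i))"
    and adjQ: "\<And>i. Suc i < m \<Longrightarrow> adjacent (Q i) (Q (Suc i))"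
    and rung0: "adjacent (P 0) (Q 0)" and rung1: "adjacent (P (m - 1)) (Q (m - 1))"
begin

lemma inj_ladder: "inj_on (\<lambda>i. if i < m then P i else Q (2 * m - 1 - i)) {..<2 * m}"
proof (rule inj_onI)
  fix i j
  assume i: "i \<in> {..<2 * m}" and j: "j \<in> {..<2 * m}"
    and eq: "(if i < m then P i else Q (2 * m - 1 - i)) = (if j < m then P j else Q (2 * m - 1 - j))"
  have less: "2 * m - 1 - l < m" if "\<not> l < m" for l using that m by arith
  show "i = j"
  proof (cases "i < m"; cases "j < m")
    assume "i < m" "j < m"
    then show ?thesis using eq inj_onD[OF injP] by simp
  next
    assume "i < m" "\<not> j < m"
    then show ?thesis using eq disj[of i "2 * m - 1 - j"] less[of j] by simp
  next
    assume "\<not> i < m" "j < m"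
    then show ?thesis using eq disj[of j "2 * m - 1 - i"] less[of i] by simp
  next
    assume *: "\<not> i < m" "\<not> j < m"
    then have "Q (2 * m - 1 - i) = Q (2 * m - 1 - j)" using eq by simp
    then have "2 * m - 1 - i = 2 * m - 1 - j" using inj_onD[OF injQ] less * by simp
    then show ?thesis using i j by (simp add: eq_diff_iff)
  qed
qed

lemma polygon_ladder: "polygon (ladder m P Q)"
  unfolding ladder_def
proof (rule polygon_cycle_edges[OF _ inj_ladder])
  show "3 \<le> 2 * m" using m by simp
next
  fix i assume i: "i < 2 * m"
  let ?c = "\<lambda>i. if i < m then P i else Q (2 * m - 1 - i)"
  consider "Suc i < m" | "i = m - 1" | "m \<le> i" "Suc i < 2 * m" | "Suc i = 2 * m"
    using i by linarith
  then show "adjacent (?c i) (?c (Suc i mod (2 * m)))"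
  proof cases
    case 1
    then show ?thesis using adjP by simp
  next
    case 2
    have "2 * m - Suc m = m - 1" by simp
    then show ?thesis using 2 m rung1 by simp
  next
    case 3
    define j where "j = 2 * m - 1 - Suc i"
    have "2 * m - 1 - i = Suc j" "Suc j < m" using 3 by (auto simp: j_def)
    then show ?thesis using 3 adjQ[of j] adjacent_sym by (simp add: j_def)
  next
    case 4
    then have "2 * m - 1 - i = 0" "\<not> i < m" using m by auto
    then show ?thesis using 4 m rung0 adjacent_sym by simp
  qed
qed

lemma Union_ladder: "\<Union>(ladder m P Q) = P ` {..<m} \<union> Q ` {..<m}"
proof -
  have "\<Union>(ladder m P Q) = (\<lambda>i. if i < m then P i else Q (2 * m - 1 - i)) ` {..<2 * m}"
    unfolding ladder_def using m by (intro Union_cycle_edges) simp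
  also have "\<dots> = P ` {..<m} \<union> Q ` {..<m}"
  proof (intro equalityI subsetI)
    fix v assume "v \<in> P ` {..<m} \<union> Q ` {..<m}"
    then consider i where "i < m" "v = P i" | i where "i < m" "v = Q i" by blast
    then show "v \<in> (\<lambda>i. if i < m then P i else Q (2 * m - 1 - i)) ` {..<2 * m}"
    proof cases
      case 1
      then show ?thesis by (intro image_eqI[of _ _ i]) auto
    next
      case 2
      then show ?thesis by (intro image_eqI[of _ _ "2 * m - 1 - i"]) auto
    qed
  qed (auto split: if_splits)
  finally show ?thesis .
qed

lemma card_ladder: "card (ladder m P Q) = 2 * m"
proof -
  have "card (\<Union>(ladder m P Q)) = card ((\<lambda>i. if i < m then P i else Q (2 * m - 1 - i)) ` {..<2 * m})"
    unfolding ladder_def using m by (subst Union_cycle_edges) auto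
  also have "\<dots> = 2 * m" by (subst card_image[OF inj_ladder]) simp
  finally show ?thesis by (simp add: polygon_card_verts[OF polygon_ladder])
qed

lemma ladder_edges:
  "{P 0, P 1} \<in> ladder m P Q" "{Q 0, Q 1} \<in> ladder m P Q"
  "{P 0, Q 0} \<in> ladder m P Q" "{P (m - 1), Q (m - 1)} \<in> ladder m P Q"
proof -
  let ?c = "\<lambda>i. if i < m then P i else Q (2 * m - 1 - i)"
  have *: "{?c i, ?c (Suc i mod (2 * m))} \<in> ladder m P Q" if "i < 2 * m" for i
    using that by (auto simp: ladder_def cycle_edges_def)
  show "{P 0, P 1} \<in> ladder m P Q" using *[of 0] m by simp
  show "{P (m - 1), Q (m - 1)} \<in> ladder m P Q" using *[of "m - 1"] m by simp
  have "?c (2 * m - 2) = Q 1" "?c (2 * m - 1) = Q 0" "Suc (2 * m - 2) mod (2 * m) = 2 * m - 1"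
    using m by auto
  then show "{Q 0, Q 1} \<in> ladder m P Q"
    using *[of "2 * m - 2"] m by (simp only: insert_commute)
  have "?c 0 = P 0" "Suc (2 * m - 1) mod (2 * m) = 0" using m by auto
  then show "{P 0, Q 0} \<in> ladder m P Q"
    using *[of "2 * m - 1"] m \<open>?c (2 * m - 1) = Q 0\<close> by (simp only: insert_commute)
qed

end

section \<open>Exchanging the left part of a polygon\<close>

text \<open>The cut lies between the planes x = -1 and x = 0: an edge crossing it counts as left,
  although its end at x = 0 counts as right.\<close>

definition left_part :: "vertex set set \<Rightarrow> vertex set set" where
  "left_part \<pi> = {e\<in>\<pi>. \<exists>v\<in>e. fst v < 0}"

definition right_part :: "vertex set set \<Rightarrow> vertex set set" where
  "right_part \<pi> = {e\<in>\<pi>. \<forall>v\<in>e. 0 \<le> fst v}"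

definition boundary :: "vertex set set \<Rightarrow> vertex set" where
  "boundary \<pi> = {v \<in> \<Union>(left_part \<pi>). 0 \<le> fst v}"

text \<open>All that the right side can notice of the left side: where the cut is crossed, and which
  crossings are connected beyond it.\<close>

definition pattern :: "vertex set set \<Rightarrow> vertex set \<times> vertex rel" where
  "pattern \<pi> = (boundary \<pi>, (link (left_part \<pi>))\<^sup>* \<inter> boundary \<pi> \<times> boundary \<pi>)"

definition glue :: "vertex set set \<Rightarrow> vertex set set \<Rightarrow> vertex set set" where
  "glue \<pi>' \<pi> = left_part \<pi>' \<union> right_part \<pi>"

lemma left_right_part: "\<pi> = left_part \<pi> \<union> right_part \<pi>"
  unfolding left_part_def right_part_def using not_less by blast

lemma left_part_cross:
  assumes "polygon \<pi>" "e \<in> left_part \<pi>" "v \<in> e" "0 \<le> fst v"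
  shows "e = {(-1, snd v), v}" "fst v = 0"
proof -
  obtain w where w: "w \<in> e" "fst w < 0" and e: "e \<in> \<pi>" using assms(2) by (auto simp: left_part_def)
  obtain a b where ab: "e = {a, b}" using polygonD(3)[OF assms(1) e] by blast
  have "w \<noteq> v" using w assms(4) by auto
  then have evw: "e = {w, v}" using ab w assms(3) by blast
  then have "adjacent w v" using polygon_edge_adjacent[OF assms(1)] e by blast
  then have "\<bar>fst w - fst v\<bar> + \<bar>fst (snd w) - fst (snd v)\<bar> + \<bar>snd (snd w) - snd (snd v)\<bar> = 1"
    by (simp add: adjacent_iff)
  then have "fst v = 0 \<and> fst w = -1 \<and> fst (snd w) = fst (snd v) \<and> snd (snd w) = snd (snd v)"
    using w assms(4) by linarith
  then show "e = {(-1, snd v), v}" "fst v = 0" using evw by (auto simp: prod_eq_iff)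
qed

text \<open>A boundary vertex has only one possible edge to the left, the one in the x-direction. So
  a pattern need not record the crossing edges themselves.\<close>

lemma left_part_at:
  assumes "polygon \<pi>" "0 \<le> fst v"
  shows "{e\<in>left_part \<pi>. v \<in> e} = (if v \<in> boundary \<pi> then {{(-1, snd v), v}} else {})"
proof (cases "v \<in> boundary \<pi>")
  case True
  then obtain e where e: "e \<in> left_part \<pi>" "v \<in> e" unfolding boundary_def by blast
  have "d = {(-1, snd v), v}" if "d \<in> left_part \<pi>" "v \<in> d" for d
    by (rule left_part_cross(1)[OF assms(1) that assms(2)])
  then have "{e\<in>left_part \<pi>. v \<in> e} = {{(-1, snd v), v}}" using e by blast
  then show ?thesis using True by simp
next
  case False
  then show ?thesis using assms by (auto simp: boundary_def)
qed

text \<open>A path from the left to the right side uses only left edges until it first meets a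
  vertex with x at least 0, and that vertex lies on the boundary.\<close>

lemma boundary_reach:
  assumes "polygon \<pi>" "u \<in> \<Union>\<pi>" "fst u < 0" "w \<in> \<Union>\<pi>" "0 \<le> fst w"
  shows "\<exists>s\<in>boundary \<pi>. (u, s) \<in> (link (left_part \<pi>))\<^sup>*"
proof -
  have u: "u \<in> \<Union>(left_part \<pi>)" using assms(2,3) by (auto simp: left_part_def)
  have bd: "y \<in> boundary \<pi>" if "(u, y) \<in> (link (left_part \<pi>))\<^sup>*" "0 \<le> fst y" for y
    using link_rtrancl_cases[OF that(1)] that(2) u assms(3) by (auto simp: boundary_def)
  have "(u, w) \<in> (link \<pi>)\<^sup>*" by (rule polygonD(5)[OF assms(1,2,4)])
  then have "(u, w) \<in> (link (left_part \<pi>))\<^sup>* \<or> (\<exists>s\<in>boundary \<pi>. (u, s) \<in> (link (left_part \<pi>))\<^sup>*)"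
  proof (induction rule: rtrancl_induct)
    case (step y z)
    then consider "(u, y) \<in> (link (left_part \<pi>))\<^sup>*" | "\<exists>s\<in>boundary \<pi>. (u, s) \<in> (link (left_part \<pi>))\<^sup>*"
      by blast
    then show ?case
    proof cases
      case 1
      have yz: "{y, z} \<in> \<pi>" using step by (simp add: link_def)
      show ?thesis
      proof (cases "0 \<le> fst y")
        case True
        then show ?thesis using bd 1 by blast
      next
        case False
        then have "(y, z) \<in> link (left_part \<pi>)" using yz by (auto simp: link_def left_part_def)
        then show ?thesis using 1 by (meson rtrancl.rtrancl_into_rtrancl)
      qed
    qed blast
  qed blast
  then show ?thesis using bd assms(5) by blast
qed

text \<open>The excursions of a path into the left part may be replaced by steps of the pattern.\<close>

lemma pattern_path:
  assumes "(u, w) \<in> (link \<pi>)\<^sup>*" "0 \<le> fst u" "0 \<le> fst w"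
  shows "(u, w) \<in> (link (right_part \<pi>) \<union> snd (pattern \<pi>))\<^sup>*"
proof -
  let ?S = "(link (right_part \<pi>) \<union> snd (pattern \<pi>))\<^sup>*"
  have pat: "(s, y) \<in> ?S" if "(s, y) \<in> (link (left_part \<pi>))\<^sup>*" "0 \<le> fst s" "0 \<le> fst y" for s y
  proof (cases "s = y")
    case False
    then have "s \<in> boundary \<pi>" "y \<in> boundary \<pi>"
      using link_rtrancl_cases[OF that(1)] that(2,3) unfolding boundary_def by blast+
    then have "(s, y) \<in> snd (pattern \<pi>)" using that(1) by (simp add: pattern_def)
    then show ?thesis by blast
  qed simp
  have "\<exists>s. 0 \<le> fst s \<and> (u, s) \<in> ?S \<and> (s, w) \<in> (link (left_part \<pi>))\<^sup>*"
    using assms(1)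
  proof (induction rule: rtrancl_induct)
    case base
    then show ?case using assms(2) by blast
  next
    case (step y z)
    then obtain s where s: "0 \<le> fst s" "(u, s) \<in> ?S" "(s, y) \<in> (link (left_part \<pi>))\<^sup>*" by blast
    have yz: "{y, z} \<in> \<pi>" using step by (simp add: link_def)
    then consider "{y, z} \<in> left_part \<pi>" | "{y, z} \<in> right_part \<pi>" using left_right_part by blast
    then show ?case
    proof cases
      case 1
      then have "(y, z) \<in> link (left_part \<pi>)" by (simp add: link_def)
      then show ?thesis using s by (meson rtrancl.rtrancl_into_rtrancl)
    next
      case 2
      then have y: "0 \<le> fst y" "0 \<le> fst z" by (auto simp: right_part_def)
      have "(u, y) \<in> ?S" using s(2) pat[OF s(3,1) y(1)] by (rule rtrancl_trans)
      moreover have "(y, z) \<in> link (right_part \<pi>)" using 2 by (simp add: link_def)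
      ultimately have "(u, z) \<in> ?S" by (meson UnI1 rtrancl.rtrancl_into_rtrancl)
      then show ?thesis using y by blast
    qed
  qed
  then show ?thesis using pat assms(3) by (meson rtrancl_trans)
qed

context
  fixes \<pi> \<pi>' :: "vertex set set"
  assumes pi: "polygon \<pi>" and pi': "polygon \<pi>'" and pat: "pattern \<pi>' = pattern \<pi>"
    and hit: "\<exists>v\<in>\<Union>\<pi>. 0 \<le> fst v" and hit': "\<exists>v\<in>\<Union>\<pi>'. 0 \<le> fst v"
begin

lemma glue_at_right:
  assumes "0 \<le> fst v"
  shows "{e\<in>glue \<pi>' \<pi>. v \<in> e} = {e\<in>\<pi>. v \<in> e}"
proof -
  have "boundary \<pi>' = boundary \<pi>" using pat by (simp add: pattern_def)
  then have "{e\<in>left_part \<pi>'. v \<in> e} = {e\<in>left_part \<pi>. v \<in> e}"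
    by (simp add: left_part_at[OF pi assms] left_part_at[OF pi' assms])
  then show ?thesis using left_right_part[of \<pi>] unfolding glue_def by blast
qed

lemma glue_at_left: "fst v < 0 \<Longrightarrow> {e\<in>glue \<pi>' \<pi>. v \<in> e} = {e\<in>\<pi>'. v \<in> e}"
  by (auto simp: glue_def left_part_def right_part_def)

text \<open>Around a vertex the glued graph looks like \<open>\<pi>\<close> if x is at least 0 and
  like \<open>\<pi>'\<close> otherwise, which gives the degrees. A path of \<open>\<pi>\<close>
  between right vertices survives because its excursions to the left are steps of the common
  pattern, and these are realised inside \<open>\<pi>'\<close>. The assumption that
  \<open>\<pi>'\<close> reaches the right side excludes a polygon entirely beyond the cut, which
  would remain a component of its own.\<close>

lemma polygon_glue: "polygon (glue \<pi>' \<pi>)"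
proof -
  let ?G = "glue \<pi>' \<pi>"
  have sub: "link (right_part \<pi>) \<union> snd (pattern \<pi>) \<subseteq> (link ?G)\<^sup>*"
  proof -
    have "link (right_part \<pi>) \<subseteq> link ?G" by (auto simp: link_def glue_def)
    moreover have "snd (pattern \<pi>) \<subseteq> (link (left_part \<pi>'))\<^sup>*"
      unfolding pat[symmetric] by (auto simp: pattern_def)
    moreover have "(link (left_part \<pi>'))\<^sup>* \<subseteq> (link ?G)\<^sup>*"
      by (rule link_mono) (auto simp: glue_def)
    ultimately show ?thesis by blast
  qed
  have rr: "(a, b) \<in> (link ?G)\<^sup>*" if "a \<in> \<Union>\<pi>" "b \<in> \<Union>\<pi>" "0 \<le> fst a" "0 \<le> fst b" for a b
  proof -
    have "(a, b) \<in> (link (right_part \<pi>) \<union> snd (pattern \<pi>))\<^sup>*"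
      by (rule pattern_path[OF polygonD(5)[OF pi that(1,2)] that(3,4)])
    moreover have "(link (right_part \<pi>) \<union> snd (pattern \<pi>))\<^sup>* \<subseteq> (link ?G)\<^sup>*"
      using rtrancl_mono[OF sub] by (simp only: rtrancl_idemp)
    ultimately show ?thesis by blast
  qed
  \<comment> \<open>Left vertices are led to the boundary inside \<open>\<pi>'\<close>; as the
    boundaries agree, they arrive at a vertex of \<open>\<pi>\<close>.\<close>
  have to_right: "\<exists>b\<in>\<Union>\<pi>. 0 \<le> fst b \<and> (a, b) \<in> (link ?G)\<^sup>*" if a: "a \<in> \<Union>?G" for a
  proof (cases "0 \<le> fst a")
    case True
    have "{e\<in>?G. a \<in> e} \<noteq> {}" using a by blast
    then have "a \<in> \<Union>\<pi>" unfolding glue_at_right[OF True] by blast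
    then show ?thesis using True by blast
  next
    case False
    have ne: "{e\<in>?G. a \<in> e} \<noteq> {}" using a by blast
    have a0: "fst a < 0" using False by simp
    have "a \<in> \<Union>\<pi>'" using ne unfolding glue_at_left[OF a0] by blast
    moreover obtain w where "w \<in> \<Union>\<pi>'" "0 \<le> fst w" using hit' by blast
    ultimately obtain s where s: "s \<in> boundary \<pi>'" "(a, s) \<in> (link (left_part \<pi>'))\<^sup>*"
      using boundary_reach[OF pi' _ a0] by meson
    have "(a, s) \<in> (link ?G)\<^sup>*" using s(2) link_mono[of "left_part \<pi>'" ?G] by (auto simp: glue_def)
    moreover have "s \<in> boundary \<pi>" using s(1) pat by (simp add: pattern_def)
    then have "s \<in> \<Union>\<pi>" "0 \<le> fst s" by (auto simp: boundary_def left_part_def)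
    ultimately show ?thesis by blast
  qed
  show ?thesis unfolding polygon_altdef
  proof (intro conjI ballI)
    show "finite ?G" using polygonD(1)[OF pi] polygonD(1)[OF pi']
      by (simp add: glue_def left_part_def right_part_def)
    obtain v where v: "v \<in> \<Union>\<pi>" "0 \<le> fst v" using hit by blast
    have "{e\<in>\<pi>. v \<in> e} \<noteq> {}" using v by blast
    then show "?G \<noteq> {}" using glue_at_right[OF v(2)] by blast
  next
    fix e assume "e \<in> ?G"
    then have "e \<in> \<pi> \<or> e \<in> \<pi>'" by (auto simp: glue_def left_part_def right_part_def)
    then show "\<exists>u v. e = {u, v} \<and> adjacent u v" using polygonD(3)[OF pi] polygonD(3)[OF pi'] by blast
  next
    fix v assume "v \<in> \<Union>?G"
    then have ne: "{e\<in>?G. v \<in> e} \<noteq> {}" by blast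
    show "card {e\<in>?G. v \<in> e} = 2"
    proof (cases "0 \<le> fst v")
      case True
      have "v \<in> \<Union>\<pi>" using ne unfolding glue_at_right[OF True] by blast
      then show ?thesis using polygonD(4)[OF pi] glue_at_right[OF True] by simp
    next
      case False
      then have v: "fst v < 0" by simp
      have "v \<in> \<Union>\<pi>'" using ne unfolding glue_at_left[OF v] by blast
      then show ?thesis using polygonD(4)[OF pi'] glue_at_left[OF v] by simp
    qed
  next
    fix a b assume "a \<in> \<Union>?G" "b \<in> \<Union>?G"
    then obtain a' b' where ab: "a' \<in> \<Union>\<pi>" "0 \<le> fst a'" "(a, a') \<in> (link ?G)\<^sup>*"
      "b' \<in> \<Union>\<pi>" "0 \<le> fst b'" "(b, b') \<in> (link ?G)\<^sup>*" using to_right by meson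
    then show "(a, b) \<in> (link ?G)\<^sup>*"
      using rr[OF ab(1,4,2,5)] link_rtrancl_sym[OF ab(6)] by (meson rtrancl_trans)
  qed
qed

end

section \<open>Windows and blocks\<close>

definition grid :: "nat \<Rightarrow> nat \<Rightarrow> (int \<times> int) set" where
  "grid L M = {0..int L} \<times> {0..int M}"

text \<open>The tube is extended to all integers x, so that translations and reflections stay
  inside.\<close>

definition cylinder_polygons :: "nat \<Rightarrow> nat \<Rightarrow> vertex set set set" where
  "cylinder_polygons L M = {\<pi>. polygon \<pi> \<and> snd ` \<Union>\<pi> \<subseteq> grid L M}"

lemma finite_grid: "finite (grid L M)"
  by (simp add: grid_def)

lemma card_grid: "card (grid L M) = tube_width L M"
proof -
  have "nat (int L + 1) = L + 1" "nat (int M + 1) = M + 1" by simp_all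
  then show ?thesis by (simp add: grid_def tube_width_def card_cartesian_product)
qed

lemma tube_eq: "tube L M = {v. 0 \<le> fst v \<and> snd v \<in> grid L M}"
  by (auto simp: tube_def grid_def)

lemma cylinder_polygonsD:
  assumes "\<pi> \<in> cylinder_polygons L M"
  shows "polygon \<pi>" "v \<in> \<Union>\<pi> \<Longrightarrow> snd v \<in> grid L M"
  using assms unfolding cylinder_polygons_def by blast+

lemma polygon_in_tube_iff:
  "polygon_in_tube L M \<pi> \<longleftrightarrow> \<pi> \<in> cylinder_polygons L M \<and> (\<forall>v\<in>\<Union>\<pi>. 0 \<le> fst v)"
  unfolding polygon_in_tube_def cylinder_polygons_def tube_eq by blast

lemma cylinder_shift:
  assumes "\<pi> \<in> cylinder_polygons L M"
  shows "gmap (shift t) \<pi> \<in> cylinder_polygons L M"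
proof -
  have "snd ` \<Union>(gmap (shift t) \<pi>) = snd ` \<Union>\<pi>"
    unfolding Union_gmap image_image by simp
  then show ?thesis
    using assms polygon_shift by (simp add: cylinder_polygons_def)
qed

lemma cylinder_reflect:
  assumes "\<pi> \<in> cylinder_polygons L M"
  shows "gmap (reflect t) \<pi> \<in> cylinder_polygons L M"
proof -
  have "snd ` \<Union>(gmap (reflect t) \<pi>) = snd ` \<Union>\<pi>"
    unfolding Union_gmap image_image by simp
  then show ?thesis
    using assms polygon_reflect by (simp add: cylinder_polygons_def)
qed

lemma mem_gmap_shift: "e \<in> gmap (shift t) \<pi> \<longleftrightarrow> shift (- t) ` e \<in> \<pi>"
proof
  assume "e \<in> gmap (shift t) \<pi>"
  then obtain d where "d \<in> \<pi>" "e = shift t ` d" unfolding gmap_def by blast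
  then show "shift (- t) ` e \<in> \<pi>" by (simp add: image_image shift_eq)
next
  assume *: "shift (- t) ` e \<in> \<pi>"
  have "e = shift t ` shift (- t) ` e" by (simp add: image_image shift_eq)
  then show "e \<in> gmap (shift t) \<pi>" unfolding gmap_def using * by (rule image_eqI)
qed

lemma edge_fst_dist:
  assumes "polygon \<pi>" "e \<in> \<pi>" "u \<in> e" "v \<in> e"
  shows "\<bar>fst u - fst v\<bar> \<le> 1"
proof -
  obtain a b where ab: "e = {a, b}" "adjacent a b" using polygonD(3)[OF assms(1,2)] by blast
  then have "\<bar>fst a - fst b\<bar> \<le> 1" "\<bar>fst b - fst a\<bar> \<le> 1" by (simp_all add: adjacent_iff)
  moreover have "(u = a \<or> u = b) \<and> (v = a \<or> v = b)" using ab(1) assms(3,4) by blast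
  ultimately show ?thesis by auto
qed

text \<open>
  A window records \<open>s\<close> consecutive blocks by the edges of \<open>\<pi>\<close> that touch them. The edges that
  cross its ends are kept whole: cutting them in half would lose no information.
\<close>

definition window :: "nat \<Rightarrow> vertex set set \<Rightarrow> vertex set set" where
  "window s \<pi> = {e\<in>\<pi>. \<exists>v\<in>e. 0 \<le> fst v \<and> fst v < int s}"

definition spanning :: "nat \<Rightarrow> nat \<Rightarrow> nat \<Rightarrow> vertex set set set" where
  "spanning L M s = {\<pi> \<in> cylinder_polygons L M. \<forall>i<s. \<exists>v\<in>\<Union>\<pi>. fst v = int i}"

definition windows :: "nat \<Rightarrow> nat \<Rightarrow> nat \<Rightarrow> vertex set set set" where
  "windows L M s = window s ` spanning L M s"

definition window_verts :: "nat \<Rightarrow> vertex set set \<Rightarrow> vertex set" where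
  "window_verts s w = {v \<in> \<Union>w. 0 \<le> fst v \<and> fst v < int s}"

text \<open>Fullness is expressed by the total number of vertices; this being the largest possible
  total, it forces every single plane to be full.\<close>

definition full_windows :: "nat \<Rightarrow> nat \<Rightarrow> nat \<Rightarrow> vertex set set set" where
  "full_windows L M s = {w \<in> windows L M s. card (window_verts s w) = tube_width L M * s}"

lemma window_window: "t \<le> s \<Longrightarrow> window t (window s \<pi>) = window t \<pi>"
  unfolding window_def by force

lemma window_verts_window [simp]: "window_verts s (window s \<pi>) = window_verts s \<pi>"
  unfolding window_def window_verts_def by blast

lemma window_verts_subset: "\<pi> \<in> cylinder_polygons L M \<Longrightarrow> window_verts s \<pi> \<subseteq> {0..<int s} \<times> grid L M"
  using cylinder_polygonsD(2) by (fastforce simp: window_verts_def)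

lemma finite_window_verts: "\<pi> \<in> cylinder_polygons L M \<Longrightarrow> finite (window_verts s \<pi>)"
  using finite_subset[OF window_verts_subset] finite_grid by auto

lemma card_window_verts_le:
  assumes "w \<in> windows L M s"
  shows "card (window_verts s w) \<le> tube_width L M * s"
proof -
  obtain \<pi> where \<pi>: "\<pi> \<in> cylinder_polygons L M" "w = window s \<pi>"
    using assms by (auto simp: windows_def spanning_def)
  have "card (window_verts s \<pi>) \<le> card ({0..<int s} \<times> grid L M)"
    using window_verts_subset[OF \<pi>(1)] finite_grid by (intro card_mono) auto
  then show ?thesis by (simp add: \<pi> card_cartesian_product card_grid mult.commute)
qed

lemma finite_windows: "finite (windows L M s)"
proof (rule finite_subset)
  show "windows L M s \<subseteq> Pow (Pow ({-1..int s} \<times> grid L M))"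
  proof (intro subsetI PowI)
    fix w e v
    assume w: "w \<in> windows L M s" and e: "e \<in> w" and v: "v \<in> e"
    obtain \<pi> where \<pi>: "\<pi> \<in> cylinder_polygons L M" "w = window s \<pi>"
      using w by (auto simp: windows_def spanning_def)
    obtain u where u: "u \<in> e" "0 \<le> fst u" "fst u < int s" and ep: "e \<in> \<pi>"
      using e \<pi> by (auto simp: window_def)
    have "\<bar>fst u - fst v\<bar> \<le> 1"
      by (rule edge_fst_dist[OF cylinder_polygonsD(1)[OF \<pi>(1)] ep u(1) v])
    then have "fst v \<in> {-1..int s}" using u by auto
    moreover have "snd v \<in> grid L M" using cylinder_polygonsD(2)[OF \<pi>(1)] ep v by blast
    ultimately show "v \<in> {-1..int s} \<times> grid L M" by (simp add: mem_Times_iff)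
  qed
  show "finite (Pow (Pow ({-1..int s} \<times> grid L M)))" using finite_grid by simp
qed

lemma finite_full_windows: "finite (full_windows L M s)"
  using finite_windows by (simp add: full_windows_def)

lemma window_gmap_shift:
  "window t (gmap (shift (- int s)) \<pi>) =
     gmap (shift (- int s)) {e\<in>\<pi>. \<exists>v\<in>e. int s \<le> fst v \<and> fst v < int (s + t)}"
proof -
  have "window t (gmap (shift (- int s)) \<pi>) = gmap (shift (- int s))
      {e\<in>\<pi>. \<exists>v\<in>shift (- int s) ` e. 0 \<le> fst v \<and> fst v < int t}"
    unfolding window_def by (rule gmap_filter[symmetric])
  also have "{e\<in>\<pi>. \<exists>v\<in>shift (- int s) ` e. 0 \<le> fst v \<and> fst v < int t} =
      {e\<in>\<pi>. \<exists>v\<in>e. int s \<le> fst v \<and> fst v < int (s + t)}"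
    by (intro Collect_cong conj_cong refl) (auto simp: bex_simps)
  finally show ?thesis .
qed

section \<open>Cutting a window in two\<close>

definition split_window :: "nat \<Rightarrow> nat \<Rightarrow> vertex set set \<Rightarrow> vertex set set \<times> vertex set set" where
  "split_window s t w = (window s w, window t (gmap (shift (- int s)) w))"

lemma split_window_in:
  assumes "w \<in> windows L M (s + t)"
  shows "split_window s t w \<in> windows L M s \<times> windows L M t"
proof -
  obtain \<pi> where \<pi>: "\<pi> \<in> spanning L M (s + t)" "w = window (s + t) \<pi>"
    using assms by (auto simp: windows_def)
  have cyl: "\<pi> \<in> cylinder_polygons L M" using \<pi>(1) by (simp add: spanning_def)
  have hit: "\<exists>v\<in>\<Union>\<pi>. fst v = int i" if "i < s + t" for i
    using \<pi>(1) that by (simp add: spanning_def)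
  have "window s w = window s \<pi>" by (simp add: \<pi>(2) window_window)
  moreover have "\<pi> \<in> spanning L M s" using cyl hit by (simp add: spanning_def)
  ultimately have 1: "window s w \<in> windows L M s" by (simp add: windows_def)
  have "{e\<in>w. \<exists>v\<in>e. int s \<le> fst v \<and> fst v < int (s + t)} =
      {e\<in>\<pi>. \<exists>v\<in>e. int s \<le> fst v \<and> fst v < int (s + t)}"
    unfolding \<pi>(2) window_def by force
  then have "window t (gmap (shift (- int s)) w) = window t (gmap (shift (- int s)) \<pi>)"
    unfolding window_gmap_shift by simp
  moreover have "gmap (shift (- int s)) \<pi> \<in> spanning L M t"
    unfolding spanning_def
  proof (intro CollectI conjI cylinder_shift[OF cyl] allI impI)
    fix i assume "i < t"
    then obtain v where "v \<in> \<Union>\<pi>" "fst v = int (s + i)" using hit[of "s + i"] by auto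
    then show "\<exists>v\<in>\<Union>(gmap (shift (- int s)) \<pi>). fst v = int i"
      unfolding Union_gmap by (intro bexI[of _ "shift (- int s) v"]) auto
  qed
  ultimately have 2: "window t (gmap (shift (- int s)) w) \<in> windows L M t" by (simp add: windows_def)
  show ?thesis using 1 2 by (simp add: split_window_def)
qed

text \<open>An edge across the cut belongs to both halves as a whole, so their union restores the
  window. Hence cutting is injective.\<close>

lemma window_split_union:
  assumes "w \<in> windows L M (s + t)"
  shows "w = fst (split_window s t w) \<union> gmap (shift (int s)) (snd (split_window s t w))"
proof -
  obtain \<pi> where \<pi>: "w = window (s + t) \<pi>" using assms by (auto simp: windows_def)
  have "w = window s w \<union> {e\<in>w. \<exists>v\<in>e. int s \<le> fst v \<and> fst v < int (s + t)}"
    unfolding \<pi> window_def using not_less by fastforce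
  then show ?thesis
    unfolding split_window_def window_gmap_shift fst_conv snd_conv gmap_shift_shift by simp
qed

lemma inj_split_window: "inj_on (split_window s t) (windows L M (s + t))"
  by (rule inj_onI) (metis window_split_union)

text \<open>Edges across the cut occur in both halves, whereas each vertex belongs to exactly one of
  them; this is why weights are defined by vertices.\<close>

lemma card_window_verts_split:
  assumes "w \<in> windows L M (s + t)"
  shows "card (window_verts (s + t) w) = card (window_verts s (fst (split_window s t w)))
           + card (window_verts t (snd (split_window s t w)))"
proof -
  obtain \<pi> where \<pi>: "\<pi> \<in> cylinder_polygons L M" "w = window (s + t) \<pi>"
    using assms by (auto simp: windows_def spanning_def)
  have fin: "finite (window_verts (s + t) w)" using finite_window_verts[OF \<pi>(1)] by (simp add: \<pi>(2))
  define B where "B = {v\<in>\<Union>w. int s \<le> fst v \<and> fst v < int (s + t)}"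
  have "window_verts t (gmap (shift (- int s)) w) = shift (- int s) ` B"
    unfolding window_verts_def Union_gmap B_def by (auto simp: image_iff)
  then have "card (window_verts t (snd (split_window s t w))) = card B"
    by (simp add: split_window_def card_image[OF inj_on_subset[OF inj_shift]])
  moreover have "window_verts (s + t) w = window_verts s w \<union> B" "window_verts s w \<inter> B = {}"
    unfolding window_verts_def B_def by auto
  moreover have "window_verts s w = window_verts s (fst (split_window s t w))"
    by (simp add: split_window_def)
  ultimately show ?thesis using fin by (simp add: card_Un_disjoint)
qed

text \<open>The vertex counts of the halves add up and each has its own upper bound, so a full
  window can only be cut into full ones.\<close>

lemma card_full_windows_add:
  "card (full_windows L M (s + t)) \<le> card (full_windows L M s) * card (full_windows L M t)"
proof -
  have "split_window s t w \<in> full_windows L M s \<times> full_windows L M t"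
    if w: "w \<in> full_windows L M (s + t)" for w
  proof -
    have w': "w \<in> windows L M (s + t)" using w by (simp add: full_windows_def)
    obtain a b where ab: "split_window s t w = (a, b)" by fastforce
    then have in': "a \<in> windows L M s" "b \<in> windows L M t" using split_window_in[OF w'] by auto
    have "card (window_verts s a) + card (window_verts t b) = tube_width L M * s + tube_width L M * t"
      using card_window_verts_split[OF w'] w ab by (simp add: full_windows_def distrib_left)
    then have "card (window_verts s a) = tube_width L M * s" "card (window_verts t b) = tube_width L M * t"
      using card_window_verts_le[OF in'(1)] card_window_verts_le[OF in'(2)] by linarith+
    then show ?thesis using in' ab by (simp add: full_windows_def)
  qed
  then have "split_window s t ` full_windows L M (s + t) \<subseteq> full_windows L M s \<times> full_windows L M t"
    by blast
  moreover have "inj_on (split_window s t) (full_windows L M (s + t))"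
    by (rule inj_on_subset[OF inj_split_window]) (auto simp: full_windows_def)
  ultimately have "card (full_windows L M (s + t)) \<le> card (full_windows L M s \<times> full_windows L M t)"
    using finite_full_windows by (metis card_image card_mono finite_cartesian_product)
  then show ?thesis by (simp add: card_cartesian_product)
qed

text \<open>The generating function by length of all \<open>s\<close>-blocks, full or not. Its
  submultiplicativity does the work of a transfer matrix.\<close>

definition window_sum :: "nat \<Rightarrow> nat \<Rightarrow> real \<Rightarrow> nat \<Rightarrow> real" where
  "window_sum L M z s = (\<Sum>w\<in>windows L M s. z ^ card (window_verts s w))"

lemma window_sum_nonneg: "0 \<le> z \<Longrightarrow> 0 \<le> window_sum L M z s"
  by (simp add: window_sum_def sum_nonneg)

lemma window_sum_add:
  assumes "0 \<le> z"
  shows "window_sum L M z (s + t) \<le> window_sum L M z s * window_sum L M z t"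
proof -
  define F where "F = (\<lambda>(a, b). z ^ card (window_verts s a) * z ^ card (window_verts t b))"
  have "window_sum L M z (s + t) = (\<Sum>w\<in>windows L M (s + t). F (split_window s t w))"
    unfolding window_sum_def
    by (intro sum.cong refl) (simp add: F_def card_window_verts_split power_add case_prod_beta)
  also have "\<dots> = (\<Sum>x\<in>split_window s t ` windows L M (s + t). F x)"
    by (simp add: sum.reindex[OF inj_split_window])
  also have "\<dots> \<le> (\<Sum>x\<in>windows L M s \<times> windows L M t. F x)"
  proof (rule sum_mono2)
    show "split_window s t ` windows L M (s + t) \<subseteq> windows L M s \<times> windows L M t"
      using split_window_in by blast
  qed (use finite_windows assms in \<open>auto simp: F_def\<close>)
  also have "\<dots> = window_sum L M z s * window_sum L M z t"
    unfolding F_def window_sum_def by (simp add: sum_product sum.cartesian_product)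
  finally show ?thesis .
qed

text \<open>A non-full window misses at least one vertex. The inequality is multiplied by
  \<open>z\<close> so that this deficit needs no negative exponent.\<close>

lemma window_sum_le:
  assumes "1 \<le> z"
  shows "z * window_sum L M z s \<le>
    z ^ (tube_width L M * s) * (z * card (full_windows L M s) + card (windows L M s))"
proof -
  let ?N = "tube_width L M * s"
  have "z * window_sum L M z s =
      (\<Sum>w\<in>full_windows L M s. z * z ^ card (window_verts s w)) +
      (\<Sum>w\<in>windows L M s - full_windows L M s. z * z ^ card (window_verts s w))"
    unfolding window_sum_def sum_distrib_left
    by (rule sum.subset_diff[OF _ finite_windows, THEN trans, OF _ add.commute])
       (auto simp: full_windows_def)
  also have "(\<Sum>w\<in>full_windows L M s. z * z ^ card (window_verts s w)) =
      card (full_windows L M s) * (z * z ^ ?N)"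
    by (simp add: full_windows_def)
  also have "(\<Sum>w\<in>windows L M s - full_windows L M s. z * z ^ card (window_verts s w)) \<le>
      (\<Sum>w\<in>windows L M s - full_windows L M s. z ^ ?N)"
  proof (rule sum_mono)
    fix w assume "w \<in> windows L M s - full_windows L M s"
    then have "Suc (card (window_verts s w)) \<le> ?N"
      using card_window_verts_le[of w L M s] by (auto simp: full_windows_def le_less)
    then have "z ^ Suc (card (window_verts s w)) \<le> z ^ ?N" by (rule power_increasing[OF _ assms])
    then show "z * z ^ card (window_verts s w) \<le> z ^ ?N" by simp
  qed
  also have "\<dots> \<le> card (windows L M s) * z ^ ?N"
    using assms finite_windows by (simp add: card_mono mult_right_mono)
  finally show ?thesis by (simp add: algebra_simps)
qed

section \<open>Correspondence between windows and sequences of 1-blocks\<close>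

lemma half_edges_iff:
  "(v, w) \<in> half_edges \<pi> k \<longleftrightarrow> {v, w} \<in> \<pi> \<and> fst v = k \<and> (fst w = k - 1 \<or> fst w = k + 1)"
proof -
  have "(\<exists>u u'. {v, w} = {u, u'} \<and> fst u = j - 1 \<and> fst u' = j) \<longleftrightarrow>
      fst v = j - 1 \<and> fst w = j \<or> fst v = j \<and> fst w = j - 1" for j
    by (metis doubleton_eq_iff)
  then have "{v, w} \<in> section_edges \<pi> j \<longleftrightarrow>
      {v, w} \<in> \<pi> \<and> (fst v = j - 1 \<and> fst w = j \<or> fst v = j \<and> fst w = j - 1)" for j
    unfolding section_edges_def by blast
  then show ?thesis unfolding half_edges_def by auto
qed

lemma finite_hinge_vertices: "polygon \<pi> \<Longrightarrow> finite (hinge_vertices \<pi> k)"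
  by (rule finite_subset[OF _ polygon_finite_verts]) (auto simp: hinge_vertices_def)

lemma hinge_vertices_window:
  "i < s \<Longrightarrow> hinge_vertices (window s \<pi>) (int i) = hinge_vertices \<pi> (int i)"
  unfolding hinge_vertices_def window_def by force

lemma hinge_edge_in_window:
  assumes "polygon \<pi>" "i < s" "e \<in> hinge_edges \<pi> (int i)"
  shows "e \<in> window s \<pi>"
proof -
  have e: "e \<in> \<pi>" "\<forall>v\<in>e. fst v = int i" using assms(3) by (simp_all add: hinge_edges_def)
  obtain u v where "e = {u, v}" using polygonD(3)[OF assms(1) e(1)] by blast
  then have "u \<in> e" by simp
  moreover from this have "0 \<le> fst u \<and> fst u < int s" using e(2) assms(2) by simp
  ultimately show ?thesis using e(1) unfolding window_def by blast
qed

lemma block_at_window: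
  assumes "polygon \<pi>" "i < s"
  shows "block_at (window s \<pi>) (int i) = block_at \<pi> (int i)"
proof -
  have "hinge_edges (window s \<pi>) (int i) = hinge_edges \<pi> (int i)"
    using hinge_edge_in_window[OF assms] unfolding hinge_edges_def
    by (auto simp: window_def)
  moreover have "half_edges (window s \<pi>) (int i) = half_edges \<pi> (int i)"
    using assms(2) by (intro set_eqI) (auto simp only: half_edges_iff window_def split_paired_all; force)
  ultimately show ?thesis using assms(2) by (simp add: block_at_def hinge_vertices_window)
qed

text \<open>The sum of the degrees over the hinge vertices counts a hinge edge twice and a half-edge
  once, so 2|V| = 2|E| + |H|. In particular the length is an integer.\<close>

lemma block_length_block_at:
  assumes "polygon \<pi>"
  shows "block_length (block_at \<pi> k) = real (card (hinge_vertices \<pi> k))"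
proof -
  define V where "V = hinge_vertices \<pi> k"
  define E where "E = hinge_edges \<pi> k"
  define H where "H = half_edges \<pi> k"
  define X where "X = (\<lambda>(v, w). {v, w}) ` H"
  have fin: "finite \<pi>" "finite V"
    using polygonD(1)[OF assms] finite_hinge_vertices[OF assms] by (simp_all add: V_def)
  have sub: "E \<subseteq> \<pi>" "X \<subseteq> \<pi>"
    by (auto simp: E_def X_def H_def hinge_edges_def half_edges_iff)
  \<comment> \<open>Only one end of such an edge lies in the plane \<open>k\<close>, so the whole
    edge determines its half.\<close>
  have inj: "inj_on (\<lambda>(v, w). {v, w}) H"
  proof (rule inj_onI, clarify)
    fix v w v' w'
    assume "(v, w) \<in> H" "(v', w') \<in> H" "{v, w} = {v', w'}"
    then show "v = v' \<and> w = w'" unfolding H_def half_edges_iff doubleton_eq_iff by auto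
  qed
  have disj: "E \<inter> X = {}"
    by (auto simp: E_def X_def H_def hinge_edges_def half_edges_iff)
  have cE: "card (e \<inter> V) = 2" if "e \<in> E" for e
  proof -
    have "e \<inter> V = e" using that by (auto simp: E_def V_def hinge_edges_def hinge_vertices_def)
    then show ?thesis using polygon_edge_card[OF assms] that sub by auto
  qed
  have cX: "card (e \<inter> V) = 1" if e: "e \<in> X" for e
  proof -
    obtain v w where vw: "(v, w) \<in> H" "e = {v, w}" using e unfolding X_def by auto
    have "e \<inter> V = {v}"
      using vw unfolding H_def half_edges_iff V_def hinge_vertices_def by auto
    then show ?thesis by simp
  qed
  have cO: "card (e \<inter> V) = 0" if e: "e \<in> \<pi>" "e \<notin> E" "e \<notin> X" for e
  proof (rule ccontr)
    assume "card (e \<inter> V) \<noteq> 0"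
    then have "e \<inter> V \<noteq> {}" by (metis card.empty)
    then obtain v where v: "v \<in> e" "fst v = k" unfolding V_def hinge_vertices_def by blast
    obtain w where w: "w \<in> e" "fst w \<noteq> k" using e by (auto simp: E_def hinge_edges_def)
    obtain a b where "e = {a, b}" using polygonD(3)[OF assms e(1)] by blast
    then have evw: "e = {v, w}" using v w by auto
    have "\<bar>fst v - fst w\<bar> \<le> 1" by (rule edge_fst_dist[OF assms e(1) v(1) w(1)])
    then have "(v, w) \<in> H" using v w e(1) evw unfolding H_def half_edges_iff by auto
    then show False using e(3) evw unfolding X_def by (auto simp: image_iff)
  qed
  have "(\<Sum>v\<in>V. card {e\<in>\<pi>. v \<in> e}) = (\<Sum>v\<in>V. 2)"
    by (rule sum.cong[OF refl], rule polygonD(4)[OF assms]) (simp add: V_def hinge_vertices_def)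
  then have "2 * card V = (\<Sum>e\<in>\<pi>. card (e \<inter> V))"
    unfolding sum_degree[OF fin] by simp
  also have "\<dots> = (\<Sum>e\<in>E \<union> X. card (e \<inter> V))"
    using fin sub cO by (intro sum.mono_neutral_right) auto
  also have "\<dots> = (\<Sum>e\<in>E. card (e \<inter> V)) + (\<Sum>e\<in>X. card (e \<inter> V))"
    using fin sub disj by (intro sum.union_disjoint) (auto intro: finite_subset)
  also have "\<dots> = 2 * card E + card X" by (simp add: cE cX)
  also have "card X = card H" unfolding X_def by (rule card_image[OF inj])
  finally have "real (2 * card V) = real (2 * card E + card H)" by simp
  then show ?thesis
    unfolding V_def E_def H_def by (simp add: block_length_def block_at_def field_simps)
qed

lemma shift_block_shift_block: "shift_block s (shift_block t b) = shift_block (t + s) b"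
proof -
  have "(`) (shift s) ` (`) (shift t) ` E = (`) (shift (t + s)) ` E" for E
    by (simp add: image_image shift_eq add.assoc)
  then show ?thesis
    by (cases b) (simp add: shift_block_def image_image shift_eq add.assoc map_prod_def case_prod_beta)
qed

lemma shift_block_0 [simp]: "shift_block 0 b = b"
  by (cases b) (simp add: shift_block_def shift_eq map_prod_def)

lemma block_at_shift: "block_at (gmap (shift t) \<pi>) (k + t) = shift_block t (block_at \<pi> k)"
proof -
  have V: "hinge_vertices (gmap (shift t) \<pi>) (k + t) = shift t ` hinge_vertices \<pi> k"
    unfolding hinge_vertices_def Union_gmap by auto
  have "gmap (shift t) {e\<in>\<pi>. \<forall>v\<in>shift t ` e. fst v = k + t} =
      {e\<in>gmap (shift t) \<pi>. \<forall>v\<in>e. fst v = k + t}" by (rule gmap_filter)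
  then have E: "hinge_edges (gmap (shift t) \<pi>) (k + t) = (`) (shift t) ` hinge_edges \<pi> k"
    unfolding hinge_edges_def gmap_def by simp
  have H: "half_edges (gmap (shift t) \<pi>) (k + t) = map_prod (shift t) (shift t) ` half_edges \<pi> k"
  proof (intro equalityI subsetI)
    fix x assume x: "x \<in> half_edges (gmap (shift t) \<pi>) (k + t)"
    obtain v w where vw: "x = (v, w)" by (rule prod.exhaust)
    have "(shift (- t) v, shift (- t) w) \<in> half_edges \<pi> k"
      using x unfolding vw half_edges_iff mem_gmap_shift by auto
    then show "x \<in> map_prod (shift t) (shift t) ` half_edges \<pi> k"
      by (rule rev_image_eqI) (simp add: vw shift_eq)
  next
    fix x assume "x \<in> map_prod (shift t) (shift t) ` half_edges \<pi> k"
    then obtain v w where vw: "x = (shift t v, shift t w)" "(v, w) \<in> half_edges \<pi> k" by auto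
    then show "x \<in> half_edges (gmap (shift t) \<pi>) (k + t)"
      unfolding vw(1) half_edges_iff mem_gmap_shift by (auto simp: shift_eq)
  qed
  show ?thesis by (simp add: block_at_def shift_block_def V E H)
qed

text \<open>The block sequence of \<open>w\<close> placed with its first hinge in the plane
  \<open>k\<close>; varying \<open>k\<close> gives all translates.\<close>

definition blocks :: "nat \<Rightarrow> vertex set set \<Rightarrow> int \<Rightarrow> block list" where
  "blocks s w k = map (shift_block k) (map (\<lambda>i. block_at w (int i)) [0..<s])"

lemma map_shift_blocks: "map (shift_block t) (blocks s w k) = blocks s w (k + t)"
  by (simp add: blocks_def shift_block_shift_block)

lemma blocks_window:
  "polygon \<pi> \<Longrightarrow> blocks s (window s \<pi>) k = blocks s \<pi> k"
  by (simp add: blocks_def block_at_window)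

lemma blocks_shift:
  "blocks s (gmap (shift (- k)) \<pi>) k = map (\<lambda>i. block_at \<pi> (k + int i)) [0..<s]"
proof -
  have "shift_block k (block_at (gmap (shift (- k)) \<pi>) (int i)) = block_at \<pi> (k + int i)" for i
    using block_at_shift[of k "gmap (shift (- k)) \<pi>" "int i"]
    by (simp add: gmap_shift_shift add.commute)
  then show ?thesis by (simp add: blocks_def)
qed

text \<open>A window can be recovered from its blocks: an edge touching one of the planes belongs to
  the hinge there or completes one of the half-edges.\<close>

lemma window_of_blocks:
  assumes "polygon \<pi>"
  shows "window s \<pi> = (\<Union>(V, E, H) \<in> set (blocks s \<pi> 0). E \<union> (\<lambda>(v, w). {v, w}) ` H)"
proof -
  have "window s \<pi> = (\<Union>i<s. hinge_edges \<pi> (int i) \<union> (\<lambda>(v, w). {v, w}) ` half_edges \<pi> (int i))"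
  proof (intro equalityI subsetI)
    fix e assume "e \<in> window s \<pi>"
    then obtain v where v: "e \<in> \<pi>" "v \<in> e" "0 \<le> fst v" "fst v < int s" by (auto simp: window_def)
    define i where "i = nat (fst v)"
    have i: "i < s" "fst v = int i" using v by (auto simp: i_def)
    have "e \<in> hinge_edges \<pi> (int i) \<union> (\<lambda>(v, w). {v, w}) ` half_edges \<pi> (int i)"
    proof (cases "e \<in> hinge_edges \<pi> (int i)")
      case False
      then obtain w where w: "w \<in> e" "fst w \<noteq> int i" using v(1) by (auto simp: hinge_edges_def)
      obtain a b where "e = {a, b}" using polygonD(3)[OF assms v(1)] by blast
      then have evw: "e = {v, w}" using v w i by auto
      have "\<bar>fst v - fst w\<bar> \<le> 1" by (rule edge_fst_dist[OF assms v(1,2) w(1)])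
      then have "(v, w) \<in> half_edges \<pi> (int i)" using v w i evw unfolding half_edges_iff by auto
      then have "e \<in> (\<lambda>(v, w). {v, w}) ` half_edges \<pi> (int i)" by (rule rev_image_eqI) (simp add: evw)
      then show ?thesis by simp
    qed simp
    then show "e \<in> (\<Union>i<s. hinge_edges \<pi> (int i) \<union> (\<lambda>(v, w). {v, w}) ` half_edges \<pi> (int i))"
      using i(1) by blast
  next
    fix e assume "e \<in> (\<Union>i<s. hinge_edges \<pi> (int i) \<union> (\<lambda>(v, w). {v, w}) ` half_edges \<pi> (int i))"
    then obtain i where i: "i < s"
      and e: "e \<in> hinge_edges \<pi> (int i) \<or> e \<in> (\<lambda>(v, w). {v, w}) ` half_edges \<pi> (int i)" by blast
    from e show "e \<in> window s \<pi>"
    proof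
      assume e: "e \<in> hinge_edges \<pi> (int i)"
      then show ?thesis by (rule hinge_edge_in_window[OF assms i])
    next
      assume "e \<in> (\<lambda>(v, w). {v, w}) ` half_edges \<pi> (int i)"
      then obtain v w where "e = {v, w}" "(v, w) \<in> half_edges \<pi> (int i)" by auto
      then show ?thesis using i unfolding half_edges_iff window_def by auto
    qed
  qed
  also have "\<dots> = (\<Union>(V, E, H) \<in> set (blocks s \<pi> 0). E \<union> (\<lambda>(v, w). {v, w}) ` H)"
    by (simp add: blocks_def block_at_def lessThan_atLeast0)
  finally show ?thesis .
qed

text \<open>The position can be read off the first hinge, which is non-empty; \<open>0 < s\<close>
  ensures that there is a first block.\<close>

lemma blocks_inject:
  assumes "w \<in> windows L M s" "w' \<in> windows L M s" "0 < s" "blocks s w k = blocks s w' k'"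
  shows "w = w'" "k = k'"
proof -
  obtain \<pi> where \<pi>: "\<pi> \<in> spanning L M s" "w = window s \<pi>" using assms(1) by (auto simp: windows_def)
  obtain \<pi>' where \<pi>': "\<pi>' \<in> spanning L M s" "w' = window s \<pi>'" using assms(2) by (auto simp: windows_def)
  have p: "polygon \<pi>" "polygon \<pi>'" using \<pi> \<pi>' cylinder_polygonsD(1) by (auto simp: spanning_def)
  have eq: "blocks s \<pi> k = blocks s \<pi>' k'" using assms(4) \<pi> \<pi>' p by (simp add: blocks_window)
  have "blocks s \<pi> k ! 0 = blocks s \<pi>' k' ! 0" by (simp add: eq)
  then have "shift_block k (block_at \<pi> 0) = shift_block k' (block_at \<pi>' 0)"
    using assms(3) by (simp add: blocks_def)
  then have V: "shift k ` hinge_vertices \<pi> 0 = shift k' ` hinge_vertices \<pi>' 0"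
    by (simp add: shift_block_def block_at_def)
  obtain v where "v \<in> \<Union>\<pi>" "fst v = int 0" using \<pi>(1) assms(3) unfolding spanning_def by blast
  then have "v \<in> hinge_vertices \<pi> 0" by (simp add: hinge_vertices_def)
  then have "shift k v \<in> shift k' ` hinge_vertices \<pi>' 0" using V by blast
  then show k: "k = k'" using \<open>fst v = int 0\<close>
    by (force simp: hinge_vertices_def dest: arg_cong[of _ _ fst])
  have "map (shift_block (- k)) (blocks s \<pi> k) = map (shift_block (- k)) (blocks s \<pi>' k')"
    by (simp add: eq)
  then have "blocks s \<pi> 0 = blocks s \<pi>' 0" by (simp add: map_shift_blocks k)
  then show "w = w'" using window_of_blocks p \<pi>(2) \<pi>'(2) by metis
qed

lemma card_window_verts_sum:
  assumes "\<pi> \<in> cylinder_polygons L M"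
  shows "card (window_verts s \<pi>) = (\<Sum>i<s. card (hinge_vertices \<pi> (int i)))"
proof -
  have "window_verts s \<pi> = (\<Union>i<s. hinge_vertices \<pi> (int i))"
  proof (intro equalityI subsetI)
    fix v assume "v \<in> window_verts s \<pi>"
    then show "v \<in> (\<Union>i<s. hinge_vertices \<pi> (int i))"
      by (intro UN_I[of "nat (fst v)"]) (auto simp: window_verts_def hinge_vertices_def)
  qed (auto simp: window_verts_def hinge_vertices_def)
  also have "card \<dots> = (\<Sum>i<s. card (hinge_vertices \<pi> (int i)))"
    using finite_hinge_vertices[OF cylinder_polygonsD(1)[OF assms]]
    by (intro card_UN_disjoint) (auto simp: hinge_vertices_def)
  finally show ?thesis .
qed

lemma card_hinge_le:
  assumes "\<pi> \<in> cylinder_polygons L M"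
  shows "card (hinge_vertices \<pi> k) \<le> tube_width L M"
proof -
  have "hinge_vertices \<pi> k \<subseteq> {k} \<times> grid L M"
    using cylinder_polygonsD(2)[OF assms] by (fastforce simp: hinge_vertices_def mem_Times_iff)
  then have "card (hinge_vertices \<pi> k) \<le> card ({k} \<times> grid L M)"
    using finite_grid by (intro card_mono) auto
  then show ?thesis by (simp add: card_cartesian_product card_grid)
qed

lemma full_window_iff:
  assumes "\<pi> \<in> cylinder_polygons L M"
  shows "card (window_verts s \<pi>) = tube_width L M * s \<longleftrightarrow>
    (\<forall>i<s. card (hinge_vertices \<pi> (int i)) = tube_width L M)"
proof
  assume *: "card (window_verts s \<pi>) = tube_width L M * s"
  show "\<forall>i<s. card (hinge_vertices \<pi> (int i)) = tube_width L M"
  proof (rule ccontr)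
    assume "\<not> ?thesis"
    then obtain i where i: "i < s" "card (hinge_vertices \<pi> (int i)) < tube_width L M"
      using card_hinge_le[OF assms] le_neq_implies_less by blast
    have "(\<Sum>i<s. card (hinge_vertices \<pi> (int i))) < (\<Sum>i<s. tube_width L M)"
      using i card_hinge_le[OF assms] by (intro sum_strict_mono_ex1) auto
    then show False using * by (simp add: card_window_verts_sum[OF assms] mult.commute)
  qed
qed (simp add: card_window_verts_sum[OF assms] mult.commute)

text \<open>A translation class of full block sequences corresponds to one window, its
  representative starting in the plane 0. Which translates occur depends on the tube, but every
  window has at least one that does.\<close>

lemma full_block_count_eq:
  assumes s: "0 < s"
  shows "full_block_count L M s = card (full_windows L M s)"
proof -
  let ?B = "full_s_blocks L M s" and ?F = "full_windows L M s"
  have up: "\<exists>w\<in>?F. \<exists>k. bs = blocks s w k" if bs: "bs \<in> ?B" for bs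
  proof -
    obtain \<pi> k where \<pi>: "bs = map (\<lambda>i. block_at \<pi> (k + int i)) [0..<s]" "polygon_in_tube L M \<pi>"
      "\<forall>i<s. hinge_vertices \<pi> (k + int i) \<noteq> {}" "\<forall>b\<in>set bs. block_length b = real (tube_width L M)"
      using bs unfolding full_s_blocks_def s_blocks_def by blast
    define \<rho> where "\<rho> = gmap (shift (- k)) \<pi>"
    have cyl: "\<pi> \<in> cylinder_polygons L M" using \<pi>(2) by (simp add: polygon_in_tube_iff)
    have \<rho>: "\<rho> \<in> cylinder_polygons L M" unfolding \<rho>_def by (rule cylinder_shift[OF cyl])
    have hv: "hinge_vertices \<rho> (int i) = shift (- k) ` hinge_vertices \<pi> (k + int i)" for i
      unfolding \<rho>_def hinge_vertices_def Union_gmap by auto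
    have "card (hinge_vertices \<rho> (int i)) = tube_width L M" if i: "i < s" for i
    proof -
      have "block_at \<pi> (k + int i) \<in> set bs" using i by (auto simp: \<pi>(1))
      then have "real (card (hinge_vertices \<pi> (k + int i))) = real (tube_width L M)"
        using \<pi>(4) block_length_block_at[OF cylinder_polygonsD(1)[OF cyl]] by metis
      then show ?thesis by (simp add: hv card_image[OF inj_on_subset[OF inj_shift]])
    qed
    then have "card (window_verts s \<rho>) = tube_width L M * s" using full_window_iff[OF \<rho>] by blast
    moreover have "hinge_vertices \<rho> (int i) \<noteq> {}" if "i < s" for i using \<pi>(3) that by (simp add: hv)
    then have "\<rho> \<in> spanning L M s" using \<rho> unfolding spanning_def hinge_vertices_def by blast
    ultimately have "window s \<rho> \<in> ?F" by (simp add: full_windows_def windows_def)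
    moreover have "bs = blocks s (window s \<rho>) k"
      using \<pi>(1) by (simp add: blocks_window[OF cylinder_polygonsD(1)[OF \<rho>]]) (simp add: \<rho>_def blocks_shift)
    ultimately show ?thesis by blast
  qed
  have down: "\<exists>k. blocks s w k \<in> ?B" if w: "w \<in> ?F" for w
  proof -
    obtain \<rho> where \<rho>: "\<rho> \<in> spanning L M s" "w = window s \<rho>"
      "card (window_verts s \<rho>) = tube_width L M * s" using w by (auto simp: full_windows_def windows_def)
    have cyl: "\<rho> \<in> cylinder_polygons L M" using \<rho> by (simp add: spanning_def)
    have "finite (fst ` \<Union>\<rho>)" using polygon_finite_verts[OF cylinder_polygonsD(1)[OF cyl]] by simp
    then obtain m where m: "\<And>v. v \<in> \<Union>\<rho> \<Longrightarrow> m \<le> fst v"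
      using bdd_below_finite[of "fst ` \<Union>\<rho>"] unfolding bdd_below_def by blast
    \<comment> \<open>Moving by \<open>- m\<close> brings the whole polygon behind the window to
      nonnegative x, that is into the tube.\<close>
    define \<pi> where "\<pi> = gmap (shift (- m)) \<rho>"
    have cpi: "\<pi> \<in> cylinder_polygons L M" unfolding \<pi>_def by (rule cylinder_shift[OF cyl])
    have tube: "polygon_in_tube L M \<pi>"
      using m unfolding polygon_in_tube_iff \<pi>_def Union_gmap by (auto intro: cylinder_shift[OF cyl])
    have hv: "hinge_vertices \<pi> (- m + int i) = shift (- m) ` hinge_vertices \<rho> (int i)" for i
      unfolding \<pi>_def hinge_vertices_def Union_gmap by auto
    have eq: "blocks s w (- m) = map (\<lambda>i. block_at \<pi> (- m + int i)) [0..<s]"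
      unfolding \<rho>(2) blocks_window[OF cylinder_polygonsD(1)[OF cyl]] blocks_shift[symmetric]
      by (simp add: \<pi>_def gmap_shift_shift)
    have "hinge_vertices \<pi> (- m + int i) \<noteq> {}" if i: "i < s" for i
    proof -
      obtain v where "v \<in> \<Union>\<rho>" "fst v = int i" using \<rho>(1) i unfolding spanning_def by blast
      then have "v \<in> hinge_vertices \<rho> (int i)" by (simp add: hinge_vertices_def)
      then show ?thesis unfolding hv by blast
    qed
    then have 1: "blocks s w (- m) \<in> s_blocks L M s" using eq tube unfolding s_blocks_def by blast
    have "block_length b = real (tube_width L M)" if "b \<in> set (blocks s w (- m))" for b
    proof -
      obtain i where i: "i < s" "b = block_at \<pi> (- m + int i)" using \<open>b \<in> _\<close> unfolding eq by auto
      have "card (hinge_vertices \<rho> (int i)) = tube_width L M"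
        using full_window_iff[OF cyl] \<rho>(3) i by blast
      then show ?thesis
        unfolding i(2) block_length_block_at[OF cylinder_polygonsD(1)[OF cpi]] hv
        by (simp add: card_image[OF inj_on_subset[OF inj_shift]])
    qed
    then show ?thesis using 1 unfolding full_s_blocks_def by blast
  qed
  \<comment> \<open>All placements of \<open>w\<close> that occur in the tube. These sets will turn
    out to be the translation classes.\<close>
  define \<Phi> where "\<Phi> = (\<lambda>w. {bs\<in>?B. \<exists>k. bs = blocks s w k})"
  have FW: "w \<in> windows L M s" if "w \<in> ?F" for w using that by (simp add: full_windows_def)
  have "inj_on \<Phi> ?F"
  proof (rule inj_onI)
    fix w w' assume w: "w \<in> ?F" "w' \<in> ?F" "\<Phi> w = \<Phi> w'"
    obtain k where "blocks s w k \<in> ?B" using down[OF w(1)] by blast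
    then have "blocks s w k \<in> \<Phi> w'" unfolding w(3)[symmetric] by (auto simp: \<Phi>_def)
    then obtain k' where "blocks s w k = blocks s w' k'" by (auto simp: \<Phi>_def)
    then show "w = w'" using blocks_inject(1)[OF FW[OF w(1)] FW[OF w(2)] s] by blast
  qed
  moreover have "\<Phi> ` ?F = ?B // translates ?B"
  proof -
    have cls: "translates ?B `` {blocks s w k} = \<Phi> w" if "blocks s w k \<in> ?B" "w \<in> ?F" for w k
    proof -
      have "(\<exists>t. cs = map (shift_block t) (blocks s w k)) \<longleftrightarrow> (\<exists>k. cs = blocks s w k)" for cs
        unfolding map_shift_blocks by (metis add.commute diff_add_cancel)
      then show ?thesis using that unfolding translates_def \<Phi>_def by auto
    qed
    show ?thesis
    proof (intro equalityI subsetI)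
      fix x assume "x \<in> \<Phi> ` ?F"
      then obtain w k where w: "w \<in> ?F" "x = \<Phi> w" "blocks s w k \<in> ?B" using down by blast
      then show "x \<in> ?B // translates ?B" using cls by (metis quotientI)
    next
      fix x assume "x \<in> ?B // translates ?B"
      then obtain bs where bs: "bs \<in> ?B" "x = translates ?B `` {bs}" by (rule quotientE)
      then show "x \<in> \<Phi> ` ?F" using up cls by blast
    qed
  qed
  ultimately show ?thesis unfolding full_block_count_def by (metis card_image)
qed

lemma cross_eq_iff: "g \<noteq> {} \<Longrightarrow> cross k g = cross k' g' \<longleftrightarrow> k = k' \<and> g = g'"
proof
  assume "g \<noteq> {}" and *: "cross k g = cross k' g'"
  then obtain p where "p \<in> g" by blast
  then have "(k, p) \<in> cross k' g'" unfolding *[symmetric] by simp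
  then show "k = k' \<and> g = g'" using * by simp
qed simp

section \<open>Growth of the number of full blocks\<close>

text \<open>A Hamiltonian path of the cross-section: rows of \<open>M + 1\<close> points are
  traversed in alternating directions.\<close>

definition snake :: "nat \<Rightarrow> nat \<Rightarrow> int \<times> int" where
  "snake M i = (int (i div (M + 1)),
     if even (i div (M + 1)) then int (i mod (M + 1)) else int M - int (i mod (M + 1)))"

lemma adjacent_snake: "adjacent (k, snake M i) (k, snake M (Suc i))"
proof (cases "Suc (i mod (M + 1)) = M + 1")
  case True
  then have "Suc i div (M + 1) = Suc (i div (M + 1))" "Suc i mod (M + 1) = 0"
    by (simp_all add: div_Suc mod_Suc)
  then show ?thesis using True by (simp add: adjacent_iff snake_def)
next
  case False
  then have "Suc i div (M + 1) = i div (M + 1)" "Suc i mod (M + 1) = Suc (i mod (M + 1))"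
    by (simp_all add: div_Suc mod_Suc)
  then show ?thesis by (simp add: adjacent_iff snake_def)
qed

lemma inj_snake: "inj (snake M)"
proof (rule injI)
  fix i j assume eq: "snake M i = snake M j"
  then have d: "i div (M + 1) = j div (M + 1)" by (simp add: snake_def)
  then have "i mod (M + 1) = j mod (M + 1)" using eq by (simp add: snake_def split: if_splits)
  then show "i = j" using d by (metis div_mult_mod_eq)
qed

lemma snake_image: "snake M ` {..<tube_width L M} = grid L M"
proof (rule card_subset_eq[OF finite_grid])
  show "snake M ` {..<tube_width L M} \<subseteq> grid L M"
  proof (rule image_subsetI)
    fix i assume "i \<in> {..<tube_width L M}"
    then have "i div (M + 1) < L + 1" by (intro less_mult_imp_div_less) (simp add: tube_width_def)
    moreover have "i mod (M + 1) \<le> M" by (simp add: less_Suc_eq_le[symmetric])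
    ultimately show "snake M i \<in> grid L M" by (auto simp: snake_def grid_def)
  qed
  show "card (snake M ` {..<tube_width L M}) = card (grid L M)"
    by (simp add: card_image[OF inj_on_subset[OF inj_snake]] card_grid)
qed

lemma tube_width_ge_2: "1 \<le> L \<Longrightarrow> 2 \<le> tube_width L M"
  by (cases L) (auto simp: tube_width_def)

text \<open>Two copies of the Hamiltonian path in adjacent planes, closed up by rungs at both ends,
  occupy both planes completely. The first edge of the path is present in each plane and serves for
  joining; it exists because \<open>1 \<le> L\<close> gives a cross-section of at least two
  points.\<close>

lemma ex_full_ladder:
  assumes "1 \<le> L"
  obtains \<pi> where "\<pi> \<in> cylinder_polygons L M" "\<Union>\<pi> = {0, 1} \<times> grid L M"
    "cross 0 {snake M 0, snake M 1} \<in> \<pi>" "cross 1 {snake M 0, snake M 1} \<in> \<pi>"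
proof -
  define m where "m = tube_width L M"
  define P where "P = (\<lambda>i. (0::int, snake M i))"
  define Q where "Q = (\<lambda>i. (1::int, snake M i))"
  have m: "2 \<le> m" using tube_width_ge_2[OF assms] by (simp add: m_def)
  have inj: "inj_on P {..<m}" "inj_on Q {..<m}"
    using inj_snake[of M] by (auto simp: P_def Q_def inj_on_def)
  have disj: "P i \<noteq> Q j" for i j by (simp add: P_def Q_def)
  have adj: "adjacent (P i) (P (Suc i))" "adjacent (Q i) (Q (Suc i))" "adjacent (P i) (Q i)" for i
    by (simp_all add: P_def Q_def adjacent_snake) (simp add: adjacent_iff)
  note L = m inj disj adj(1,2,3,3)
  have "\<Union>(ladder m P Q) = P ` {..<m} \<union> Q ` {..<m}" by (rule Union_ladder[where m = m and P = P and Q = Q, OF L])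
  also have "P ` {..<m} = {0} \<times> grid L M"
  proof -
    have "P ` {..<m} = Pair 0 ` snake M ` {..<m}" by (simp add: P_def image_image)
    also have "\<dots> = {0} \<times> grid L M" unfolding m_def snake_image by (rule set_eqI) auto
    finally show ?thesis .
  qed
  also have "Q ` {..<m} = {1} \<times> grid L M"
  proof -
    have "Q ` {..<m} = Pair 1 ` snake M ` {..<m}" by (simp add: Q_def image_image)
    also have "\<dots> = {1} \<times> grid L M" unfolding m_def snake_image by (rule set_eqI) auto
    finally show ?thesis .
  qed
  also have "{0} \<times> grid L M \<union> {1} \<times> grid L M = {0, 1} \<times> grid L M"
    by (rule set_eqI) (auto simp: mem_Times_iff)
  finally have U: "\<Union>(ladder m P Q) = {0, 1} \<times> grid L M" .
  have "polygon (ladder m P Q)" by (rule polygon_ladder[where m = m and P = P and Q = Q, OF L])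
  moreover have "snd ` ({0::int, 1} \<times> grid L M) \<subseteq> grid L M" by auto
  ultimately have "ladder m P Q \<in> cylinder_polygons L M"
    unfolding cylinder_polygons_def by (simp only: mem_Collect_eq U simp_thms)
  moreover have "cross 0 {snake M 0, snake M 1} = {P 0, P 1}" "cross 1 {snake M 0, snake M 1} = {Q 0, Q 1}"
    by (simp_all add: cross_def P_def Q_def)
  ultimately show ?thesis using that[OF _ U] ladder_edges(1,2)[where m = m and P = P and Q = Q, OF L] by simp
qed

lemma cylinder_join:
  assumes "\<pi> \<in> cylinder_polygons L M" "\<rho> \<in> cylinder_polygons L M"
    and "\<And>v. v \<in> \<Union>\<pi> \<Longrightarrow> fst v \<le> k" "\<And>v. v \<in> \<Union>\<rho> \<Longrightarrow> k + 1 \<le> fst v"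
    and "cross k g \<in> \<pi>" "cross (k + 1) g \<in> \<rho>"
  shows "join k g \<pi> \<rho> \<in> cylinder_polygons L M"
proof -
  note p = cylinder_polygonsD(1)[OF assms(1)] cylinder_polygonsD(1)[OF assms(2)]
  have "polygon (join k g \<pi> \<rho>)" "\<Union>(join k g \<pi> \<rho>) = \<Union>\<pi> \<union> \<Union>\<rho>"
    by (rule polygon_join[OF p assms(3-)] Union_join[OF p assms(3-)]; assumption)+
  then show ?thesis using assms(1,2) unfolding cylinder_polygons_def by (simp add: image_Un)
qed

text \<open>Ladders are joined in a row. The two joining edges of a ladder lie in different planes,
  so opening the left one keeps the right one for the next step.\<close>

lemma ex_full_polygon:
  assumes "1 \<le> L"
  shows "\<exists>\<pi>\<in>cylinder_polygons L M. \<Union>\<pi> = {0..2 * int j + 1} \<times> grid L M \<and>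
    cross (2 * int j + 1) {snake M 0, snake M 1} \<in> \<pi>"
proof (induction j)
  case 0
  have "{0..1::int} = {0, 1}" by auto
  moreover have "2 * int 0 + 1 = 1" by simp
  moreover obtain \<sigma> where "\<sigma> \<in> cylinder_polygons L M" "\<Union>\<sigma> = {0, 1} \<times> grid L M"
    "cross 1 {snake M 0, snake M 1} \<in> \<sigma>" by (rule ex_full_ladder[OF assms, of M])
  ultimately show ?case by (intro bexI[of _ \<sigma>]) simp_all
next
  case (Suc j)
  define g where "g = {snake M 0, snake M 1}"
  define k where "k = 2 * int j + 1"
  obtain \<pi> where \<pi>: "\<pi> \<in> cylinder_polygons L M" "\<Union>\<pi> = {0..k} \<times> grid L M" "cross k g \<in> \<pi>"
    using Suc unfolding g_def k_def by blast
  obtain \<sigma> where \<sigma>: "\<sigma> \<in> cylinder_polygons L M" "\<Union>\<sigma> = {0, 1} \<times> grid L M" "cross 0 g \<in> \<sigma>" "cross 1 g \<in> \<sigma>"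
    using ex_full_ladder[OF assms] unfolding g_def by metis
  define \<rho> where "\<rho> = gmap (shift (k + 1)) \<sigma>"
  have \<rho>: "\<rho> \<in> cylinder_polygons L M" unfolding \<rho>_def by (rule cylinder_shift[OF \<sigma>(1)])
  have U\<rho>: "\<Union>\<rho> = {k + 1, k + 2} \<times> grid L M"
    unfolding \<rho>_def Union_gmap \<sigma>(2) by (force simp: shift_eq)
  have c: "shift (k + 1) ` cross 0 g \<in> \<rho>" "shift (k + 1) ` cross 1 g \<in> \<rho>"
    unfolding \<rho>_def gmap_def using \<sigma>(3,4) by blast+
  then have c: "cross (k + 1) g \<in> \<rho>" "cross (k + 2) g \<in> \<rho>" by (simp_all add: shift_cross add.commute)
  have le: "fst v \<le> k" if "v \<in> \<Union>\<pi>" for v using that unfolding \<pi>(2) by auto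
  have ge: "k + 1 \<le> fst v" if "v \<in> \<Union>\<rho>" for v using that unfolding U\<rho> by auto
  note p = cylinder_polygonsD(1)[OF \<pi>(1)] cylinder_polygonsD(1)[OF \<rho>]
  have "join k g \<pi> \<rho> \<in> cylinder_polygons L M" by (rule cylinder_join[OF \<pi>(1) \<rho> le ge \<pi>(3) c(1)])
  moreover have "\<Union>(join k g \<pi> \<rho>) = {0..k + 2} \<times> grid L M"
  proof -
    have "\<Union>(join k g \<pi> \<rho>) = \<Union>\<pi> \<union> \<Union>\<rho>"
      by (rule Union_join[OF p le ge \<pi>(3) c(1)]; assumption)
    also have "\<dots> = ({0..k} \<union> {k + 1, k + 2}) \<times> grid L M"
      unfolding \<pi>(2) U\<rho> by (rule Sigma_Un_distrib1[symmetric])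
    also have "{0..k} \<union> {k + 1, k + 2} = {0..k + 2}"
      unfolding set_eq_iff by (simp add: k_def) presburger
    finally show ?thesis .
  qed
  moreover have "cross (k + 2) g \<in> join k g \<pi> \<rho>"
    using c(2) by (simp add: join_def cross_eq_iff g_def)
  moreover have kk: "2 * int (Suc j) + 1 = k + 2" by (simp add: k_def)
  ultimately show ?case unfolding kk g_def[symmetric] by (intro bexI conjI)
qed

text \<open>With positive counts the logarithms are nonnegative, which is the lower bound that
  Fekete's lemma asks for.\<close>

lemma full_windows_nonempty:
  assumes "1 \<le> L"
  shows "full_windows L M s \<noteq> {}"
proof -
  obtain \<pi> where \<pi>: "\<pi> \<in> cylinder_polygons L M" "\<Union>\<pi> = {0..2 * int s + 1} \<times> grid L M"
    using ex_full_polygon[OF assms] by blast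
  have "(0, 0) \<in> grid L M" by (simp add: grid_def)
  then have pt: "(int i, 0, 0) \<in> \<Union>\<pi>" if "i < s" for i using that unfolding \<pi>(2) by simp
  have "\<exists>v\<in>\<Union>\<pi>. fst v = int i" if "i < s" for i by (rule bexI[OF _ pt[OF that]]) simp
  then have "\<pi> \<in> spanning L M s" using \<pi>(1) by (simp only: spanning_def mem_Collect_eq) blast
  moreover have "window_verts s \<pi> = {0..<int s} \<times> grid L M"
    unfolding window_verts_def \<pi>(2) by auto
  then have "card (window_verts s \<pi>) = tube_width L M * s"
    by (simp add: card_cartesian_product card_grid mult.commute)
  ultimately have "window s \<pi> \<in> full_windows L M s" by (simp add: full_windows_def windows_def)
  then show ?thesis by blast
qed

text \<open>Fekete's lemma for sequences that are subadditive only from \<open>n0\<close> on. The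
  threshold accommodates the pinned sums, whose positivity comes from rectangles of half-length at
  least 2.\<close>

lemma fekete:
  fixes u :: "nat \<Rightarrow> real"
  assumes sub: "\<And>m n. n0 \<le> m \<Longrightarrow> n0 \<le> n \<Longrightarrow> u (m + n) \<le> u m + u n"
    and "0 < n0" and bdd: "\<And>n. n0 \<le> n \<Longrightarrow> c \<le> u n / real n"
  obtains l where "(\<lambda>n. u n / real n) \<longlonglongrightarrow> l" "\<And>n. n0 \<le> n \<Longrightarrow> l \<le> u n / real n"
proof -
  define l where "l = (INF n\<in>{n0..}. u n / real n)"
  have bb: "bdd_below ((\<lambda>n. u n / real n) ` {n0..})" using bdd by (intro bdd_belowI2) auto
  have lower: "l \<le> u n / real n" if "n0 \<le> n" for n
    unfolding l_def using that by (intro cINF_lower[OF bb]) auto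
  have "(\<lambda>n. u n / real n) \<longlonglongrightarrow> l"
  proof (rule LIMSEQ_I)
    fix e :: real assume e: "0 < e"
    have "\<exists>m\<in>{n0..}. u m / real m < l + e / 2"
      using e bb by (intro cINF_less_iff[THEN iffD1]) (auto simp: l_def)
    then obtain m where m: "n0 \<le> m" "u m / real m < l + e / 2" by auto
    have m0: "0 < m" using m(1) assms(2) by simp
    define C where "C = (\<Sum>r\<in>{m..<2 * m}. \<bar>u r\<bar>)"
    define a where "a = u m / real m"
    \<comment> \<open>Absorbs the value at the remainder \<open>r\<close> and the error of replacing
      \<open>n - r\<close> by \<open>n\<close>.\<close>
    define K where "K = C + 2 * real m * \<bar>a\<bar>"
    have step: "u (q * m + r) \<le> real q * u m + u r" if "m \<le> r" for q r
    proof (induction q)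
      case (Suc q)
      have "u (m + (q * m + r)) \<le> u m + u (q * m + r)" using m(1) that by (intro sub) auto
      then show ?case using Suc by (simp add: algebra_simps)
    qed simp
    have bound: "u n / real n \<le> a + K / real n" if n: "2 * m \<le> n" for n
    proof -
      \<comment> \<open>The remainder is taken between \<open>m\<close> and \<open>2 * m - 1\<close>
        instead of below \<open>m\<close>, so that subadditivity is used only at indices from
        \<open>n0\<close> on.\<close>
      define r where "r = n mod m + m"
      define q where "q = n div m - 1"
      have "1 \<le> n div m" using n m0 by (simp add: Suc_le_eq div_greater_zero_iff)
      then have nq: "n = q * m + r" unfolding q_def r_def
        by (simp add: diff_mult_distrib)
      have r: "m \<le> r" "r < 2 * m" using m0 by (auto simp: r_def)
      have "\<bar>u r\<bar> \<le> C" unfolding C_def using r by (intro member_le_sum) auto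
      then have "u n \<le> real q * u m + C" using step[OF r(1), of q] nq by simp
      also have "real q * u m = (real n - real r) * a"
        using nq m0 by (simp add: a_def field_simps)
      also have "\<dots> \<le> real n * a + 2 * real m * \<bar>a\<bar>"
      proof -
        have "- (real r * a) \<le> real r * \<bar>a\<bar>" using abs_ge_minus_self[of "real r * a"] by (simp add: abs_mult)
        also have "\<dots> \<le> 2 * real m * \<bar>a\<bar>" using r by (intro mult_right_mono) auto
        finally show ?thesis by (simp add: algebra_simps)
      qed
      finally have "u n \<le> real n * a + K" by (simp add: K_def)
      moreover have "0 < real n" using n m0 by simp
      ultimately show ?thesis by (simp add: field_simps)
    qed
    obtain N :: nat where N: "2 * K / e < real N" using reals_Archimedean2 by blast
    show "\<exists>no. \<forall>n\<ge>no. norm (u n / real n - l) < e"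
    proof (intro exI allI impI)
      fix n assume n: "max N (2 * m) \<le> n"
      have n0: "0 < real n" using n m0 by simp
      have "2 * K / e < real n" using N n by simp
      then have "K < e / 2 * real n" using e by (simp add: field_simps)
      then have "K / real n < e / 2" using n0 by (simp only: pos_divide_less_eq)
      moreover have "u n / real n \<le> a + K / real n" using bound n by simp
      moreover have "a < l + e / 2" using m(2) by (simp add: a_def)
      moreover have "l \<le> u n / real n" using lower[of n] m(1) n by simp
      ultimately show "norm (u n / real n - l) < e" unfolding real_norm_def by linarith
    qed
  qed
  then show ?thesis using lower that by blast
qed

text \<open>The limit in Fekete's lemma is an infimum, so the growth rate bounds every single count
  from below without an error term. The lower bound for the free energy relies on this.\<close>

lemma full_block_growth_limit:
  assumes "1 \<le> L"
  shows "(\<lambda>s. ln (real (full_block_count L M s)) / real s) \<longlonglongrightarrow> full_block_growth L M"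
    and "exp (full_block_growth L M * real s) \<le> real (card (full_windows L M s))"
proof -
  define b where "b = (\<lambda>s. real (card (full_windows L M s)))"
  have b1: "1 \<le> b s" for s
    using full_windows_nonempty[OF assms, of M s] finite_full_windows[of L M s]
    by (simp add: b_def Suc_le_eq card_gt_0_iff)
  have b_add: "b (m + n) \<le> b m * b n" for m n
    unfolding b_def of_nat_mult[symmetric] of_nat_le_iff by (rule card_full_windows_add)
  obtain l where l: "(\<lambda>n. ln (b n) / real n) \<longlonglongrightarrow> l" "\<And>n. 1 \<le> n \<Longrightarrow> l \<le> ln (b n) / real n"
  proof (rule fekete[of 1 "\<lambda>n. ln (b n)" 0])
    fix m n
    have "ln (b (m + n)) \<le> ln (b m * b n)"
      using b_add b1 by (intro ln_mono) (auto intro: less_le_trans[OF zero_less_one])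
    then show "ln (b (m + n)) \<le> ln (b m) + ln (b n)"
      using b1[of m] b1[of n] by (simp add: ln_mult_pos)
    show "0 \<le> ln (b n) / real n" using b1[of n] by simp
  qed auto
  have ev: "\<forall>\<^sub>F s in sequentially. ln (b s) / real s = ln (real (full_block_count L M s)) / real s"
    using eventually_gt_at_top[of 0] by eventually_elim (simp add: b_def full_block_count_eq)
  have lim: "(\<lambda>s. ln (real (full_block_count L M s)) / real s) \<longlonglongrightarrow> l"
    by (rule Lim_transform_eventually[OF l(1) ev])
  then have growth: "full_block_growth L M = l" unfolding full_block_growth_def by (rule limI)
  show "(\<lambda>s. ln (real (full_block_count L M s)) / real s) \<longlonglongrightarrow> full_block_growth L M"
    using lim by (simp add: growth)
  show "exp (full_block_growth L M * real s) \<le> real (card (full_windows L M s))"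
  proof (cases "s = 0")
    case True
    then show ?thesis using b1[of 0] by (simp add: b_def)
  next
    case False
    then have "l * real s \<le> ln (b s)" using l(2)[of s] by (simp add: field_simps)
    then have "exp (l * real s) \<le> exp (ln (b s))" by simp
    also have "\<dots> = b s" using b1[of s] by (intro exp_ln) simp
    finally show ?thesis by (simp add: growth b_def)
  qed
qed

section \<open>The partition function\<close>

definition polygons :: "nat \<Rightarrow> nat \<Rightarrow> nat \<Rightarrow> vertex set set set" where
  "polygons L M n = {\<pi> \<in> tube_polygons L M. card \<pi> = n}"

lemma tube_polygons_iff:
  "\<pi> \<in> tube_polygons L M \<longleftrightarrow>
     \<pi> \<in> cylinder_polygons L M \<and> (\<forall>v\<in>\<Union>\<pi>. 0 \<le> fst v) \<and> (\<exists>v\<in>\<Union>\<pi>. fst v = 0)"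
  unfolding tube_polygons_def polygon_in_tube_iff by blast

lemma polygon_span_ge:
  assumes "polygon \<pi>" "v \<in> \<Union>\<pi>"
  shows "fst v \<le> polygon_span \<pi>"
  unfolding polygon_span_def using assms(2) polygon_finite_verts[OF assms(1)] by (intro Max_ge) auto

lemma polygon_span_attained:
  assumes "polygon \<pi>"
  obtains v where "v \<in> \<Union>\<pi>" "fst v = polygon_span \<pi>"
proof -
  have "polygon_span \<pi> \<in> fst ` \<Union>\<pi>"
    unfolding polygon_span_def
    using polygon_finite_verts[OF assms] polygon_verts_nonempty[OF assms] by (intro Max_in) auto
  then obtain v where "polygon_span \<pi> = fst v" "v \<in> \<Union>\<pi>" by (rule imageE)
  then show ?thesis using that by simp
qed

lemma polygon_span_eqI:
  assumes "polygon \<pi>" "\<And>v. v \<in> \<Union>\<pi> \<Longrightarrow> fst v \<le> k" "v \<in> \<Union>\<pi>" "fst v = k"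
  shows "polygon_span \<pi> = k"
proof (rule antisym)
  obtain w where "w \<in> \<Union>\<pi>" "fst w = polygon_span \<pi>" by (rule polygon_span_attained[OF assms(1)])
  then show "polygon_span \<pi> \<le> k" using assms(2)[of w] by simp
  show "k \<le> polygon_span \<pi>" using polygon_span_ge[OF assms(1,3)] assms(4) by simp
qed

context
  fixes L M n :: nat and \<pi> :: "vertex set set"
  assumes \<pi>: "\<pi> \<in> polygons L M n"
begin

lemma polygonsD:
  shows "\<pi> \<in> cylinder_polygons L M" "polygon \<pi>" "v \<in> \<Union>\<pi> \<Longrightarrow> 0 \<le> fst v" "\<exists>v\<in>\<Union>\<pi>. fst v = 0"
    "card \<pi> = n"
  using \<pi> cylinder_polygonsD(1)[of \<pi> L M] unfolding polygons_def tube_polygons_iff by blast+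

lemma polygon_span_nonneg: "0 \<le> polygon_span \<pi>"
  using polygonsD(4) polygon_span_ge[OF polygonsD(2)] by force

lemma polygons_hit: "0 \<le> k \<Longrightarrow> k \<le> polygon_span \<pi> \<Longrightarrow> \<exists>v\<in>\<Union>\<pi>. fst v = k"
proof -
  assume k: "0 \<le> k" "k \<le> polygon_span \<pi>"
  obtain a where "a \<in> \<Union>\<pi>" "fst a = 0" using polygonsD(4) by blast
  moreover obtain b where "b \<in> \<Union>\<pi>" "fst b = polygon_span \<pi>" by (rule polygon_span_attained[OF polygonsD(2)])
  ultimately show ?thesis using k by (intro polygon_hits_plane[OF polygonsD(2), of a b]) auto
qed

text \<open>Every plane from 0 to the span is met, and each takes a vertex of its own.\<close>

lemma polygon_span_less: "polygon_span \<pi> < int n"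
proof -
  have fin: "finite (\<Union>\<pi>)" by (rule polygon_finite_verts[OF polygonsD(2)])
  have "{0..polygon_span \<pi>} \<subseteq> fst ` \<Union>\<pi>"
  proof
    fix k assume "k \<in> {0..polygon_span \<pi>}"
    then obtain v where "v \<in> \<Union>\<pi>" "fst v = k" using polygons_hit[of k] unfolding atLeastAtMost_iff by blast
    then show "k \<in> fst ` \<Union>\<pi>" by blast
  qed
  then have "card {0..polygon_span \<pi>} \<le> card (fst ` \<Union>\<pi>)" using fin by (intro card_mono) auto
  also have "\<dots> \<le> card (\<Union>\<pi>)" by (rule card_image_le[OF fin])
  also have "\<dots> = n" using polygon_card_verts[OF polygonsD(2)] polygonsD(5) by simp
  finally show ?thesis using polygon_span_nonneg by simp
qed

text \<open>A polygon of span \<open>s\<close> lies within \<open>s + 1\<close> planes and meets all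
  of them, so it is its own window.\<close>

lemma polygons_window:
  assumes "polygon_span \<pi> = int s"
  shows "\<pi> \<in> windows L M (Suc s)" "card (window_verts (Suc s) \<pi>) = n"
proof -
  have in_range: "0 \<le> fst v \<and> fst v < int (Suc s)" if "v \<in> \<Union>\<pi>" for v
    using polygonsD(3)[OF that] polygon_span_ge[OF polygonsD(2) that] assms by simp
  have "\<exists>v\<in>e. 0 \<le> fst v \<and> fst v < int (Suc s)" if e: "e \<in> \<pi>" for e
  proof -
    obtain u v where "e = {u, v}" using polygonsD(2) polygonD(3)[OF _ e] by blast
    then have "u \<in> e" "u \<in> \<Union>\<pi>" using e by auto
    then show ?thesis using in_range by blast
  qed
  then have "window (Suc s) \<pi> = \<pi>" unfolding window_def by blast
  moreover have "\<pi> \<in> spanning L M (Suc s)"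
    unfolding spanning_def using polygonsD(1) polygons_hit assms by simp
  ultimately show "\<pi> \<in> windows L M (Suc s)" unfolding windows_def by (metis image_eqI)
  have "window_verts (Suc s) \<pi> = \<Union>\<pi>" unfolding window_verts_def using in_range by blast
  then show "card (window_verts (Suc s) \<pi>) = n"
    using polygon_card_verts[OF polygonsD(2)] polygonsD(5) by simp
qed

end

lemma finite_polygons: "finite (polygons L M n)"
proof (rule finite_subset)
  show "polygons L M n \<subseteq> (\<Union>s<n. windows L M (Suc s))"
  proof
    fix \<pi> assume \<pi>: "\<pi> \<in> polygons L M n"
    define s where "s = nat (polygon_span \<pi>)"
    have "polygon_span \<pi> = int s" "s < n"
      using polygon_span_nonneg[OF \<pi>] polygon_span_less[OF \<pi>] by (auto simp: s_def)
    then show "\<pi> \<in> (\<Union>s<n. windows L M (Suc s))" using polygons_window(1)[OF \<pi>] by blast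
  qed
qed (simp add: finite_windows)

lemma polygon_count_eq:
  "polygon_count L M n s = card {\<pi> \<in> polygons L M n. polygon_span \<pi> = int s}"
  unfolding polygon_count_def polygons_def by (rule arg_cong[of _ _ card]) blast

lemma partition_function_sum:
  "partition_function L M n f = (\<Sum>s<n. real (polygon_count L M n s) * exp (f * real s))"
proof -
  have "polygon_count L M n s = 0" if "\<not> s < n" for s
  proof -
    have "{\<pi> \<in> polygons L M n. polygon_span \<pi> = int s} = {}" using polygon_span_less that by force
    then show ?thesis unfolding polygon_count_eq by (metis card.empty)
  qed
  then show ?thesis unfolding partition_function_def by (intro suminf_finite) auto
qed

lemma partition_function_eq:
  "partition_function L M n f = (\<Sum>\<pi>\<in>polygons L M n. exp (f * real_of_int (polygon_span \<pi>)))"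
proof -
  let ?s = "\<lambda>\<pi>. nat (polygon_span \<pi>)"
  have "(\<Sum>\<pi>\<in>polygons L M n. exp (f * real_of_int (polygon_span \<pi>))) =
      (\<Sum>s<n. \<Sum>\<pi>\<in>{\<pi> \<in> polygons L M n. ?s \<pi> = s}. exp (f * real_of_int (polygon_span \<pi>)))"
    using polygon_span_nonneg polygon_span_less
    by (intro sum.group[symmetric] finite_polygons) force+
  also have "\<dots> = (\<Sum>s<n. real (polygon_count L M n s) * exp (f * real s))"
  proof (rule sum.cong[OF refl])
    fix s
    have "{\<pi> \<in> polygons L M n. ?s \<pi> = s} = {\<pi> \<in> polygons L M n. polygon_span \<pi> = int s}"
      using polygon_span_nonneg by force
    then show "(\<Sum>\<pi>\<in>{\<pi> \<in> polygons L M n. ?s \<pi> = s}. exp (f * real_of_int (polygon_span \<pi>))) =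
        real (polygon_count L M n s) * exp (f * real s)"
      by (simp add: polygon_count_eq)
  qed
  finally show ?thesis by (simp add: partition_function_sum)
qed

lemma polygon_count_window_sum:
  assumes "0 \<le> z"
  shows "real (polygon_count L M n s) * z ^ n \<le> window_sum L M z (Suc s)"
proof -
  let ?P = "{\<pi> \<in> polygons L M n. polygon_span \<pi> = int s}"
  have "real (polygon_count L M n s) * z ^ n = (\<Sum>\<pi>\<in>?P. z ^ card (window_verts (Suc s) \<pi>))"
  proof -
    have "(\<Sum>\<pi>\<in>?P. z ^ card (window_verts (Suc s) \<pi>)) = (\<Sum>\<pi>\<in>?P. z ^ n)"
    proof (rule sum.cong[OF refl])
      fix \<pi> assume "\<pi> \<in> ?P"
      then have "card (window_verts (Suc s) \<pi>) = n" using polygons_window(2)[of \<pi> L M n s] by simp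
      then show "z ^ card (window_verts (Suc s) \<pi>) = z ^ n" by simp
    qed
    then show ?thesis by (simp add: polygon_count_eq)
  qed
  also have "\<dots> \<le> window_sum L M z (Suc s)"
    unfolding window_sum_def
  proof (rule sum_mono2[OF finite_windows])
    show "?P \<subseteq> windows L M (Suc s)" using polygons_window(1) by blast
  qed (simp add: assms)
  finally show ?thesis .
qed

text \<open>As \<open>h t \<le> 1\<close>, removing a multiple of \<open>t\<close> from the index
  does not decrease the value, so only the finitely many indices below \<open>t\<close>
  matter.\<close>

lemma submultiplicative_bounded:
  fixes h :: "nat \<Rightarrow> real"
  assumes add: "\<And>s t. h (s + t) \<le> h s * h t" and nn: "\<And>s. 0 \<le> h s" and "0 < t" "h t \<le> 1"
  shows "h s \<le> (\<Sum>r<t. h r)"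
proof -
  have *: "h (q * t + r) \<le> h r" for q r
  proof (induction q)
    case (Suc q)
    have "h (t + (q * t + r)) \<le> h t * h (q * t + r)" by (rule add)
    also have "\<dots> \<le> 1 * h (q * t + r)" using assms(4) nn by (rule mult_right_mono)
    finally show ?case using Suc by (simp add: add.assoc)
  qed simp
  have "h s \<le> h (s mod t)" using *[of "s div t" "s mod t"] by simp
  also have "\<dots> \<le> (\<Sum>r<t. h r)" using assms(3) nn by (intro member_le_sum) auto
  finally show ?thesis .
qed

text \<open>Each span contributes a bounded amount once multiplied by \<open>z ^ n\<close>, and
  fewer than \<open>n + 1\<close> spans are possible; this is the origin of the linear
  factor.\<close>

lemma partition_function_bound:
  assumes z: "0 < z" and t: "0 < t" and small: "exp (f * real t) * window_sum L M z t \<le> 1"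
  obtains C where "0 < C" "\<And>n. partition_function L M n f \<le> C * real n * (1 / z) ^ n"
proof -
  define h where "h = (\<lambda>s. exp (f * real s) * window_sum L M z s)"
  \<comment> \<open>The factor \<open>exp (- f)\<close> makes up for the fact that span
    \<open>s\<close> belongs to windows of \<open>s + 1\<close> planes; the summand 1 makes
    \<open>C\<close> positive.\<close>
  define C where "C = exp (- f) * (\<Sum>r<t. h r) + 1"
  have nn: "0 \<le> h s" for s using z by (simp add: h_def window_sum_nonneg)
  have add: "h (s + s') \<le> h s * h s'" for s s'
  proof -
    have "h (s + s') \<le> exp (f * real (s + s')) * (window_sum L M z s * window_sum L M z s')"
      unfolding h_def using z by (intro mult_left_mono window_sum_add) auto
    then show ?thesis by (simp add: h_def distrib_left exp_add)
  qed
  have hb: "h s \<le> (\<Sum>r<t. h r)" for s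
    by (rule submultiplicative_bounded[OF add nn t]) (use small in \<open>simp add: h_def\<close>)
  have "partition_function L M n f \<le> C * real n * (1 / z) ^ n" for n
  proof -
    have "partition_function L M n f * z ^ n =
        (\<Sum>s<n. exp (f * real s) * (real (polygon_count L M n s) * z ^ n))"
      unfolding partition_function_sum sum_distrib_right by (intro sum.cong refl) simp
    also have "\<dots> \<le> (\<Sum>s<n. C)"
    proof (rule sum_mono)
      fix s
      have "exp (f * real s) * (real (polygon_count L M n s) * z ^ n) \<le>
          exp (f * real s) * window_sum L M z (Suc s)"
        using z by (intro mult_left_mono polygon_count_window_sum) auto
      also have "\<dots> = exp (- f) * h (Suc s)"
        by (simp add: h_def mult.assoc[symmetric] exp_add[symmetric] algebra_simps)
      also have "\<dots> \<le> exp (- f) * (\<Sum>r<t. h r)" using hb by (intro mult_left_mono) auto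
      finally show "exp (f * real s) * (real (polygon_count L M n s) * z ^ n) \<le> C"
        by (simp add: C_def)
    qed
    finally have "partition_function L M n f * z ^ n \<le> C * real n" by (simp add: mult.commute)
    then have "partition_function L M n f \<le> C * real n / z ^ n"
      using z by (simp add: pos_le_divide_eq)
    then show ?thesis by (simp add: power_one_over)
  qed
  moreover have "0 < C" using nn by (simp add: C_def sum_nonneg add_nonneg_pos)
  ultimately show ?thesis using that by blast
qed

section \<open>Existence of the free energy\<close>

definition grid_edges :: "nat \<Rightarrow> nat \<Rightarrow> (int \<times> int) set set" where
  "grid_edges L M = {{p, q} | p q. p \<in> grid L M \<and> q \<in> grid L M \<and> adjacent (0, p) (0, q)}"

lemma finite_grid_edges: "finite (grid_edges L M)"
  by (rule finite_subset[of _ "Pow (grid L M)"]) (auto simp: grid_edges_def finite_grid)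

lemma grid_edges_nonempty_edge: "g \<in> grid_edges L M \<Longrightarrow> g \<noteq> {}"
  by (auto simp: grid_edges_def)

lemma grid_edges_nonempty: "1 \<le> L \<Longrightarrow> grid_edges L M \<noteq> {}"
proof -
  assume "1 \<le> L"
  then have "{(0, 0), (1, 0)} \<in> grid_edges L M"
    unfolding grid_edges_def grid_def
    by (intro CollectI exI[of _ "(0, 0)"] exI[of _ "(1, 0)"]) (simp add: adjacent_iff)
  then show ?thesis by blast
qed

lemma planar_edge_eq_cross: "fst u = k \<Longrightarrow> fst v = k \<Longrightarrow> {u, v} = cross k {snd u, snd v}"
  by (auto simp: cross_def prod_eq_iff)

lemma cross_in_polygon:
  assumes "\<pi> \<in> cylinder_polygons L M" "cross k g \<in> \<pi>"
  shows "g \<in> grid_edges L M"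
proof -
  obtain u v where uv: "cross k g = {u, v}" "adjacent u v"
    using polygonD(3)[OF cylinder_polygonsD(1)[OF assms(1)] assms(2)] by blast
  have "u \<in> cross k g" "v \<in> cross k g" unfolding uv(1) by simp_all
  then have k: "fst u = k" "fst v = k" by simp_all
  have "g = {snd u, snd v}" using uv(1) planar_edge_eq_cross[OF k] by simp
  moreover have "snd u \<in> grid L M" "snd v \<in> grid L M"
    using cylinder_polygonsD(2)[OF assms(1)] assms(2) unfolding uv(1) by blast+
  moreover have "adjacent (0, snd u) (0, snd v)" using uv(2) k by (simp add: adjacent_iff)
  ultimately show ?thesis unfolding grid_edges_def by blast
qed

text \<open>A vertex in the rightmost plane has degree 2, but only one of its possible neighbours
  lies to the left, so one of its edges stays in the plane.\<close>

lemma ex_extreme_edge: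
  assumes \<pi>: "polygon \<pi>" and le: "\<And>v. v \<in> \<Union>\<pi> \<Longrightarrow> fst v \<le> k" and v: "v \<in> \<Union>\<pi>" "fst v = k"
  shows "\<exists>g. cross k g \<in> \<pi>"
proof (rule ccontr)
  assume no: "\<nexists>g. cross k g \<in> \<pi>"
  have "e = {v, (k - 1, snd v)}" if e: "e \<in> \<pi>" "v \<in> e" for e
  proof -
    obtain a b where "e = {a, b}" using polygonD(3)[OF \<pi> e(1)] by blast
    then obtain w where evw: "e = {v, w}" using e(2) by blast
    have "fst w \<noteq> k" using no e(1) planar_edge_eq_cross[OF v(2)] evw by metis
    moreover have "fst w \<le> k" using le e(1) evw by blast
    moreover have "\<bar>fst v - fst w\<bar> + \<bar>fst (snd v) - fst (snd w)\<bar> + \<bar>snd (snd v) - snd (snd w)\<bar> = 1"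
      using polygon_edge_adjacent[OF \<pi>, of v w] e(1) evw by (simp add: adjacent_iff)
    ultimately have "fst w = k - 1 \<and> fst (snd w) = fst (snd v) \<and> snd (snd w) = snd (snd v)"
      using v(2) by linarith
    then have "w = (k - 1, snd v)" by (simp add: prod_eq_iff)
    then show ?thesis by (simp add: evw)
  qed
  then have "{e\<in>\<pi>. v \<in> e} \<subseteq> {{v, (k - 1, snd v)}}" by blast
  then have "card {e\<in>\<pi>. v \<in> e} \<le> card {{v, (k - 1, snd v)}}" by (intro card_mono) auto
  then show False using polygonD(4)[OF \<pi> v(1)] by simp
qed

text \<open>Positive span separates the two end planes, so that opening the edge in one of them
  cannot destroy the marked edge in the other.\<close>

definition pinned :: "nat \<Rightarrow> nat \<Rightarrow> nat \<Rightarrow> (int \<times> int) set \<Rightarrow> (int \<times> int) set \<Rightarrow> vertex set set set" where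
  "pinned L M n g g' = {\<pi> \<in> polygons L M n.
     cross 0 g \<in> \<pi> \<and> cross (polygon_span \<pi>) g' \<in> \<pi> \<and> 0 < polygon_span \<pi>}"

definition pinned_sum :: "nat \<Rightarrow> nat \<Rightarrow> real \<Rightarrow> nat \<Rightarrow> (int \<times> int) set \<Rightarrow> (int \<times> int) set \<Rightarrow> real" where
  "pinned_sum L M f n g g' = (\<Sum>\<pi>\<in>pinned L M n g g'. exp (f * real_of_int (polygon_span \<pi>)))"

lemma finite_pinned: "finite (pinned L M n g g')"
  using finite_polygons by (simp add: pinned_def)

lemma pinned_sum_le: "pinned_sum L M f n g g' \<le> partition_function L M n f"
  unfolding pinned_sum_def partition_function_eq
  by (intro sum_mono2 finite_polygons) (auto simp: pinned_def)

section \<open>Concatenation at a prescribed edge\<close>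

definition concatenate :: "(int \<times> int) set \<Rightarrow> vertex set set \<Rightarrow> vertex set set \<Rightarrow> vertex set set" where
  "concatenate g \<pi> \<rho> = join (polygon_span \<pi>) g \<pi> (gmap (shift (polygon_span \<pi> + 1)) \<rho>)"

context
  fixes L M n m :: nat and g g' g'' :: "(int \<times> int) set" and \<pi> \<rho> :: "vertex set set"
  assumes \<pi>: "\<pi> \<in> pinned L M n g g'" and \<rho>: "\<rho> \<in> pinned L M m g' g''"
begin

lemma concatenate_prems:
  shows "polygon \<pi>" "polygon (gmap (shift (polygon_span \<pi> + 1)) \<rho>)"
    "\<And>v. v \<in> \<Union>\<pi> \<Longrightarrow> fst v \<le> polygon_span \<pi>"
    "\<And>v. v \<in> \<Union>(gmap (shift (polygon_span \<pi> + 1)) \<rho>) \<Longrightarrow> polygon_span \<pi> + 1 \<le> fst v"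
    "cross (polygon_span \<pi>) g' \<in> \<pi>"
    "cross (polygon_span \<pi> + 1) g' \<in> gmap (shift (polygon_span \<pi> + 1)) \<rho>"
proof -
  have P: "\<pi> \<in> polygons L M n" "\<rho> \<in> polygons L M m" using \<pi> \<rho> by (simp_all add: pinned_def)
  show "polygon \<pi>" by (rule polygonsD(2)[OF P(1)])
  then show "\<And>v. v \<in> \<Union>\<pi> \<Longrightarrow> fst v \<le> polygon_span \<pi>" by (rule polygon_span_ge)
  show "polygon (gmap (shift (polygon_span \<pi> + 1)) \<rho>)" by (rule polygon_shift[OF polygonsD(2)[OF P(2)]])
  show "polygon_span \<pi> + 1 \<le> fst v" if v: "v \<in> \<Union>(gmap (shift (polygon_span \<pi> + 1)) \<rho>)" for v
  proof -
    obtain u where "u \<in> \<Union>\<rho>" "v = shift (polygon_span \<pi> + 1) u"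
      using v unfolding Union_gmap by (rule imageE)
    then show ?thesis using polygonsD(3)[OF P(2)] by simp
  qed
  show "cross (polygon_span \<pi>) g' \<in> \<pi>" using \<pi> by (simp add: pinned_def)
  have "cross 0 g' \<in> \<rho>" using \<rho> by (simp add: pinned_def)
  then show "cross (polygon_span \<pi> + 1) g' \<in> gmap (shift (polygon_span \<pi> + 1)) \<rho>"
    unfolding mem_gmap_shift shift_cross by simp
qed

lemma concatenate_facts:
  shows "\<Union>(concatenate g' \<pi> \<rho>) = \<Union>\<pi> \<union> shift (polygon_span \<pi> + 1) ` \<Union>\<rho>"
    and "card (concatenate g' \<pi> \<rho>) = card \<pi> + card \<rho>"
    and "polygon (concatenate g' \<pi> \<rho>)"
  unfolding concatenate_def Union_gmap[symmetric] card_gmap[OF inj_shift, of "polygon_span \<pi> + 1" \<rho>, symmetric]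
  by (rule Union_join[OF concatenate_prems(1-2) _ _ concatenate_prems(5-6)]
        card_join[OF concatenate_prems(1-2) _ _ concatenate_prems(5-6)]
        polygon_join[OF concatenate_prems(1-2) _ _ concatenate_prems(5-6)];
      erule concatenate_prems(3) concatenate_prems(4))+

text \<open>The extra 1 is the bridged gap between the polygons; it causes the factor
  \<open>exp f\<close> in \<open>pinned_sum_concatenate\<close>.\<close>

lemma concatenate_span: "polygon_span (concatenate g' \<pi> \<rho>) = polygon_span \<pi> + 1 + polygon_span \<rho>"
proof -
  have P: "\<pi> \<in> polygons L M n" "\<rho> \<in> polygons L M m" using \<pi> \<rho> by (simp_all add: pinned_def)
  obtain v where v: "v \<in> \<Union>\<rho>" "fst v = polygon_span \<rho>" by (rule polygon_span_attained[OF polygonsD(2)[OF P(2)]])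
  show ?thesis
  proof (rule polygon_span_eqI[OF concatenate_facts(3)])
    show "shift (polygon_span \<pi> + 1) v \<in> \<Union>(concatenate g' \<pi> \<rho>)" unfolding concatenate_facts(1) using v by blast
    show "fst (shift (polygon_span \<pi> + 1) v) = polygon_span \<pi> + 1 + polygon_span \<rho>" using v by simp
    fix u assume "u \<in> \<Union>(concatenate g' \<pi> \<rho>)"
    then show "fst u \<le> polygon_span \<pi> + 1 + polygon_span \<rho>"
      unfolding concatenate_facts(1)
    proof
      assume "u \<in> \<Union>\<pi>"
      then show ?thesis using concatenate_prems(3)[of u] polygon_span_nonneg[OF P(2)] by simp
    next
      assume "u \<in> shift (polygon_span \<pi> + 1) ` \<Union>\<rho>"
      then obtain w where "w \<in> \<Union>\<rho>" "u = shift (polygon_span \<pi> + 1) w" by (rule imageE)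
      then show ?thesis using polygon_span_ge[OF polygonsD(2)[OF P(2)], of w] by simp
    qed
  qed
qed

lemma concatenate_pinned: "concatenate g' \<pi> \<rho> \<in> pinned L M (n + m) g g''"
proof -
  have P: "\<pi> \<in> polygons L M n" "\<rho> \<in> polygons L M m" using \<pi> \<rho> by (simp_all add: pinned_def)
  have s: "0 < polygon_span \<pi>" "0 < polygon_span \<rho>" using \<pi> \<rho> by (simp_all add: pinned_def)
  have c: "cross 0 g \<in> \<pi>" "cross (polygon_span \<rho>) g'' \<in> \<rho>" using \<pi> \<rho> by (simp_all add: pinned_def)
  have ne: "g \<noteq> {}" "g'' \<noteq> {}"
    using c cross_in_polygon[OF polygonsD(1)[OF P(1)]] cross_in_polygon[OF polygonsD(1)[OF P(2)]]
      grid_edges_nonempty_edge by blast+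
  have U: "\<Union>(concatenate g' \<pi> \<rho>) = \<Union>\<pi> \<union> shift (polygon_span \<pi> + 1) ` \<Union>\<rho>" by (rule concatenate_facts(1))
  have "concatenate g' \<pi> \<rho> \<in> cylinder_polygons L M"
    unfolding concatenate_def
    by (rule cylinder_join[OF polygonsD(1)[OF P(1)] cylinder_shift[OF polygonsD(1)[OF P(2)]] _ _
          concatenate_prems(5-6)]; erule concatenate_prems(3) concatenate_prems(4))
  moreover have "\<forall>v\<in>\<Union>(concatenate g' \<pi> \<rho>). 0 \<le> fst v"
    unfolding U using polygonsD(3)[OF P(1)] polygonsD(3)[OF P(2)] s by fastforce
  moreover have "\<exists>v\<in>\<Union>(concatenate g' \<pi> \<rho>). fst v = 0"
    unfolding U using polygonsD(4)[OF P(1)] by blast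
  ultimately have "concatenate g' \<pi> \<rho> \<in> polygons L M (n + m)"
    unfolding polygons_def tube_polygons_iff
    using concatenate_facts(2) polygonsD(5)[OF P(1)] polygonsD(5)[OF P(2)] by simp
  moreover have "cross 0 g \<in> concatenate g' \<pi> \<rho>"
    unfolding concatenate_def join_def using c(1) s(1) cross_eq_iff[OF ne(1)] by simp
  moreover have "cross (polygon_span \<pi> + 1 + polygon_span \<rho>) g'' \<in> gmap (shift (polygon_span \<pi> + 1)) \<rho>"
    unfolding mem_gmap_shift shift_cross using c(2) by simp
  then have "cross (polygon_span \<pi> + 1 + polygon_span \<rho>) g'' \<in> concatenate g' \<pi> \<rho>"
    unfolding concatenate_def join_def using s(2) cross_eq_iff[OF ne(2)] by simp
  ultimately show ?thesis using s by (simp add: pinned_def concatenate_span)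
qed

lemma concatenate_left_verts: "{v \<in> \<Union>(concatenate g' \<pi> \<rho>). fst v \<le> polygon_span \<pi>} = \<Union>\<pi>"
  unfolding concatenate_facts(1) Union_gmap[symmetric]
  using concatenate_prems(3) concatenate_prems(4) by force

text \<open>Once the plane of the join is known, a factor is recovered from its side of the result
  by putting back the removed edge, which is known because \<open>g'\<close> is fixed.\<close>

lemma concatenate_left: "\<pi> = insert (cross (polygon_span \<pi>) g')
    {e \<in> concatenate g' \<pi> \<rho>. \<forall>v\<in>e. fst v \<le> polygon_span \<pi>}"
proof -
  let ?k = "polygon_span \<pi>" and ?\<rho> = "gmap (shift (polygon_span \<pi> + 1)) \<rho>"
  have 1: "\<forall>v\<in>e. fst v \<le> ?k" if "e \<in> \<pi>" for e using concatenate_prems(3) that by blast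
  have 2: "\<not> (\<forall>v\<in>e. fst v \<le> ?k)" if e: "e \<in> ?\<rho>" for e
  proof -
    obtain u v where uv: "e = {u, v}" using polygonD(3)[OF concatenate_prems(2) e] by blast
    then have "u \<in> \<Union>?\<rho>" using e by blast
    then have "\<not> fst u \<le> ?k" using concatenate_prems(4)[of u] by simp
    then show ?thesis using uv by blast
  qed
  have 3: "\<not> (\<forall>v\<in>e. fst v \<le> ?k)" if "e \<in> bridges ?k g'" for e
    using that by (auto simp: bridges_def)
  show ?thesis
    using concatenate_prems(5) 1 2 3 unfolding concatenate_def join_def by blast
qed

lemma concatenate_right: "gmap (shift (polygon_span \<pi> + 1)) \<rho> = insert (cross (polygon_span \<pi> + 1) g')
    {e \<in> concatenate g' \<pi> \<rho>. \<forall>v\<in>e. polygon_span \<pi> + 1 \<le> fst v}"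
proof -
  let ?k = "polygon_span \<pi>" and ?\<rho> = "gmap (shift (polygon_span \<pi> + 1)) \<rho>"
  have 1: "\<forall>v\<in>e. ?k + 1 \<le> fst v" if "e \<in> ?\<rho>" for e using concatenate_prems(4) that by blast
  have 2: "\<not> (\<forall>v\<in>e. ?k + 1 \<le> fst v)" if e: "e \<in> \<pi>" for e
  proof -
    obtain u v where uv: "e = {u, v}" using polygonD(3)[OF concatenate_prems(1) e] by blast
    then have "u \<in> \<Union>\<pi>" using e by blast
    then have "\<not> ?k + 1 \<le> fst u" using concatenate_prems(3)[of u] by simp
    then show ?thesis using uv by blast
  qed
  have 3: "\<not> (\<forall>v\<in>e. ?k + 1 \<le> fst v)" if "e \<in> bridges ?k g'" for e
    using that by (auto simp: bridges_def)
  show ?thesis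
    using concatenate_prems(6) 1 2 3 unfolding concatenate_def join_def by blast
qed

end

text \<open>The place of the join is recovered as the plane up to which there are \<open>n\<close> vertices.\<close>

lemma concatenate_span_inject:
  assumes "\<pi> \<in> pinned L M n g g'" "\<rho> \<in> pinned L M m g' g''"
    and "\<pi>' \<in> pinned L M n g g'" "\<rho>' \<in> pinned L M m g' g''"
    and eq: "concatenate g' \<pi> \<rho> = concatenate g' \<pi>' \<rho>'"
  shows "\<not> polygon_span \<pi> < polygon_span \<pi>'"
proof
  assume less: "polygon_span \<pi> < polygon_span \<pi>'"
  have P: "\<pi> \<in> polygons L M n" "\<pi>' \<in> polygons L M n" using assms by (simp_all add: pinned_def)
  have "\<Union>\<pi> \<subseteq> \<Union>\<pi>'"
    unfolding concatenate_left_verts[OF assms(1,2), symmetric] concatenate_left_verts[OF assms(3,4), symmetric] eq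
    using less by auto
  moreover obtain v where v: "v \<in> \<Union>\<pi>'" "fst v = polygon_span \<pi>'"
    by (rule polygon_span_attained[OF polygonsD(2)[OF P(2)]])
  have "v \<notin> \<Union>\<pi>" using polygon_span_ge[OF polygonsD(2)[OF P(1)], of v] v(2) less by auto
  ultimately have "\<Union>\<pi> \<subset> \<Union>\<pi>'" using v(1) by blast
  then have "card (\<Union>\<pi>) < card (\<Union>\<pi>')"
    by (rule psubset_card_mono[OF polygon_finite_verts[OF polygonsD(2)[OF P(2)]]])
  then show False
    using polygon_card_verts[OF polygonsD(2)[OF P(1)]] polygon_card_verts[OF polygonsD(2)[OF P(2)]]
      polygonsD(5)[OF P(1)] polygonsD(5)[OF P(2)] by simp
qed

lemma inj_concatenate:
  "inj_on (\<lambda>(\<pi>, \<rho>). concatenate g' \<pi> \<rho>) (pinned L M n g g' \<times> pinned L M m g' g'')"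
proof (rule inj_onI, clarify)
  fix \<pi> \<rho> \<pi>' \<rho>'
  assume *: "\<pi> \<in> pinned L M n g g'" "\<rho> \<in> pinned L M m g' g''"
    "\<pi>' \<in> pinned L M n g g'" "\<rho>' \<in> pinned L M m g' g''" and eq: "concatenate g' \<pi> \<rho> = concatenate g' \<pi>' \<rho>'"
  have s: "polygon_span \<pi> = polygon_span \<pi>'"
    using concatenate_span_inject[OF * eq] concatenate_span_inject[OF *(3,4,1,2) eq[symmetric]] by simp
  have 1: "\<pi> = \<pi>'"
    by (subst concatenate_left[OF *(1,2)], subst concatenate_left[OF *(3,4)]) (simp only: s eq)
  have "gmap (shift (polygon_span \<pi> + 1)) \<rho> = gmap (shift (polygon_span \<pi>' + 1)) \<rho>'"
    by (subst concatenate_right[OF *(1,2)], subst concatenate_right[OF *(3,4)]) (simp only: s eq)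
  then have "\<rho> = \<rho>'" unfolding s by (rule injD[OF inj_gmap[OF inj_shift]])
  then show "\<pi> = \<pi>' \<and> \<rho> = \<rho>'" using 1 by simp
qed

text \<open>For fixed lengths and a fixed joining edge concatenation is injective, and the weights
  multiply up to the factor \<open>exp f\<close>.\<close>

lemma pinned_sum_concatenate:
  "exp f * (pinned_sum L M f n g g' * pinned_sum L M f m g' g'') \<le> pinned_sum L M f (n + m) g g''"
proof -
  let ?A = "pinned L M n g g'" and ?B = "pinned L M m g' g''"
  let ?w = "\<lambda>\<pi>. exp (f * real_of_int (polygon_span \<pi>))"
  have "exp f * (pinned_sum L M f n g g' * pinned_sum L M f m g' g'') =
      (\<Sum>x\<in>?A \<times> ?B. exp f * (?w (fst x) * ?w (snd x)))"
    unfolding pinned_sum_def sum_product sum.cartesian_product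
    by (simp add: sum_distrib_left case_prod_beta)
  also have "\<dots> = (\<Sum>x\<in>?A \<times> ?B. ?w ((\<lambda>(\<pi>, \<rho>). concatenate g' \<pi> \<rho>) x))"
  proof (rule sum.cong[OF refl])
    fix x assume "x \<in> ?A \<times> ?B"
    then obtain \<pi> \<rho> where x: "x = (\<pi>, \<rho>)" "\<pi> \<in> ?A" "\<rho> \<in> ?B" by (rule SigmaE)
    have "exp f * (?w \<pi> * ?w \<rho>) = ?w (concatenate g' \<pi> \<rho>)"
      unfolding concatenate_span[OF x(2,3)] by (simp add: exp_add[symmetric] algebra_simps)
    then show "exp f * (?w (fst x) * ?w (snd x)) = ?w ((\<lambda>(\<pi>, \<rho>). concatenate g' \<pi> \<rho>) x)" by (simp add: x(1))
  qed
  also have "\<dots> = (\<Sum>\<sigma>\<in>(\<lambda>(\<pi>, \<rho>). concatenate g' \<pi> \<rho>) ` (?A \<times> ?B). ?w \<sigma>)"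
    by (simp add: sum.reindex[OF inj_concatenate] o_def)
  also have "\<dots> \<le> pinned_sum L M f (n + m) g g''"
    unfolding pinned_sum_def
  proof (rule sum_mono2[OF finite_pinned])
    show "(\<lambda>(\<pi>, \<rho>). concatenate g' \<pi> \<rho>) ` (?A \<times> ?B) \<subseteq> pinned L M (n + m) g g''"
      using concatenate_pinned by (auto simp del: Sup_upper)
  qed simp
  finally show ?thesis .
qed

lemma reflect_pinned:
  assumes \<pi>: "\<pi> \<in> pinned L M n g g'"
  shows "gmap (reflect (polygon_span \<pi>)) \<pi> \<in> pinned L M n g' g"
    and "polygon_span (gmap (reflect (polygon_span \<pi>)) \<pi>) = polygon_span \<pi>"
proof -
  let ?k = "polygon_span \<pi>" and ?r = "gmap (reflect (polygon_span \<pi>)) \<pi>"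
  have P: "\<pi> \<in> polygons L M n" using \<pi> by (simp add: pinned_def)
  note pol = polygonsD(2)[OF P]
  obtain a where a: "a \<in> \<Union>\<pi>" "fst a = 0" using polygonsD(4)[OF P] by blast
  obtain b where b: "b \<in> \<Union>\<pi>" "fst b = ?k" by (rule polygon_span_attained[OF pol])
  have U: "\<Union>?r = reflect ?k ` \<Union>\<pi>" by (rule Union_gmap)
  have range: "0 \<le> fst v \<and> fst v \<le> ?k" if "v \<in> \<Union>?r" for v
  proof -
    obtain u where "u \<in> \<Union>\<pi>" "v = reflect ?k u" using \<open>v \<in> \<Union>?r\<close> unfolding U by (rule imageE)
    then show ?thesis using polygonsD(3)[OF P, of u] polygon_span_ge[OF pol, of u] by simp
  qed
  show span: "polygon_span ?r = ?k"
  proof (rule polygon_span_eqI[OF polygon_reflect[OF pol]])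
    show "reflect ?k a \<in> \<Union>?r" unfolding U using a(1) by (rule imageI)
    show "fst (reflect ?k a) = ?k" using a(2) by simp
  qed (use range in blast)
  have "\<exists>v\<in>\<Union>?r. fst v = 0"
    by (rule bexI[of _ "reflect ?k b"]) (use b U in auto)
  then have "?r \<in> polygons L M n"
    unfolding polygons_def tube_polygons_iff
    using cylinder_reflect[OF polygonsD(1)[OF P]] range polygonsD(5)[OF P] card_gmap[OF inj_reflect]
    by blast
  moreover have "cross (?k - 0) g \<in> ?r" "cross (?k - ?k) g' \<in> ?r"
    unfolding reflect_cross[symmetric] gmap_def using \<pi> by (simp_all add: pinned_def)
  ultimately show "?r \<in> pinned L M n g' g" using \<pi> by (simp add: pinned_def span)
qed

lemma pinned_sum_commute: "pinned_sum L M f n g g' = pinned_sum L M f n g' g"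
  unfolding pinned_sum_def
proof (rule sum.reindex_bij_witness[of _ "\<lambda>\<pi>. gmap (reflect (polygon_span \<pi>)) \<pi>"
      "\<lambda>\<pi>. gmap (reflect (polygon_span \<pi>)) \<pi>"])
qed (simp_all add: reflect_pinned(2) reflect_pinned(1))

text \<open>The edge \<open>g\<close> swept along \<open>m\<close> planes bounds a rectangle;
  \<open>2 \<le> m\<close> gives it positive span.\<close>

lemma rectangle_pinned:
  assumes "g \<in> grid_edges L M" "2 \<le> m"
  shows "pinned L M (2 * m) g g \<noteq> {}"
proof -
  obtain p q where g: "g = {p, q}" "p \<in> grid L M" "q \<in> grid L M" "adjacent (0, p) (0, q)"
    using assms(1) unfolding grid_edges_def by blast
  have pq: "p \<noteq> q" using adjacent_neq[OF g(4)] by simp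
  define P where "P = (\<lambda>i. (int i, p))"
  define Q where "Q = (\<lambda>i. (int i, q))"
  have inj: "inj_on P {..<m}" "inj_on Q {..<m}" by (simp_all add: P_def Q_def inj_on_def)
  have disj: "P i \<noteq> Q j" for i j using pq by (simp add: P_def Q_def)
  have adj: "adjacent (P i) (P (Suc i))" "adjacent (Q i) (Q (Suc i))" "adjacent (P i) (Q i)" for i
    using g(4) by (simp_all add: P_def Q_def adjacent_iff)
  note L = assms(2) inj disj adj(1,2,3,3)
  let ?l = "ladder m P Q"
  have pol: "polygon ?l" by (rule polygon_ladder[where m = m and P = P and Q = Q, OF L])
  have U: "\<Union>?l = P ` {..<m} \<union> Q ` {..<m}" by (rule Union_ladder[where m = m and P = P and Q = Q, OF L])
  have range: "0 \<le> fst v \<and> fst v \<le> int (m - 1) \<and> snd v \<in> grid L M" if "v \<in> \<Union>?l" for v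
    using that g(2,3) unfolding U by (auto simp: P_def Q_def)
  have P0: "P 0 \<in> \<Union>?l" "P (m - 1) \<in> \<Union>?l" unfolding U using assms(2) by auto
  have span: "polygon_span ?l = int (m - 1)"
    by (rule polygon_span_eqI[OF pol _ P0(2)]) (use range in \<open>auto simp: P_def\<close>)
  have "?l \<in> cylinder_polygons L M"
    unfolding cylinder_polygons_def using pol range by blast
  moreover have "card ?l = 2 * m" by (rule card_ladder[where m = m and P = P and Q = Q, OF L])
  moreover have "fst (P 0) = 0" by (simp add: P_def)
  ultimately have "?l \<in> polygons L M (2 * m)"
    unfolding polygons_def tube_polygons_iff using range P0(1) by blast
  moreover have "cross 0 g = {P 0, Q 0}" "cross (int (m - 1)) g = {P (m - 1), Q (m - 1)}"
    by (simp_all add: cross_def g(1) P_def Q_def)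
  then have "cross 0 g \<in> ?l" "cross (int (m - 1)) g \<in> ?l"
    using ladder_edges(3,4)[where m = m and P = P and Q = Q, OF L] by simp_all
  moreover have "0 < int (m - 1)" using assms(2) by simp
  ultimately have "?l \<in> pinned L M (2 * m) g g" by (simp add: pinned_def span)
  then show ?thesis by blast
qed

lemma pinned_sum_pos: "g \<in> grid_edges L M \<Longrightarrow> 2 \<le> m \<Longrightarrow> 0 < pinned_sum L M f (2 * m) g g"
  unfolding pinned_sum_def using rectangle_pinned by (intro sum_pos finite_pinned) auto

text \<open>The sets may overlap: a polygon can have several edges in its end planes and is then
  pinned in several ways.\<close>

lemma sum_UN_le:
  fixes f :: "'a \<Rightarrow> real"
  assumes "finite I" "\<And>i. finite (A i)" "\<And>x. 0 \<le> f x"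
  shows "sum f (\<Union>i\<in>I. A i) \<le> (\<Sum>i\<in>I. sum f (A i))"
  using assms(1)
proof (induction rule: finite_induct)
  case (insert i I)
  have "sum f (A i \<union> (\<Union>i\<in>I. A i)) + sum f (A i \<inter> (\<Union>i\<in>I. A i)) = sum f (A i) + sum f (\<Union>i\<in>I. A i)"
    using insert(1) assms(2) by (intro sum.union_inter) auto
  moreover have "0 \<le> sum f (A i \<inter> (\<Union>i\<in>I. A i))" using assms(3) by (intro sum_nonneg)
  ultimately show ?case using insert by simp
qed simp

text \<open>A polygon of span 0 lies in one plane and has at most \<open>tube_width L M\<close>
  vertices, so a longer one has two distinct end planes, each containing one of its edges.\<close>

lemma partition_function_le_pinned:
  assumes "tube_width L M < n"
  shows "partition_function L M n f \<le>
    (\<Sum>g\<in>grid_edges L M. \<Sum>g'\<in>grid_edges L M. pinned_sum L M f n g g')"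
proof -
  let ?G = "grid_edges L M"
  let ?w = "\<lambda>\<pi>. exp (f * real_of_int (polygon_span \<pi>))"
  have sub: "polygons L M n \<subseteq> (\<Union>x\<in>?G \<times> ?G. pinned L M n (fst x) (snd x))"
  proof
    fix \<pi> assume P: "\<pi> \<in> polygons L M n"
    note pol = polygonsD(2)[OF P] and cyl = polygonsD(1)[OF P]
    obtain a where a: "a \<in> \<Union>\<pi>" "fst a = 0" using polygonsD(4)[OF P] by blast
    obtain b where b: "b \<in> \<Union>\<pi>" "fst b = polygon_span \<pi>" by (rule polygon_span_attained[OF pol])
    obtain g' where g': "cross (polygon_span \<pi>) g' \<in> \<pi>"
      using ex_extreme_edge[OF pol polygon_span_ge[OF pol] b] by blast
    \<comment> \<open>The statement about rightmost planes, applied to the mirror image, yields an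
      edge in the plane 0.\<close>
    have "\<exists>g. cross 0 g \<in> gmap (reflect 0) \<pi>"
    proof (rule ex_extreme_edge[OF polygon_reflect[OF pol]])
      show "reflect 0 a \<in> \<Union>(gmap (reflect 0) \<pi>)" unfolding Union_gmap using a(1) by (rule imageI)
      show "fst (reflect 0 a) = 0" using a(2) by simp
      fix v assume "v \<in> \<Union>(gmap (reflect 0) \<pi>)"
      then obtain u where "u \<in> \<Union>\<pi>" "v = reflect 0 u" unfolding Union_gmap by (rule imageE)
      then show "fst v \<le> 0" using polygonsD(3)[OF P, of u] by simp
    qed
    then obtain g where "cross 0 g \<in> gmap (reflect 0) \<pi>" by blast
    then have "reflect 0 ` cross 0 g \<in> gmap (reflect 0) (gmap (reflect 0) \<pi>)"
      unfolding gmap_def by (rule imageI)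
    then have g: "cross 0 g \<in> \<pi>" by (simp add: reflect_cross)
    have "polygon_span \<pi> \<noteq> 0"
    proof
      assume "polygon_span \<pi> = 0"
      then have "card (window_verts (Suc 0) \<pi>) = n" "\<pi> \<in> windows L M (Suc 0)"
        using polygons_window[OF P, of 0] by simp_all
      then show False using card_window_verts_le[of \<pi> L M "Suc 0"] assms by simp
    qed
    then have "\<pi> \<in> pinned L M n g g'"
      using P g g' polygon_span_nonneg[OF P] by (simp add: pinned_def)
    moreover have "(g, g') \<in> ?G \<times> ?G"
      using cross_in_polygon[OF cyl g] cross_in_polygon[OF cyl g'] by simp
    ultimately show "\<pi> \<in> (\<Union>x\<in>?G \<times> ?G. pinned L M n (fst x) (snd x))"
      by (intro UN_I[of "(g, g')"]) simp_all
  qed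
  have "partition_function L M n f \<le> (\<Sum>\<pi>\<in>(\<Union>x\<in>?G \<times> ?G. pinned L M n (fst x) (snd x)). ?w \<pi>)"
    unfolding partition_function_eq
    by (intro sum_mono2[OF _ sub] finite_UN_I finite_cartesian_product finite_grid_edges finite_pinned) simp
  also have "\<dots> \<le> (\<Sum>x\<in>?G \<times> ?G. \<Sum>\<pi>\<in>pinned L M n (fst x) (snd x). ?w \<pi>)"
    by (intro sum_UN_le finite_cartesian_product finite_grid_edges finite_pinned) simp
  also have "\<dots> = (\<Sum>g\<in>?G. \<Sum>g'\<in>?G. pinned_sum L M f n g g')"
    unfolding pinned_sum_def by (simp add: sum.cartesian_product case_prod_beta)
  finally show ?thesis .
qed

text \<open>The assumed bound serves twice: it keeps the limits of the supermultiplicative sequences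
  finite, and it passes to the limit as \<open>l \<le> ln y\<close>.\<close>

lemma partition_function_limit:
  assumes "1 \<le> L" "0 < C" "0 < y"
    and bound: "\<And>n. partition_function L M n f \<le> C * real n * y ^ n"
  obtains l where "(\<lambda>m. ln (partition_function L M (2 * m) f) / real (2 * m)) \<longlonglongrightarrow> l" "l \<le> ln y"
proof -
  let ?G = "grid_edges L M"
  \<comment> \<open>The factor \<open>exp f\<close> makes the sequences exactly supermultiplicative.
    The index \<open>k\<close> is half the length.\<close>
  define c where "c = (\<lambda>g k. exp f * pinned_sum L M f (2 * k) g g)"
  \<comment> \<open>A lower bound for \<open>- ln (c g k) / real k\<close>, obtained from the
    assumed bound and \<open>ln x \<le> x\<close>.\<close>
  define B where "B = - (\<bar>f\<bar> + 2 * C + 2 * ln y)"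
  have c_pos: "0 < c g k" if "g \<in> ?G" "2 \<le> k" for g k
    using pinned_sum_pos[OF that] by (simp add: c_def)
  have c_add: "c g j * c g k \<le> c g (j + k)" for g j k
  proof -
    have "exp f * (pinned_sum L M f (2 * j) g g * pinned_sum L M f (2 * k) g g) \<le>
        pinned_sum L M f (2 * j + 2 * k) g g" by (rule pinned_sum_concatenate)
    then show ?thesis by (simp add: c_def distrib_left mult.assoc mult.left_commute)
  qed
  have ln_bound: "ln x \<le> ln (C * real (2 * k)) + real (2 * k) * ln y"
    if "0 < x" "x \<le> partition_function L M (2 * k) f" "0 < k" for x k
  proof -
    have "ln x \<le> ln (C * real (2 * k) * y ^ (2 * k))"
      using that bound[of "2 * k"] by (intro ln_mono) auto
    also have "\<dots> = ln (C * real (2 * k)) + real (2 * k) * ln y"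
      using that assms(2,3) by (subst ln_mult_pos) (auto simp: ln_realpow)
    finally show ?thesis .
  qed
  have "\<exists>l. (\<lambda>k. ln (c g k) / real k) \<longlonglongrightarrow> l \<and> (\<forall>k\<ge>2. ln (c g k) / real k \<le> l)" if g: "g \<in> ?G" for g
  proof -
    obtain l where l: "(\<lambda>k. - ln (c g k) / real k) \<longlonglongrightarrow> l" "\<And>k. 2 \<le> k \<Longrightarrow> l \<le> - ln (c g k) / real k"
    proof (rule fekete[of 2 "\<lambda>k. - ln (c g k)" B])
      fix j k :: nat assume jk: "2 \<le> j" "2 \<le> k"
      have "ln (c g j * c g k) \<le> ln (c g (j + k))"
        using c_pos[OF g] jk by (intro ln_mono c_add mult_pos_pos) auto
      then show "- ln (c g (j + k)) \<le> - ln (c g j) + - ln (c g k)"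
        using c_pos[OF g] jk by (simp add: ln_mult_pos)
    next
      fix k :: nat assume k: "2 \<le> k"
      have p: "0 < pinned_sum L M f (2 * k) g g" by (rule pinned_sum_pos[OF g k])
      have "ln (c g k) = f + ln (pinned_sum L M f (2 * k) g g)"
        using p by (simp add: c_def ln_mult_pos)
      also have "\<dots> \<le> f + (ln (C * real (2 * k)) + real (2 * k) * ln y)"
        using ln_bound[OF p pinned_sum_le] k by simp
      also have "ln (C * real (2 * k)) \<le> C * real (2 * k)"
        using k assms(2) by (intro less_imp_le ln_less_self) simp
      also have "f \<le> \<bar>f\<bar> * real k"
      proof -
        have "\<bar>f\<bar> * 1 \<le> \<bar>f\<bar> * real k" using k by (intro mult_left_mono) auto
        then show ?thesis by linarith
      qed
      finally have "ln (c g k) \<le> \<bar>f\<bar> * real k + (C * real (2 * k) + real (2 * k) * ln y)" by simp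
      then have "B * real k \<le> - ln (c g k)" by (simp add: B_def algebra_simps)
      then show "B \<le> - ln (c g k) / real k" using k by (subst pos_le_divide_eq) auto
    qed auto
    have "(\<lambda>k. - (- ln (c g k) / real k)) \<longlonglongrightarrow> - l" by (rule tendsto_minus[OF l(1)])
    moreover have "\<forall>k\<ge>2. ln (c g k) / real k \<le> - l" using l(2) by fastforce
    ultimately show ?thesis by (intro exI[of _ "- l"]) simp
  qed
  then obtain \<kappa> where lam: "\<And>g. g \<in> ?G \<Longrightarrow> (\<lambda>k. ln (c g k) / real k) \<longlonglongrightarrow> \<kappa> g"
    "\<And>g k. g \<in> ?G \<Longrightarrow> 2 \<le> k \<Longrightarrow> ln (c g k) / real k \<le> \<kappa> g" by metis
  define \<mu> where "\<mu> = Max (\<kappa> ` ?G)"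
  have fin: "finite (\<kappa> ` ?G)" "\<kappa> ` ?G \<noteq> {}"
    using finite_grid_edges grid_edges_nonempty[OF assms(1)] by auto
  obtain g0 where g0: "g0 \<in> ?G" "\<kappa> g0 = \<mu>" using Max_in[OF fin] unfolding \<mu>_def by (metis imageE)
  \<comment> \<open>The limit is a supremum here, so the bound holds at every index from 2 on and
    can be used below without passing to a limit.\<close>
  have le_mu: "c g k \<le> exp (\<mu> * real k)" if "g \<in> ?G" "2 \<le> k" for g k
  proof -
    have "\<kappa> g \<le> \<mu>" unfolding \<mu>_def using that(1) fin by (intro Max_ge) auto
    then have "ln (c g k) / real k \<le> \<mu>" using lam(2)[OF that] by simp
    then have "ln (c g k) \<le> \<mu> * real k" using that(2) by (simp add: pos_divide_le_eq)
    then have "exp (ln (c g k)) \<le> exp (\<mu> * real k)" by simp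
    then show ?thesis using c_pos[OF that] by simp
  qed
  define D where "D = real (card ?G * card ?G) * exp (- f)"
  have D: "0 < D" using finite_grid_edges grid_edges_nonempty[OF assms(1)] by (simp add: D_def card_gt_0_iff)
  \<comment> \<open>Joining with a mirror image leads from any pair to the diagonal at twice the
    length; the square root then has the diagonal rate.\<close>
  have pinned_le: "pinned_sum L M f (2 * k) g g' \<le> exp (- f) * exp (\<mu> * real k)"
    if "g \<in> ?G" "2 \<le> k" for g g' k
  proof (rule power2_le_imp_le)
    let ?a = "pinned_sum L M f (2 * k) g g'"
    have *: "exp f * (?a * pinned_sum L M f (2 * k) g' g) \<le> pinned_sum L M f (2 * k + 2 * k) g g"
      by (rule pinned_sum_concatenate)
    have "exp f * ?a\<^sup>2 \<le> pinned_sum L M f (2 * (2 * k)) g g"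
    proof -
      have "2 * k + 2 * k = 2 * (2 * k)" by simp
      then show ?thesis
        using * by (simp only: pinned_sum_commute[of L M f "2 * k" g' g] power2_eq_square)
    qed
    also have "\<dots> = exp (- f) * c g (2 * k)" by (simp add: c_def mult.assoc[symmetric] exp_add[symmetric])
    also have "\<dots> \<le> exp (- f) * exp (\<mu> * real (2 * k))" using le_mu[OF that(1), of "2 * k"] that(2) by simp
    finally have "exp (- f) * (exp f * ?a\<^sup>2) \<le> exp (- f) * (exp (- f) * exp (\<mu> * real (2 * k)))"
      by (intro mult_left_mono) auto
    then have "?a\<^sup>2 \<le> exp (- f) * (exp (- f) * exp (\<mu> * real (2 * k)))"
      by (simp add: mult.assoc[symmetric] exp_add[symmetric])
    also have "\<dots> = (exp (- f) * exp (\<mu> * real k))\<^sup>2"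
      by (simp add: power2_eq_square exp_add[symmetric])
    finally show "?a\<^sup>2 \<le> (exp (- f) * exp (\<mu> * real k))\<^sup>2" .
  qed simp
  let ?Z = "\<lambda>k. partition_function L M (2 * k) f"
  have Z_ge: "exp (- f) * c g0 k \<le> ?Z k" for k
    using pinned_sum_le[of L M f "2 * k" g0 g0] by (simp add: c_def mult.assoc[symmetric] exp_add[symmetric])
  have Z_pos: "0 < ?Z k" if "2 \<le> k" for k
    using Z_ge[of k] c_pos[OF g0(1) that] by (meson exp_gt_zero less_le_trans mult_pos_pos)
  have lower: "(- f + ln (c g0 k)) / real (2 * k) \<le> ln (?Z k) / real (2 * k)" if k: "2 \<le> k" for k
  proof (rule divide_right_mono)
    have "ln (exp (- f) * c g0 k) \<le> ln (?Z k)"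
      using Z_ge[of k] c_pos[OF g0(1) k] by (intro ln_mono mult_pos_pos) auto
    then show "- f + ln (c g0 k) \<le> ln (?Z k)" using c_pos[OF g0(1) k] by (simp add: ln_mult_pos)
  qed simp
  have upper: "ln (?Z k) / real (2 * k) \<le> (ln D + \<mu> * real k) / real (2 * k)"
    if k: "2 \<le> k" "tube_width L M < k" for k
  proof (rule divide_right_mono)
    have "?Z k \<le> (\<Sum>g\<in>?G. \<Sum>g'\<in>?G. pinned_sum L M f (2 * k) g g')"
      using k by (intro partition_function_le_pinned) simp
    also have "\<dots> \<le> (\<Sum>g\<in>?G. \<Sum>g'\<in>?G. exp (- f) * exp (\<mu> * real k))"
      using pinned_le k(1) by (intro sum_mono) auto
    also have "\<dots> = D * exp (\<mu> * real k)" by (simp add: D_def)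
    finally have "ln (?Z k) \<le> ln (D * exp (\<mu> * real k))"
      using Z_pos[OF k(1)] by (intro ln_mono)
    then show "ln (?Z k) \<le> ln D + \<mu> * real k" using D by (simp add: ln_mult_pos)
  qed simp
  \<comment> \<open>The rate is halved because \<open>\<mu>\<close> refers to half-lengths.\<close>
  have lim_lower: "(\<lambda>k. (- f + ln (c g0 k)) / real (2 * k)) \<longlonglongrightarrow> \<mu> / 2"
  proof -
    have "(\<lambda>k. (- f / 2) / real k + ln (c g0 k) / real k / 2) \<longlonglongrightarrow> 0 + \<mu> / 2"
      using lam(1)[OF g0(1)] unfolding g0(2) by (intro tendsto_intros lim_const_over_n) auto
    moreover have "(\<lambda>k. (- f / 2) / real k + ln (c g0 k) / real k / 2) =
        (\<lambda>k. (- f + ln (c g0 k)) / real (2 * k))"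
    proof
      show "(- f / 2) / real k + ln (c g0 k) / real k / 2 = (- f + ln (c g0 k)) / real (2 * k)" for k
        by (cases "k = 0") (simp_all add: field_simps)
    qed
    ultimately show ?thesis by (simp only: add_0)
  qed
  have lim_upper: "(\<lambda>k. (ln D + \<mu> * real k) / real (2 * k)) \<longlonglongrightarrow> \<mu> / 2"
  proof -
    have "(\<lambda>k. (ln D / 2) / real k + \<mu> / 2) \<longlonglongrightarrow> 0 + \<mu> / 2"
      by (intro tendsto_intros lim_const_over_n)
    moreover have "\<forall>\<^sub>F k in sequentially.
        (ln D / 2) / real k + \<mu> / 2 = (ln D + \<mu> * real k) / real (2 * k)"
      using eventually_gt_at_top[of 0] by eventually_elim (simp add: field_simps)
    ultimately show ?thesis by (auto dest: Lim_transform_eventually)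
  qed
  have lim: "(\<lambda>k. ln (?Z k) / real (2 * k)) \<longlonglongrightarrow> \<mu> / 2"
  proof (rule tendsto_sandwich[OF _ _ lim_lower lim_upper])
    show "\<forall>\<^sub>F k in sequentially. (- f + ln (c g0 k)) / real (2 * k) \<le> ln (?Z k) / real (2 * k)"
      using eventually_ge_at_top[of 2] by eventually_elim (rule lower)
    show "\<forall>\<^sub>F k in sequentially. ln (?Z k) / real (2 * k) \<le> (ln D + \<mu> * real k) / real (2 * k)"
      using eventually_ge_at_top[of 2] eventually_gt_at_top[of "tube_width L M"]
      by eventually_elim (rule upper)
  qed
  have lim_bound: "(\<lambda>k. (ln C + ln (real (2 * k))) / real (2 * k) + ln y) \<longlonglongrightarrow> ln y"
  proof -
    define h where "h = (\<lambda>n. ln C / real n + ln (real n) / real n + ln y)"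
    have A: "(\<lambda>n. ln C / real n) \<longlonglongrightarrow> 0" by (rule lim_const_over_n)
    have B: "(\<lambda>n. ln (real n) / real n) \<longlonglongrightarrow> 0"
      by (rule filterlim_compose[OF ln_x_over_x_tendsto_0 filterlim_real_sequentially])
    have "h \<longlonglongrightarrow> 0 + 0 + ln y"
      unfolding h_def by (rule tendsto_add[OF tendsto_add[OF A B] tendsto_const])
    moreover have "strict_mono (\<lambda>k::nat. 2 * k)" by (rule strict_monoI) simp
    ultimately have "(h \<circ> (\<lambda>k. 2 * k)) \<longlonglongrightarrow> 0 + 0 + ln y" by (rule LIMSEQ_subseq_LIMSEQ)
    moreover have "h \<circ> (\<lambda>k. 2 * k) = (\<lambda>k. (ln C + ln (real (2 * k))) / real (2 * k) + ln y)"
      by (rule ext) (simp only: h_def o_def add_divide_distrib)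
    ultimately show ?thesis by (simp only: add_0)
  qed
  have "\<mu> / 2 \<le> ln y"
  proof (rule LIMSEQ_le[OF lim lim_bound], intro exI allI impI)
    fix k :: nat assume k: "2 \<le> k"
    have "ln (?Z k) \<le> ln (C * real (2 * k)) + real (2 * k) * ln y"
      using k by (intro ln_bound Z_pos) auto
    also have "ln (C * real (2 * k)) = ln C + ln (real (2 * k))"
      using k assms(2) by (intro ln_mult_pos) auto
    finally have "ln (?Z k) / real (2 * k) \<le> (ln C + ln (real (2 * k)) + real (2 * k) * ln y) / real (2 * k)"
      by (intro divide_right_mono) auto
    also have "\<dots> = (ln C + ln (real (2 * k))) / real (2 * k) + ln y"
      using k by (simp add: add_divide_distrib)
    finally show "ln (?Z k) / real (2 * k) \<le> (ln C + ln (real (2 * k))) / real (2 * k) + ln y" .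
  qed
  then show ?thesis using lim that by blast
qed

section \<open>Bounds for the free energy\<close>

text \<open>One polygon is chosen for each of the finitely many patterns, and its left part replaces
  the original one. \<open>C\<close> depends only on the chosen polygons, hence only on
  \<open>L\<close> and \<open>M\<close>.\<close>

lemma ex_bounded_left_closure:
  "\<exists>C. \<forall>\<pi>\<in>cylinder_polygons L M. (\<exists>v\<in>\<Union>\<pi>. 0 \<le> fst v) \<longrightarrow>
     (\<exists>\<rho>\<in>cylinder_polygons L M. (\<forall>v. 0 \<le> fst v \<longrightarrow> {e\<in>\<rho>. v \<in> e} = {e\<in>\<pi>. v \<in> e}) \<and>
        (\<forall>v\<in>\<Union>\<rho>. - int C \<le> fst v))"
proof -
  define X where "X = {\<pi> \<in> cylinder_polygons L M. \<exists>v\<in>\<Union>\<pi>. 0 \<le> fst v}"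
  let ?A = "{0::int} \<times> grid L M"
  have fin: "finite (pattern ` X)"
  proof (rule finite_subset)
    show "pattern ` X \<subseteq> Pow ?A \<times> Pow (?A \<times> ?A)"
    proof (rule image_subsetI)
      fix \<pi> assume "\<pi> \<in> X"
      then have cyl: "\<pi> \<in> cylinder_polygons L M" by (simp add: X_def)
      have "boundary \<pi> \<subseteq> ?A"
      proof
        fix v assume "v \<in> boundary \<pi>"
        then obtain e where e: "e \<in> left_part \<pi>" "v \<in> e" "0 \<le> fst v" unfolding boundary_def by blast
        have "fst v = 0" by (rule left_part_cross(2)[OF cylinder_polygonsD(1)[OF cyl] e])
        moreover have "v \<in> \<Union>\<pi>" using e(1,2) by (auto simp: left_part_def)
        then have "snd v \<in> grid L M" by (rule cylinder_polygonsD(2)[OF cyl])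
        ultimately show "v \<in> ?A" by (simp add: mem_Times_iff)
      qed
      then show "pattern \<pi> \<in> Pow ?A \<times> Pow (?A \<times> ?A)" unfolding pattern_def by blast
    qed
    show "finite (Pow ?A \<times> Pow (?A \<times> ?A))" using finite_grid by simp
  qed
  define r where "r = inv_into X pattern"
  have r: "r p \<in> X" "pattern (r p) = p" if "p \<in> pattern ` X" for p
    using that unfolding r_def by (rule inv_into_into, intro f_inv_into_f)
  define S where "S = (\<Union>p\<in>pattern ` X. \<Union>(r p))"
  have "finite S"
    unfolding S_def
  proof (rule finite_UN_I[OF fin])
    fix p assume "p \<in> pattern ` X"
    then have "r p \<in> cylinder_polygons L M" using r(1) by (simp add: X_def)
    then show "finite (\<Union>(r p))" by (intro polygon_finite_verts cylinder_polygonsD(1))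
  qed
  \<comment> \<open>A crude bound for every single coordinate: the sum of the absolute values of all
    of them.\<close>
  define C where "C = (\<Sum>v\<in>S. nat \<bar>fst v\<bar>)"
  have C: "- int C \<le> fst v" if "v \<in> S" for v
  proof -
    have "nat \<bar>fst v\<bar> \<le> C" unfolding C_def using that \<open>finite S\<close> by (intro member_le_sum) auto
    then show ?thesis by linarith
  qed
  show ?thesis
  proof (intro exI[of _ C] ballI impI)
    fix \<pi> assume cyl: "\<pi> \<in> cylinder_polygons L M" and hit: "\<exists>v\<in>\<Union>\<pi>. 0 \<le> fst v"
    then have p: "pattern \<pi> \<in> pattern ` X" by (auto simp: X_def)
    let ?\<pi>' = "r (pattern \<pi>)"
    have cyl': "?\<pi>' \<in> cylinder_polygons L M" and hit': "\<exists>v\<in>\<Union>?\<pi>'. 0 \<le> fst v"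
      using r(1)[OF p] by (simp_all add: X_def)
    have sub: "\<Union>?\<pi>' \<subseteq> S" unfolding S_def using p by blast
    note G = cylinder_polygonsD(1)[OF cyl] cylinder_polygonsD(1)[OF cyl'] r(2)[OF p]
    let ?G = "glue ?\<pi>' \<pi>"
    have "snd ` \<Union>?G \<subseteq> grid L M"
    proof (rule image_subsetI)
      fix v assume "v \<in> \<Union>?G"
      then have "v \<in> \<Union>?\<pi>' \<or> v \<in> \<Union>\<pi>" unfolding glue_def left_part_def right_part_def by blast
      then show "snd v \<in> grid L M"
        using cylinder_polygonsD(2)[OF cyl] cylinder_polygonsD(2)[OF cyl'] by (elim disjE)
    qed
    then have G1: "?G \<in> cylinder_polygons L M"
      using polygon_glue[OF G hit hit'] by (simp add: cylinder_polygons_def)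
    have G2: "\<forall>v. 0 \<le> fst v \<longrightarrow> {e\<in>?G. v \<in> e} = {e\<in>\<pi>. v \<in> e}"
      using glue_at_right[OF G hit hit'] by (intro allI impI)
    have G3: "- int C \<le> fst v" if v: "v \<in> \<Union>?G" for v
    proof (cases "0 \<le> fst v")
      case False
      then have v0: "fst v < 0" by simp
      have "{e\<in>?G. v \<in> e} \<noteq> {}" using v by blast
      then have "v \<in> \<Union>?\<pi>'" using glue_at_left[OF G hit hit' v0] by blast
      then show ?thesis using sub C by blast
    qed simp
    show "\<exists>\<rho>\<in>cylinder_polygons L M.
        (\<forall>v. 0 \<le> fst v \<longrightarrow> {e\<in>\<rho>. v \<in> e} = {e\<in>\<pi>. v \<in> e}) \<and> (\<forall>v\<in>\<Union>\<rho>. - int C \<le> fst v)"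
      by (intro bexI[OF _ G1] conjI ballI G2 G3)
  qed
qed

lemma edges_at_reflect:
  "{e\<in>gmap (reflect c) \<pi>. v \<in> e} = gmap (reflect c) {e\<in>\<pi>. reflect c v \<in> e}"
proof -
  have "v \<in> reflect c ` e \<longleftrightarrow> reflect c v \<in> e" for e
  proof
    assume "v \<in> reflect c ` e"
    then obtain u where "u \<in> e" "v = reflect c u" by (rule imageE)
    then show "reflect c v \<in> e" by (simp add: reflect_def)
  next
    assume "reflect c v \<in> e"
    then show "v \<in> reflect c ` e" by (rule rev_image_eqI) (simp add: reflect_def)
  qed
  then show ?thesis using gmap_filter[of "reflect c" \<pi> "\<lambda>e. v \<in> e"] by simp
qed

lemma mem_Union_cong: "{e\<in>\<rho>. v \<in> e} = {e\<in>\<pi>. v \<in> e} \<Longrightarrow> v \<in> \<Union>\<rho> \<longleftrightarrow> v \<in> \<Union>\<pi>"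
  by blast

lemma window_cong:
  assumes "\<And>v. 0 \<le> fst v \<Longrightarrow> fst v < int s \<Longrightarrow> {e\<in>\<rho>. v \<in> e} = {e\<in>\<pi>. v \<in> e}"
  shows "window s \<rho> = window s \<pi>"
  unfolding window_def using assms by blast

text \<open>The left closure is applied twice, with a reflection in between that brings the last
  plane \<open>s - 1\<close> of the window to 0. The second exchange leaves all edges at planes up
  to \<open>s - 1\<close> unchanged, so it does not undo the first. It matters that \<open>C\<close>
  is chosen before \<open>s\<close>.\<close>

lemma ex_bounded_closure:
  "\<exists>C. \<forall>s>0. \<forall>w\<in>windows L M s. \<exists>\<pi>\<in>cylinder_polygons L M. window s \<pi> = w \<and>
     (\<exists>v\<in>\<Union>\<pi>. fst v = 0) \<and> (\<forall>v\<in>\<Union>\<pi>. - int C \<le> fst v \<and> fst v \<le> int (s - 1) + int C)"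
proof -
  obtain C where "\<forall>\<pi>\<in>cylinder_polygons L M. (\<exists>v\<in>\<Union>\<pi>. 0 \<le> fst v) \<longrightarrow>
     (\<exists>\<rho>\<in>cylinder_polygons L M. (\<forall>v. 0 \<le> fst v \<longrightarrow> {e\<in>\<rho>. v \<in> e} = {e\<in>\<pi>. v \<in> e}) \<and>
        (\<forall>v\<in>\<Union>\<rho>. - int C \<le> fst v))"
    using ex_bounded_left_closure[of L M] by (rule exE)
  note C = this[rule_format]
  show ?thesis
  proof (intro exI[of _ C] allI impI ballI)
    fix s :: nat and w assume s: "0 < s" and w: "w \<in> windows L M s"
    let ?c = "int (s - 1)"
    obtain \<pi> where sp: "\<pi> \<in> spanning L M s" "w = window s \<pi>"
      using w unfolding windows_def by (rule imageE)
    then have \<pi>: "\<pi> \<in> cylinder_polygons L M" "window s \<pi> = w" by (simp_all add: spanning_def)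
    have "\<exists>v\<in>\<Union>\<pi>. fst v = int 0" using sp(1) s by (simp only: spanning_def mem_Collect_eq)
    then obtain a where a: "a \<in> \<Union>\<pi>" "fst a = 0" unfolding of_nat_0 by (rule bexE)
    then have "\<exists>v\<in>\<Union>\<pi>. 0 \<le> fst v" by (intro bexI[of _ a]) simp_all
    from C[OF \<pi>(1) this] obtain \<pi>1 where "\<pi>1 \<in> cylinder_polygons L M"
      "\<forall>v. 0 \<le> fst v \<longrightarrow> {e\<in>\<pi>1. v \<in> e} = {e\<in>\<pi>. v \<in> e}" "\<forall>v\<in>\<Union>\<pi>1. - int C \<le> fst v"
      by (elim bexE conjE)
    note \<pi>1 = this(1) this(2,3)[rule_format]
    have a1: "a \<in> \<Union>\<pi>1" using a(1) unfolding mem_Union_cong[OF \<pi>1(2)[OF eq_refl[OF a(2)[symmetric]]]] .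
    define \<pi>2 where "\<pi>2 = gmap (reflect ?c) \<pi>1"
    have "reflect ?c a \<in> \<Union>\<pi>2" unfolding \<pi>2_def Union_gmap using a1 by (rule imageI)
    moreover have "0 \<le> fst (reflect ?c a)" using a(2) by simp
    ultimately have hit2: "\<exists>v\<in>\<Union>\<pi>2. 0 \<le> fst v" by (rule bexI[rotated])
    have "\<pi>2 \<in> cylinder_polygons L M" unfolding \<pi>2_def by (rule cylinder_reflect[OF \<pi>1(1)])
    from C[OF this hit2] obtain \<pi>3 where "\<pi>3 \<in> cylinder_polygons L M"
      "\<forall>v. 0 \<le> fst v \<longrightarrow> {e\<in>\<pi>3. v \<in> e} = {e\<in>\<pi>2. v \<in> e}" "\<forall>v\<in>\<Union>\<pi>3. - int C \<le> fst v"
      by (elim bexE conjE)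
    note \<pi>3 = this(1) this(2,3)[rule_format]
    define \<rho> where "\<rho> = gmap (reflect ?c) \<pi>3"
    have \<rho>: "\<rho> \<in> cylinder_polygons L M" unfolding \<rho>_def by (rule cylinder_reflect[OF \<pi>3(1)])
    have at: "{e\<in>\<rho>. v \<in> e} = {e\<in>\<pi>1. v \<in> e}" if "fst v \<le> ?c" for v
    proof -
      have "{e\<in>\<rho>. v \<in> e} = gmap (reflect ?c) {e\<in>\<pi>2. reflect ?c v \<in> e}"
        unfolding \<rho>_def edges_at_reflect using \<pi>3(2)[of "reflect ?c v"] that by simp
      also have "\<dots> = {e\<in>gmap (reflect ?c) \<pi>2. v \<in> e}" by (rule edges_at_reflect[symmetric])
      finally show ?thesis by (simp add: \<pi>2_def)
    qed
    have "window s \<rho> = window s \<pi>"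
    proof (rule window_cong)
      fix v :: vertex assume "0 \<le> fst v" "fst v < int s"
      then show "{e\<in>\<rho>. v \<in> e} = {e\<in>\<pi>. v \<in> e}" using at[of v] \<pi>1(2)[of v] by simp
    qed
    moreover have "a \<in> \<Union>\<rho>" using a1 mem_Union_cong[OF at[of a]] a(2) s by simp
    moreover have "- int C \<le> fst v \<and> fst v \<le> ?c + int C" if v: "v \<in> \<Union>\<rho>" for v
    proof
      obtain u where "u \<in> \<Union>\<pi>3" "v = reflect ?c u" using v unfolding \<rho>_def Union_gmap by (rule imageE)
      then show "fst v \<le> ?c + int C" using \<pi>3(3)[of u] by simp
      show "- int C \<le> fst v"
      proof (cases "0 \<le> fst v")
        case False
        then have "v \<in> \<Union>\<pi>1" using v mem_Union_cong[OF at[of v]] by simp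
        then show ?thesis by (rule \<pi>1(3))
      qed simp
    qed
    ultimately show "\<exists>\<pi>\<in>cylinder_polygons L M. window s \<pi> = w \<and> (\<exists>v\<in>\<Union>\<pi>. fst v = 0) \<and>
        (\<forall>v\<in>\<Union>\<pi>. - int C \<le> fst v \<and> fst v \<le> int (s - 1) + int C)"
      using \<rho> \<pi>(2) a(2) by (intro bexI[of _ \<rho>] conjI bexI[of _ a] ballI) simp_all
  qed
qed

text \<open>The leftmost vertex is moved to x = 0, which takes a translation by at most
  \<open>C\<close>. The length is confined to an interval because the polygon contains a full window
  and sits in at most \<open>s + 2 * C\<close> planes.\<close>

lemma normalize_polygon:
  assumes cyl: "\<pi> \<in> cylinder_polygons L M" and s: "0 < s"
    and full: "card (window_verts s \<pi>) = tube_width L M * s"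
    and hit: "\<exists>v\<in>\<Union>\<pi>. fst v = 0"
    and range: "\<And>v. v \<in> \<Union>\<pi> \<Longrightarrow> - int C \<le> fst v \<and> fst v \<le> int (s - 1) + int C"
  obtains a n where "a \<le> C" "n \<in> {tube_width L M * s..tube_width L M * (s + 2 * C)}"
    "gmap (shift (int a)) \<pi> \<in> polygons L M n" "polygon_span (gmap (shift (int a)) \<pi>) \<le> int (s + 2 * C)"
proof -
  note pol = cylinder_polygonsD(1)[OF cyl]
  have fin: "finite (fst ` \<Union>\<pi>)" "fst ` \<Union>\<pi> \<noteq> {}"
    using polygon_finite_verts[OF pol] polygon_verts_nonempty[OF pol] by auto
  define b where "b = Min (fst ` \<Union>\<pi>)"
  obtain v where v: "v \<in> \<Union>\<pi>" "fst v = b" using Min_in[OF fin] unfolding b_def by (metis imageE)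
  have b: "b \<le> fst u" if "u \<in> \<Union>\<pi>" for u unfolding b_def using fin that by (intro Min_le) auto
  have "b \<le> 0" using hit b by force
  have "- int C \<le> b" using range[OF v(1)] v(2) by simp
  define a where "a = nat (- b)"
  have a: "b = - int a" "a \<le> C" using \<open>b \<le> 0\<close> \<open>- int C \<le> b\<close> by (auto simp: a_def)
  let ?\<pi> = "gmap (shift (int a)) \<pi>"
  have U: "\<Union>?\<pi> = shift (int a) ` \<Union>\<pi>" by (rule Union_gmap)
  have ge: "0 \<le> fst u" if "u \<in> \<Union>?\<pi>" for u
  proof -
    obtain u' where "u' \<in> \<Union>\<pi>" "u = shift (int a) u'" using \<open>u \<in> \<Union>?\<pi>\<close> unfolding U by (rule imageE)
    then show ?thesis using b[of u'] a(1) by simp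
  qed
  have "shift (int a) v \<in> \<Union>?\<pi>" "fst (shift (int a) v) = 0" unfolding U using v a(1) by auto
  then have "?\<pi> \<in> tube_polygons L M"
    unfolding tube_polygons_iff using cylinder_shift[OF cyl] ge by blast
  then have P: "?\<pi> \<in> polygons L M (card \<pi>)" by (simp add: polygons_def card_gmap[OF inj_shift])
  have "\<Union>\<pi> \<subseteq> {- int C..int (s - 1) + int C} \<times> grid L M"
  proof
    fix u assume "u \<in> \<Union>\<pi>"
    then show "u \<in> {- int C..int (s - 1) + int C} \<times> grid L M"
      unfolding mem_Times_iff atLeastAtMost_iff by (intro conjI[OF range cylinder_polygonsD(2)[OF cyl]])
  qed
  then have "card (\<Union>\<pi>) \<le> card ({- int C..int (s - 1) + int C} \<times> grid L M)"
    using finite_grid by (intro card_mono) auto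
  moreover have "card {- int C..int (s - 1) + int C} = s + 2 * C"
    unfolding card_atLeastAtMost_int using s by linarith
  then have "card ({- int C..int (s - 1) + int C} \<times> grid L M) = (s + 2 * C) * tube_width L M"
    by (simp only: card_cartesian_product card_grid)
  ultimately have "card \<pi> \<le> tube_width L M * (s + 2 * C)"
    by (simp only: polygon_card_verts[OF pol] mult.commute)
  moreover have "card (window_verts s \<pi>) \<le> card (\<Union>\<pi>)"
    using polygon_finite_verts[OF pol] by (intro card_mono) (auto simp: window_verts_def)
  then have "tube_width L M * s \<le> card \<pi>" using full polygon_card_verts[OF pol] by simp
  moreover have "polygon_span ?\<pi> \<le> int (s + 2 * C)"
  proof -
    obtain u where u: "u \<in> \<Union>?\<pi>" "fst u = polygon_span ?\<pi>" by (rule polygon_span_attained[OF polygon_shift[OF pol]])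
    then obtain u' where "u' \<in> \<Union>\<pi>" "u = shift (int a) u'" unfolding U by blast
    moreover have "int (s - 1) = int s - 1" using s by simp
    ultimately show ?thesis using range[of u'] a(2) u(2) by simp
  qed
  ultimately show ?thesis using that[of a "card \<pi>"] a(2) P by simp
qed

text \<open>A window is recovered from its polygon and the translation \<open>a\<close>, so each
  polygon is used at most \<open>C + 1\<close> times. For \<open>f \<le> 0\<close> an upper bound on
  the span is a lower bound on the weight.\<close>

lemma full_windows_le_partition_function:
  "\<exists>C. \<forall>s>0. \<forall>f\<le>0. real (card (full_windows L M s)) * exp (f * real (s + 2 * C)) \<le>
     real (C + 1) * (\<Sum>n\<in>{tube_width L M * s..tube_width L M * (s + 2 * C)}. partition_function L M n f)"
proof -
  obtain C where C: "\<And>s w. 0 < s \<Longrightarrow> w \<in> windows L M s \<Longrightarrow>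
      \<exists>\<pi>\<in>cylinder_polygons L M. window s \<pi> = w \<and> (\<exists>v\<in>\<Union>\<pi>. fst v = 0) \<and>
        (\<forall>v\<in>\<Union>\<pi>. - int C \<le> fst v \<and> fst v \<le> int (s - 1) + int C)"
    using ex_bounded_closure[of L M] by meson
  show ?thesis
  proof (intro exI[of _ C] allI impI)
    fix s :: nat and f :: real assume s: "0 < s" and f: "f \<le> 0"
    let ?W = "tube_width L M"
    let ?I = "{?W * s..?W * (s + 2 * C)}"
    define R where "R = (\<lambda>n. {\<pi> \<in> polygons L M n. polygon_span \<pi> \<le> int (s + 2 * C)})"
    have finR: "finite (\<Union>n\<in>?I. R n)" using finite_polygons by (auto simp: R_def)
    have "full_windows L M s \<subseteq> (\<lambda>(\<rho>, a). window s (gmap (shift (- int a)) \<rho>)) ` ((\<Union>n\<in>?I. R n) \<times> {..C})"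
    proof
      fix w assume w: "w \<in> full_windows L M s"
      then have "w \<in> windows L M s" and cw: "card (window_verts s w) = ?W * s"
        by (simp_all add: full_windows_def)
      then obtain \<pi> where \<pi>: "\<pi> \<in> cylinder_polygons L M" "window s \<pi> = w" "\<exists>v\<in>\<Union>\<pi>. fst v = 0"
        "\<And>v. v \<in> \<Union>\<pi> \<Longrightarrow> - int C \<le> fst v \<and> fst v \<le> int (s - 1) + int C"
        using C[OF s, of w] by blast
      have "card (window_verts s \<pi>) = ?W * s" using cw unfolding \<pi>(2)[symmetric] by simp
      then obtain a n where an: "a \<le> C" "n \<in> ?I" "gmap (shift (int a)) \<pi> \<in> polygons L M n"
        "polygon_span (gmap (shift (int a)) \<pi>) \<le> int (s + 2 * C)"
        by (rule normalize_polygon[OF \<pi>(1) s _ \<pi>(3,4)])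
      then have "(gmap (shift (int a)) \<pi>, a) \<in> (\<Union>n\<in>?I. R n) \<times> {..C}" by (auto simp: R_def)
      then show "w \<in> (\<lambda>(\<rho>, a). window s (gmap (shift (- int a)) \<rho>)) ` ((\<Union>n\<in>?I. R n) \<times> {..C})"
        by (rule rev_image_eqI) (simp add: gmap_shift_shift \<pi>(2))
    qed
    then have "card (full_windows L M s) \<le> card ((\<Union>n\<in>?I. R n) \<times> {..C})"
      using finR by (intro surj_card_le) auto
    also have "\<dots> = card (\<Union>n\<in>?I. R n) * (C + 1)" by (simp add: card_cartesian_product)
    also have "\<dots> \<le> (\<Sum>n\<in>?I. card (R n)) * (C + 1)" by (intro mult_right_mono card_UN_le) auto
    finally have "card (full_windows L M s) \<le> (\<Sum>n\<in>?I. card (R n)) * (C + 1)" .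
    then have "real (card (full_windows L M s)) \<le> real ((\<Sum>n\<in>?I. card (R n)) * (C + 1))"
      by (rule of_nat_mono)
    then have "real (card (full_windows L M s)) * exp (f * real (s + 2 * C)) \<le>
        real ((\<Sum>n\<in>?I. card (R n)) * (C + 1)) * exp (f * real (s + 2 * C))"
      by (intro mult_right_mono) auto
    also have "\<dots> = real (C + 1) * (\<Sum>n\<in>?I. real (card (R n)) * exp (f * real (s + 2 * C)))"
      unfolding sum_distrib_right[symmetric] by (simp add: algebra_simps)
    also have "\<dots> \<le> real (C + 1) * (\<Sum>n\<in>?I. partition_function L M n f)"
    proof (intro mult_left_mono sum_mono)
      fix n
      have "real (card (R n)) * exp (f * real (s + 2 * C)) = (\<Sum>\<pi>\<in>R n. exp (f * real (s + 2 * C)))"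
        by simp
      also have "\<dots> \<le> (\<Sum>\<pi>\<in>R n. exp (f * real_of_int (polygon_span \<pi>)))"
      proof (rule sum_mono)
        fix \<pi> assume "\<pi> \<in> R n"
        then have "real_of_int (polygon_span \<pi>) \<le> real_of_int (int (s + 2 * C))"
          unfolding of_int_le_iff by (simp add: R_def)
        then have "real_of_int (polygon_span \<pi>) \<le> real (s + 2 * C)" by (simp only: of_int_of_nat_eq)
        then show "exp (f * real (s + 2 * C)) \<le> exp (f * real_of_int (polygon_span \<pi>))"
          using f by (simp add: mult_left_mono_neg)
      qed
      also have "\<dots> \<le> partition_function L M n f"
        unfolding partition_function_eq by (intro sum_mono2 finite_polygons) (auto simp: R_def)
      finally show "real (card (R n)) * exp (f * real (s + 2 * C)) \<le> partition_function L M n f" .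
    qed simp
    finally show "real (card (full_windows L M s)) * exp (f * real (s + 2 * C)) \<le>
        real (C + 1) * (\<Sum>n\<in>?I. partition_function L M n f)" .
  qed
qed

section \<open>Passage to exponential rates\<close>

lemma partition_function_odd:
  assumes "odd n"
  shows "partition_function L M n f = 0"
proof -
  have "polygons L M n = {}" using polygon_even polygonsD(2,5) assms by blast
  then show ?thesis by (simp add: partition_function_eq)
qed

text \<open>If \<open>x\<close> were larger than \<open>y\<close>, the quotient of the exponentials
  would eventually exceed any constant.\<close>

lemma linear_exp_bound:
  fixes x y K :: real
  assumes "\<And>s. N \<le> s \<Longrightarrow> exp (x * real s) \<le> K * exp (y * real s)"
  shows "x \<le> y"
proof (rule ccontr)
  assume "\<not> x \<le> y"
  then have xy: "0 < x - y" by simp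
  obtain k :: nat where k: "ln (max K 1) / (x - y) < real k" using reals_Archimedean2 by blast
  define s where "s = max k N"
  have "exp (x * real s) \<le> K * exp (y * real s)" using assms by (simp add: s_def)
  also have "\<dots> \<le> max K 1 * exp (y * real s)" by (intro mult_right_mono) auto
  finally have "exp (x * real s) * exp (- (y * real s)) \<le> max K 1 * exp (y * real s) * exp (- (y * real s))"
    by (intro mult_right_mono) auto
  then have "exp ((x - y) * real s) \<le> max K 1"
    by (simp add: mult.assoc exp_add[symmetric] algebra_simps)
  then have "(x - y) * real s \<le> ln (max K 1)" by (simp add: ln_ge_iff)
  then have "real s \<le> ln (max K 1) / (x - y)" using xy by (simp add: pos_le_divide_eq mult.commute)
  moreover have "real k \<le> real s" by (simp add: s_def)
  ultimately show False using k by simp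
qed

text \<open>The rates are compared per plane: the full blocks of \<open>s\<close> planes have total
  weight at least about \<open>exp ((\<beta> + f) * s)\<close>, and the polygons closing them have
  length about \<open>W * s\<close>, which produces the factor \<open>W\<close> on the
  right.\<close>

lemma free_energy_lower:
  assumes L: "1 \<le> L" and f: "f \<le> 0"
    and lim: "(\<lambda>m. ln (partition_function L M (2 * m) f) / real (2 * m)) \<longlonglongrightarrow> l"
  shows "full_block_growth L M + f \<le> l * real (tube_width L M)"
proof (rule field_le_epsilon)
  fix d :: real assume d: "0 < d"
  let ?W = "tube_width L M"
  define e where "e = d / real ?W"
  have W: "2 \<le> ?W" by (rule tube_width_ge_2[OF L])
  have e: "0 < e" "e * real ?W = d" using d W by (simp_all add: e_def)
  let ?r = "l + e"
  have "\<forall>\<^sub>F m in sequentially. ln (partition_function L M (2 * m) f) / real (2 * m) < ?r"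
    using lim e(1) by (intro order_tendstoD(2)[OF lim]) simp
  then obtain N where N: "\<And>m. N \<le> m \<Longrightarrow> ln (partition_function L M (2 * m) f) / real (2 * m) < ?r"
    unfolding eventually_sequentially by blast
  \<comment> \<open>The limit concerns even lengths only; as odd ones contribute nothing, the bound
    extends to all large \<open>n\<close>. The value 0 is treated apart because its logarithm gives
    no information.\<close>
  have Z: "partition_function L M n f \<le> exp (?r * real n)" if n: "2 * N + 2 \<le> n" for n
  proof (cases "even n")
    case True
    then obtain m where m: "n = 2 * m" by (rule evenE)
    have nn: "0 \<le> partition_function L M n f" by (simp add: partition_function_eq sum_nonneg)
    show ?thesis
    proof (cases "partition_function L M n f = 0")
      case False
      then have pos: "0 < partition_function L M n f" using nn by simp
      have "ln (partition_function L M n f) < ?r * real n"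
        using N[of m] n by (simp add: m pos_divide_less_eq)
      then have "exp (ln (partition_function L M n f)) \<le> exp (?r * real n)" by simp
      then show ?thesis using pos by simp
    qed simp
  qed (simp add: partition_function_odd)
  obtain C where C: "\<And>s f. 0 < s \<Longrightarrow> f \<le> 0 \<Longrightarrow>
     real (card (full_windows L M s)) * exp (f * real (s + 2 * C)) \<le>
     real (C + 1) * (\<Sum>n\<in>{?W * s..?W * (s + 2 * C)}. partition_function L M n f)"
    using full_windows_le_partition_function[of L M] by meson
  \<comment> \<open>Collects what is independent of \<open>s\<close>: the number of translations,
    the number of admissible lengths, the excess of the length over \<open>?W * s\<close>, and the
    excess \<open>2 * C\<close> of the span.\<close>
  define K where "K = real (C + 1) * (real (?W * (2 * C) + 1) * exp (\<bar>?r\<bar> * real (?W * (2 * C)))) *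
      exp (- (f * real (2 * C)))"
  have "full_block_growth L M + f \<le> ?r * real ?W"
  proof (rule linear_exp_bound)
    fix s assume s: "2 * N + 2 \<le> s"
    have sW: "s \<le> ?W * s" using W by simp
    let ?I = "{?W * s..?W * (s + 2 * C)}"
    have "(\<Sum>n\<in>?I. partition_function L M n f) \<le>
        (\<Sum>n\<in>?I. exp (?r * real (?W * s)) * exp (\<bar>?r\<bar> * real (?W * (2 * C))))"
    proof (rule sum_mono)
      fix n assume n: "n \<in> ?I"
      then obtain i where i: "n = ?W * s + i" "i \<le> ?W * (2 * C)"
        by (auto simp: le_iff_add distrib_left)
      \<comment> \<open>The rate \<open>?r\<close> may be negative, hence the absolute
        value.\<close>
      have "?r * real i \<le> \<bar>?r\<bar> * real (?W * (2 * C))"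
        using i(2) by (intro mult_mono) (auto simp del: of_nat_mult)
      then have "?r * real n \<le> ?r * real (?W * s) + \<bar>?r\<bar> * real (?W * (2 * C))"
        by (simp add: i(1) distrib_left)
      then have "exp (?r * real n) \<le> exp (?r * real (?W * s)) * exp (\<bar>?r\<bar> * real (?W * (2 * C)))"
        by (simp add: exp_add[symmetric])
      moreover have "2 * N + 2 \<le> n" using n s sW unfolding atLeastAtMost_iff by linarith
      ultimately show "partition_function L M n f \<le>
          exp (?r * real (?W * s)) * exp (\<bar>?r\<bar> * real (?W * (2 * C)))" using Z[of n] by simp
    qed
    also have "\<dots> = real (?W * (2 * C) + 1) * exp (\<bar>?r\<bar> * real (?W * (2 * C))) * exp (?r * real (?W * s))"
    proof -
      have "card ?I = ?W * (2 * C) + 1" by (simp add: distrib_left)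
      then show ?thesis by (simp only: sum_constant mult_ac)
    qed
    finally have sum_le: "(\<Sum>n\<in>?I. partition_function L M n f) \<le>
        real (?W * (2 * C) + 1) * exp (\<bar>?r\<bar> * real (?W * (2 * C))) * exp (?r * real (?W * s))" .
    have "exp ((full_block_growth L M + f) * real s) =
        exp (full_block_growth L M * real s) * exp (f * real (s + 2 * C)) * exp (- (f * real (2 * C)))"
      by (simp add: exp_add[symmetric] algebra_simps)
    also have "\<dots> \<le> real (card (full_windows L M s)) * exp (f * real (s + 2 * C)) * exp (- (f * real (2 * C)))"
      using full_block_growth_limit(2)[OF L] by (intro mult_right_mono) auto
    also have "\<dots> \<le> real (C + 1) * (\<Sum>n\<in>?I. partition_function L M n f) * exp (- (f * real (2 * C)))"
      using s by (intro mult_right_mono C f) auto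
    also have "\<dots> \<le> real (C + 1) * (real (?W * (2 * C) + 1) * exp (\<bar>?r\<bar> * real (?W * (2 * C))) *
        exp (?r * real (?W * s))) * exp (- (f * real (2 * C)))"
      using sum_le by (intro mult_right_mono mult_left_mono) auto
    also have "\<dots> = K * exp (?r * real ?W * real s)"
      by (simp only: K_def of_nat_mult mult_ac)
    finally show "exp ((full_block_growth L M + f) * real s) \<le> K * exp (?r * real ?W * real s)" .
  qed
  then show "full_block_growth L M + f \<le> l * real ?W + d" using e(2) by (simp add: distrib_right)
qed

text \<open>\<open>t\<close> is fixed first, such that there are strictly fewer than
  \<open>exp (\<beta> * t)\<close> full blocks, where \<open>\<beta>\<close> includes
  \<open>e\<close>. The gap is a positive number independent of \<open>f\<close>, so for large
  \<open>z\<close> it outweighs the share \<open>T / z\<close> of the non-full windows.\<close>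

lemma free_energy_upper:
  assumes L: "1 \<le> L" and e: "0 < e"
  shows "\<forall>\<^sub>F f in at_bot. \<exists>l \<le> (f + full_block_growth L M + e) / real (tube_width L M).
    (\<lambda>m. ln (partition_function L M (2 * m) f) / real (2 * m)) \<longlonglongrightarrow> l"
proof -
  let ?W = "tube_width L M"
  define \<beta> where "\<beta> = full_block_growth L M + e"
  have W: "0 < ?W" using tube_width_ge_2[OF L, of M] by simp
  have "\<forall>\<^sub>F t in sequentially. ln (real (full_block_count L M t)) / real t < \<beta>"
    using e by (intro order_tendstoD(2)[OF full_block_growth_limit(1)[OF L]]) (simp add: \<beta>_def)
  then have "\<forall>\<^sub>F t in sequentially. 0 < t \<and> ln (real (full_block_count L M t)) / real t < \<beta>"
    using eventually_gt_at_top[of 0] by eventually_elim simp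
  then obtain t where t: "0 < t" "ln (real (full_block_count L M t)) / real t < \<beta>"
    unfolding eventually_sequentially by blast
  define b where "b = real (card (full_windows L M t))"
  define T where "T = real (card (windows L M t))"
  have b: "0 < b" using full_windows_nonempty[OF L] finite_full_windows by (simp add: b_def card_gt_0_iff)
  have "ln b < \<beta> * real t" using t by (simp add: b_def full_block_count_eq pos_divide_less_eq)
  then have "exp (ln b) < exp (\<beta> * real t)" by simp
  then have \<delta>: "0 < exp (\<beta> * real t) - b" using b by simp
  \<comment> \<open>Chosen so that a full plane, with weight \<open>exp f * z f ^ ?W\<close>,
    contributes exactly \<open>exp (- \<beta>)\<close>.\<close>
  define z where "z = (\<lambda>f. exp (- (f + \<beta>) / real ?W))"
  \<comment> \<open>The threshold for \<open>z f\<close> from which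
    \<open>z f * b + T \<le> z f * exp (\<beta> * real t)\<close> holds, raised to 1 as
    \<open>window_sum_le\<close> demands.\<close>
  define Y where "Y = max 1 (T / (exp (\<beta> * real t) - b))"
  \<comment> \<open>This is \<open>Y \<le> z f\<close> solved for \<open>f\<close>.\<close>
  have "\<forall>\<^sub>F f in at_bot. f \<le> - \<beta> - real ?W * ln Y" by (rule eventually_le_at_bot)
  then show ?thesis
  proof eventually_elim
    case (elim f)
    have Y: "1 \<le> Y" "T / (exp (\<beta> * real t) - b) \<le> Y" by (simp_all add: Y_def)
    have "real ?W * ln Y \<le> - (f + \<beta>)" using elim by simp
    then have "ln Y \<le> - (f + \<beta>) / real ?W" using W by (simp add: pos_le_divide_eq mult.commute)
    then have "exp (ln Y) \<le> z f" unfolding z_def by simp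
    then have zY: "Y \<le> z f" using Y(1) by simp
    have z: "0 < z f" "1 \<le> z f" using zY Y(1) by linarith+
    have "T \<le> Y * (exp (\<beta> * real t) - b)" using Y(2) \<delta> by (simp add: pos_divide_le_eq)
    also have "\<dots> \<le> z f * (exp (\<beta> * real t) - b)" using zY \<delta> by (intro mult_right_mono) auto
    finally have T: "z f * b + T \<le> z f * exp (\<beta> * real t)" by (simp add: right_diff_distrib)
    have zW: "z f ^ (?W * t) = exp (- (f + \<beta>) * real t)"
      unfolding z_def exp_of_nat_mult[symmetric] using W by simp
    have "z f * (exp (f * real t) * window_sum L M (z f) t) = exp (f * real t) * (z f * window_sum L M (z f) t)"
      by simp
    also have "\<dots> \<le> exp (f * real t) * (z f ^ (?W * t) * (z f * b + T))"
      unfolding b_def T_def by (intro mult_left_mono window_sum_le z) simp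
    also have "\<dots> \<le> exp (f * real t) * (z f ^ (?W * t) * (z f * exp (\<beta> * real t)))"
      using z T by (intro mult_left_mono) auto
    also have "\<dots> = z f * (exp (f * real t) * exp (- (f + \<beta>) * real t) * exp (\<beta> * real t))"
      by (simp add: zW)
    also have "\<dots> = z f * 1" unfolding exp_add[symmetric] by (simp add: algebra_simps)
    finally have small: "exp (f * real t) * window_sum L M (z f) t \<le> 1"
      using z(1) by (simp only: mult_le_cancel_left_pos)
    obtain C where C: "0 < C" "\<And>n. partition_function L M n f \<le> C * real n * (1 / z f) ^ n"
      using partition_function_bound[OF z(1) t(1) small] by blast
    obtain l where l: "(\<lambda>m. ln (partition_function L M (2 * m) f) / real (2 * m)) \<longlonglongrightarrow> l" "l \<le> ln (1 / z f)"
      by (rule partition_function_limit[OF L C(1) _ C(2)]) (use z(1) in simp)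
    have "ln (1 / z f) = (f + \<beta>) / real ?W"
      using z(1) by (simp add: ln_div z_def) (simp add: diff_divide_distrib add_divide_distrib)
    then show ?case using l by (intro exI[of _ l]) (simp add: \<beta>_def add.assoc)
  qed
qed

theorem theorem5:
  fixes L M W :: nat
  assumes "M \<le> L" and "1 \<le> L" and "W = (L + 1) * (M + 1)"
  shows "((\<lambda>f. free_energy L M f - f / real W) \<longlongrightarrow> full_block_growth L M / real W) at_bot"
proof (rule tendstoI)
  fix d :: real assume d: "0 < d"
  have W: "W = tube_width L M" by (simp add: assms(3) tube_width_def)
  have W0: "0 < real W" using tube_width_ge_2[OF assms(2), of M] by (simp add: W)
  \<comment> \<open>Divided by \<open>W\<close>, the error of the upper bound becomes
    \<open>d / 2\<close>.\<close>
  define e where "e = d * real W / 2"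
  have e: "0 < e" using d W0 by (simp add: e_def)
  show "\<forall>\<^sub>F f in at_bot. dist (free_energy L M f - f / real W) (full_block_growth L M / real W) < d"
    using free_energy_upper[OF assms(2) e, of M] eventually_le_at_bot[of 0]
  proof eventually_elim
    case (elim f)
    then obtain l where l: "l \<le> (f + full_block_growth L M + e) / real W"
      "(\<lambda>m. ln (partition_function L M (2 * m) f) / real (2 * m)) \<longlonglongrightarrow> l" unfolding W by blast
    have F: "free_energy L M f = l" unfolding free_energy_def using l(2) by (rule limI)
    have "full_block_growth L M + f \<le> l * real W"
      unfolding W by (rule free_energy_lower[OF assms(2) _ l(2)]) (use elim in simp)
    then have "(full_block_growth L M + f) / real W \<le> l" using W0 by (simp add: pos_divide_le_eq)
    moreover have "e / real W < d" using W0 d by (simp add: e_def)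
    ultimately show ?case using l(1) unfolding F dist_real_def add_divide_distrib by linarith
  qed
qed

end
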